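(* Let $z(n,d)$ be the number of combinatorial types of $d$-dimensional zonotopes with $n$ generators. For fixed $d$, as $n\to\infty$, $$n^{(d^2-2d)n\left(1+O\left(\frac{1}{\log n}\right)\right)}\ \le\ z(n,d)\ \le\ n^{(d-1)^2n\left(1+O\left(\frac{\log\log n}{\log n}\right)\right)}.$$
   Context: Up to translation, a zonotope in $\mathbb{R}^d$ is a set $Z=\sum_{g\in\mathcal{G}}\mathrm{conv}\{0,g\}$ where $\mathcal{G}$ is a finite non-empty set of pairwise non-collinear non-zero vectors of $\mathbb{R}^d$ (a set of generators); all sets of generators of $Z$ have the same cardinality, called the number of generators of $Z$. Two polytopes have the same combinatorial type when their face lattices are isomorphic.
   Formalization: The dimension d is assumed to be at least 2; for d = 1 no zonotope has n ≥ 2 pairwise non-collinear generators, so z(n,1) = 0 and the stated positive lower bound fails. *)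

theory Defs
  imports "HOL-Analysis.Analysis" "HOL-Library.Landau_Symbols"
begin

definition generator_set :: "('a::real_vector) set \<Rightarrow> bool" where
  "generator_set G \<longleftrightarrow> finite G \<and> G \<noteq> {} \<and> 0 \<notin> G \<and>
     (\<forall>g\<in>G. \<forall>h\<in>G. g \<noteq> h \<longrightarrow> \<not> (\<exists>c::real. h = c *\<^sub>R g))"

definition zonotope_of :: "('a::real_vector) set \<Rightarrow> 'a set" where
  "zonotope_of G = {\<Sum>g\<in>G. t g *\<^sub>R g | t. \<forall>g\<in>G. 0 \<le> t g \<and> t g \<le> 1}"

definition zonotope_with_gens :: "('a::real_vector) set \<Rightarrow> nat \<Rightarrow> bool" where
  "zonotope_with_gens Z n \<longleftrightarrow>
     (\<exists>G a. generator_set G \<and> card G = n \<and> Z = (\<lambda>x. a + x) ` zonotope_of G)"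

text \<open>Same combinatorial type: isomorphic face lattices (faces ordered by inclusion,
  including the empty face and the polytope itself).\<close>
definition same_comb_type :: "('a::real_vector) set \<Rightarrow> ('b::real_vector) set \<Rightarrow> bool" where
  "same_comb_type P Q \<longleftrightarrow>
     (\<exists>f. bij_betw f {F. F face_of P} {F. F face_of Q} \<and>
          (\<forall>F\<in>{F. F face_of P}. \<forall>F'\<in>{F. F face_of P}. F \<subseteq> F' \<longleftrightarrow> f F \<subseteq> f F'))"

definition zonotopes_dim :: "'d::finite itself \<Rightarrow> nat \<Rightarrow> (real^'d) set set" where
  "zonotopes_dim _ n = {Z :: (real^'d) set. zonotope_with_gens Z n \<and> aff_dim Z = int CARD('d)}"

definition zcount :: "'d::finite itself \<Rightarrow> nat \<Rightarrow> nat" where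
  "zcount D n = card (zonotopes_dim D n //
     {(P, Q). P \<in> zonotopes_dim D n \<and> Q \<in> zonotopes_dim D n \<and> same_comb_type P Q})"

end

theory Submission
  imports Defs "HOL-Library.Function_Algebras"
begin

text \<open>
Faces of a zonotope correspond to the covectors of its generators, that is, to the sign vectors of
linear functionals on them.

Upper bound: the covectors are determined by the signs of the \<open>d \<times> d\<close> minors of the generators.
After normalisation these are \<open>n ^ d\<close> polynomials of degree \<open>d\<close> in \<open>n (d - 1)\<close> variables, and the
number of sign patterns of \<open>s\<close> polynomials of degree \<open>D\<close> in \<open>N\<close> variables is at most
\<open>D ^ N * ((N + 2 s + 1) choose N)\<close>. For strict patterns, put one point into each region so that the
points jointly maximise \<open>\<Sum>p. \<Sum>i. ln \<bar>F i (X p)\<bar> + (\<Sum>p. X p)\<^sup>2 / 2\<close>. They become nondegenerate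
solutions of a single system of bidegree \<open>(D, 1)\<close> in the variables \<open>x\<close> and \<open>y i = 1 / F i x\<close>, and a
multihomogeneous Bezout inequality bounds their number.

Lower bound: the vertices of a generic zonotope and their adjacency embed isometrically into the cube
\<open>{1, -1} ^ n\<close>, so that a combinatorial type arises from at most \<open>n ^ n * 2 ^ n\<close> labelled sets of
topes. If \<open>k\<close> generators are in general position, a new generator can be put into
\<open>c k ^ ((d - 1) ^ 2)\<close> different cells of the arrangement of hyperplanes they span, since each vertex
of the arrangement is the lowest point of a cell. Multiplying over \<open>k < n\<close> gives
\<open>n ^ ((d - 1) ^ 2 n)\<close> labelled sets of topes, up to a factor \<open>C ^ n\<close>, and
\<open>(d - 1) ^ 2 - 1 = d ^ 2 - 2 d\<close>.
\<close>

section \<open>Spaces of bihomogeneous polynomial functions\<close>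

text \<open>A normalised configuration has n (d - 1) parameters, and the binomial coefficient of
  about n ^ d over n (d - 1) grows like (n ^ (d - 1)) ^ (n (d - 1)); with n d parameters the
  exponent would only be d (d - 1) n. The variables y i are as many as the polynomials, so the
  ordinary Bezout number of the critical system would be exponential in n ^ d. As the system has
  degree 1 in them, a bound by bidegree lets them enter only through a binomial coefficient; it is
  obtained by comparing dimensions, not by elimination. In the lower bound the obstacle is to tell
  the cells at different vertices apart by topes alone. The generators are divided into (d - 1) ^ 2
  disjoint blocks, one for each of the d - 1 spanning vectors of each of d - 1 hyperplanes, so that
  one generator can be chosen from every block independently. The gap between the two exponents is
  exactly the factor n ^ n lost in passing from labelled to unlabelled zonotopes.\<close>

interpretation fun_space: vector_space "\<lambda>(c::real) (f::'a \<Rightarrow> real) x. c * f x"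
  by unfold_locales (auto simp: fun_eq_iff algebra_simps)

lemma sum_apply: "(\<Sum>i\<in>A. f i) x = (\<Sum>i\<in>A. f i x)"
  for f :: "'i \<Rightarrow> 'a \<Rightarrow> 'b::comm_monoid_add"
  by (induction A rule: infinite_finite_induct) auto

text \<open>The independence hypothesis concerns the indexed family, so it forces \<phi> to be
  injective: equal members would satisfy a relation with coefficients 1 and -1. Hence the exchange
  bound for the image counts the indices.\<close>

lemma card_family_le_spanning:
  fixes \<phi> :: "'i \<Rightarrow> 'a \<Rightarrow> real"
  assumes "finite I" "finite T"
    and span: "\<And>i. i \<in> I \<Longrightarrow> \<phi> i \<in> fun_space.span T"
    and indep: "\<And>c i. (\<And>x. (\<Sum>i\<in>I. c i * \<phi> i x) = 0) \<Longrightarrow> i \<in> I \<Longrightarrow> c i = 0"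
  shows "card I \<le> card T"
proof -
  have inj: "inj_on \<phi> I"
  proof (rule inj_onI, rule ccontr)
    fix i j assume ij: "i \<in> I" "j \<in> I" "\<phi> i = \<phi> j" "i \<noteq> j"
    define c where "c k = (if k = i then 1 else if k = j then -1 else (0::real))" for k
    have "(\<Sum>k\<in>I. c k * \<phi> k x) = 0" for x
    proof -
      have "(\<Sum>k\<in>I. c k * \<phi> k x) = (\<Sum>k\<in>{i,j}. c k * \<phi> k x)"
        by (rule sum.mono_neutral_right) (use ij assms(1) in \<open>auto simp: c_def\<close>)
      then show ?thesis using ij by (simp add: c_def)
    qed
    then have "c i = 0" using indep ij(1) by blast
    then show False by (simp add: c_def)
  qed
  have "fun_space.independent (\<phi> ` I)"
  proof (rule fun_space.independent_if_scalars_zero)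
    show "finite (\<phi> ` I)" using assms by simp
    fix f g assume z: "(\<Sum>x\<in>\<phi> ` I. (\<lambda>y. f x * x y)) = 0" and "g \<in> \<phi> ` I"
    then obtain i where i: "i \<in> I" "g = \<phi> i" by auto
    have "(\<Sum>i\<in>I. f (\<phi> i) * \<phi> i x) = 0" for x
    proof -
      have "(\<Sum>i\<in>I. f (\<phi> i) * \<phi> i x) = (\<Sum>h\<in>\<phi> ` I. f h * h x)"
        by (simp add: sum.reindex inj)
      also have "\<dots> = (\<Sum>x\<in>\<phi> ` I. (\<lambda>y. f x * x y)) x"
        by (simp add: sum_apply)
      finally show ?thesis by (simp add: z)
    qed
    from indep[OF this i(1)] show "f g = 0" by (simp add: i)
  qed
  from fun_space.independent_span_bound[OF assms(2) this] span have "card (\<phi> ` I) \<le> card T"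
    by auto
  then show ?thesis by (simp add: card_image inj)
qed

text \<open>A slack entry in front turns the inequality into an equation with one more summand,
  which is stars and bars.\<close>

lemma card_length_sum_list_le:
  "card {l::nat list. length l = N \<and> sum_list l \<le> a} = (N + a) choose N"
  (is "card ?A = _")
proof -
  have "bij_betw (\<lambda>l. (a - sum_list l) # l) ?A {l::nat list. size l = Suc N \<and> sum_list l = a}"
    by (rule bij_betwI[where g = tl]) (auto simp: length_Suc_conv)
  from bij_betw_same_card[OF this] show ?thesis
    using binomial_symmetric[of N "N + a"] by (simp add: card_length_sum_list add.commute)
qed

lemma finite_length_sum_list_le: "finite {l::nat list. length l = N \<and> sum_list l \<le> a}"
proof (rule finite_subset)
  show "{l::nat list. length l = N \<and> sum_list l \<le> a} \<subseteq> {l. set l \<subseteq> {..a} \<and> length l = N}"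
    by (auto dest: member_le_sum_list)
qed (simp add: finite_lists_length_eq)

section \<open>Polynomial functions of bounded bidegree\<close>

definition monomial_fun :: "nat list \<Rightarrow> (nat \<Rightarrow> real) \<Rightarrow> real" where
  "monomial_fun \<alpha> z = (\<Prod>i<length \<alpha>. z i ^ (\<alpha> ! i))"

text \<open>Variables below \<open>N\<close> carry the first degree, the next \<open>s\<close> ones
  the second. The numbers \<open>a\<close> and \<open>b\<close> are upper bounds, so constants live
  in every bidegree. Polynomials are plain functions here: closure properties, derivatives along
  lines and membership in a finite-dimensional span are all that matters.\<close>

inductive bipoly :: "nat \<Rightarrow> nat \<Rightarrow> nat \<Rightarrow> nat \<Rightarrow> ((nat \<Rightarrow> real) \<Rightarrow> real) \<Rightarrow> bool" for N s where
  const: "bipoly N s a b (\<lambda>z. c)"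
| xvar: "j < N \<Longrightarrow> 1 \<le> a \<Longrightarrow> bipoly N s a b (\<lambda>z. z j)"
| yvar: "i < s \<Longrightarrow> 1 \<le> b \<Longrightarrow> bipoly N s a b (\<lambda>z. z (N + i))"
| add: "bipoly N s a b f \<Longrightarrow> bipoly N s a b g \<Longrightarrow> bipoly N s a b (\<lambda>z. f z + g z)"
| mult: "bipoly N s a b f \<Longrightarrow> bipoly N s a' b' g \<Longrightarrow> bipoly N s (a + a') (b + b') (\<lambda>z. f z * g z)"

lemma bipoly_mono:
  assumes "bipoly N s a b f" "a \<le> a'" "b \<le> b'"
  shows "bipoly N s a' b' f"
  using bipoly.mult[OF assms(1) bipoly.const[of N s "a' - a" "b' - b" 1]] assms(2,3) by simp

lemma bipoly_more_vars:
  assumes "bipoly N 0 a b f"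
  shows "bipoly N s a b f"
  using assms by induction (auto intro: bipoly.intros)

lemma bipoly_cong_vars:
  assumes "bipoly N s a b f" "\<And>j. j < N + s \<Longrightarrow> z j = z' j"
  shows "f z = f z'"
  using assms by induction auto

lemma bipoly_sum:
  assumes "\<And>i. i \<in> A \<Longrightarrow> bipoly N s a b (f i)"
  shows "bipoly N s a b (\<lambda>z. \<Sum>i\<in>A. f i z)"
  using assms by (induction A rule: infinite_finite_induct) (auto intro: bipoly.intros)

lemma bipoly_prod:
  assumes "\<And>i. i \<in> A \<Longrightarrow> bipoly N s (a i) (b i) (f i)"
  shows "bipoly N s (\<Sum>i\<in>A. a i) (\<Sum>i\<in>A. b i) (\<lambda>z. \<Prod>i\<in>A. f i z)"
  using assms by (induction A rule: infinite_finite_induct) (auto intro: bipoly.intros)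

lemma bipoly_power:
  assumes "bipoly N s a b f"
  shows "bipoly N s (k * a) (k * b) (\<lambda>z. f z ^ k)"
  by (induction k) (auto intro!: bipoly.intros assms)

text \<open>The \<open>f' j\<close> are the partial derivatives. They keep the degree bounds of
  \<open>f\<close>, so the critical equations have the same degree as the polynomials they come
  from.\<close>

lemma bipoly_has_gradient:
  assumes "bipoly N s a b f"
  shows "\<exists>f'. (\<forall>j. bipoly N s a b (f' j)) \<and>
    (\<forall>z w t. ((\<lambda>t. f (\<lambda>j. z j + t * w j)) has_real_derivative
       (\<Sum>j<N+s. w j * f' j (\<lambda>j. z j + t * w j))) (at t))"
  using assms
proof induction
  case (const a b c)
  show ?case
    by (rule exI[of _ "\<lambda>j z. 0"]) (auto intro!: bipoly.intros)
next
  case (xvar j a b)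
  show ?case
    by (rule exI[of _ "\<lambda>i z. if i = j then 1 else 0"])
      (use xvar in \<open>auto intro!: bipoly.intros derivative_eq_intros
        simp: if_distrib[of "(*) _"] cong: if_cong\<close>)
next
  case (yvar i b a)
  show ?case
    by (rule exI[of _ "\<lambda>k z. if k = N + i then 1 else 0"])
      (use yvar in \<open>auto intro!: bipoly.intros derivative_eq_intros
        simp: if_distrib[of "(*) _"] cong: if_cong\<close>)
next
  case (add a b f g)
  then obtain f' g' where
    f': "\<forall>j. bipoly N s a b (f' j)"
      "\<And>z w t. ((\<lambda>t. f (\<lambda>j. z j + t * w j)) has_real_derivative
       (\<Sum>j<N+s. w j * f' j (\<lambda>j. z j + t * w j))) (at t)" and
    g': "\<forall>j. bipoly N s a b (g' j)"
      "\<And>z w t. ((\<lambda>t. g (\<lambda>j. z j + t * w j)) has_real_derivative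
       (\<Sum>j<N+s. w j * g' j (\<lambda>j. z j + t * w j))) (at t)" by blast
  show ?case
    by (rule exI[of _ "\<lambda>j z. f' j z + g' j z"])
      (use f' g' in \<open>auto intro!: bipoly.intros derivative_eq_intros simp: algebra_simps sum.distrib\<close>)
next
  case (mult a b f a' b' g)
  then obtain f' g' where
    f': "\<forall>j. bipoly N s a b (f' j)"
      "\<And>z w t. ((\<lambda>t. f (\<lambda>j. z j + t * w j)) has_real_derivative
       (\<Sum>j<N+s. w j * f' j (\<lambda>j. z j + t * w j))) (at t)" and
    g': "\<forall>j. bipoly N s a' b' (g' j)"
      "\<And>z w t. ((\<lambda>t. g (\<lambda>j. z j + t * w j)) has_real_derivative
       (\<Sum>j<N+s. w j * g' j (\<lambda>j. z j + t * w j))) (at t)" by blast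
  show ?case
  proof (intro exI[of _ "\<lambda>j z. f' j z * g z + f z * g' j z"] conjI allI)
    show "bipoly N s (a + a') (b + b') (\<lambda>z. f' j z * g z + f z * g' j z)" for j
      by (intro bipoly.add[OF bipoly.mult bipoly.mult]) (use f'(1) g'(1) mult.hyps in auto)
    show "((\<lambda>t. f (\<lambda>j. z j + t * w j) * g (\<lambda>j. z j + t * w j)) has_real_derivative
      (\<Sum>j<N + s. w j * (f' j (\<lambda>j. z j + t * w j) * g (\<lambda>j. z j + t * w j) +
         f (\<lambda>j. z j + t * w j) * g' j (\<lambda>j. z j + t * w j)))) (at t)" for z w t
      by (rule DERIV_cong[OF DERIV_mult[OF f'(2) g'(2)]])
        (simp add: algebra_simps sum.distrib sum_distrib_left)
  qed
qed

definition bidegree_exponents :: "nat \<Rightarrow> nat \<Rightarrow> nat \<Rightarrow> nat \<Rightarrow> nat list set" where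
  "bidegree_exponents N s a b =
     {\<alpha>. length \<alpha> = N + s \<and> sum_list (take N \<alpha>) \<le> a \<and> sum_list (drop N \<alpha>) \<le> b}"

lemma bidegree_exponents_bij:
  "bij_betw (\<lambda>(\<alpha>, \<beta>). \<alpha> @ \<beta>)
     ({l. length l = N \<and> sum_list l \<le> a} \<times> {l. length l = s \<and> sum_list l \<le> b})
     (bidegree_exponents N s a b)"
  by (rule bij_betwI[where g = "\<lambda>\<alpha>. (take N \<alpha>, drop N \<alpha>)"]) (auto simp: bidegree_exponents_def)

lemma finite_bidegree_exponents: "finite (bidegree_exponents N s a b)"
  using bij_betw_finite[OF bidegree_exponents_bij] finite_length_sum_list_le by blast

lemma card_bidegree_exponents:
  "card (bidegree_exponents N s a b) = ((N + a) choose N) * ((s + b) choose s)"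
  using bij_betw_same_card[OF bidegree_exponents_bij, of N a s b]
  by (simp add: card_cartesian_product card_length_sum_list_le)

lemma monomial_fun_mult:
  assumes "length \<alpha> = length \<beta>"
  shows "monomial_fun \<alpha> z * monomial_fun \<beta> z = monomial_fun (map2 (+) \<alpha> \<beta>) z"
  using assms by (simp add: monomial_fun_def prod.distrib[symmetric] power_add)

lemma monomial_fun_unit:
  assumes "j < n"
  shows "monomial_fun ((replicate n 0)[j := 1]) = (\<lambda>z. z j)"
proof
  fix z
  have "monomial_fun ((replicate n 0)[j := 1]) z = (\<Prod>i<n. if i = j then z j else 1)"
    unfolding monomial_fun_def by (rule prod.cong) (auto simp: nth_list_update)
  then show "monomial_fun ((replicate n 0)[j := 1]) z = z j" using assms by simp
qed

lemma sum_list_map2_add: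
  fixes \<alpha> \<beta> :: "nat list"
  assumes "length \<alpha> = length \<beta>"
  shows "sum_list (map2 (+) \<alpha> \<beta>) = sum_list \<alpha> + sum_list \<beta>"
  using assms by (induction \<alpha> \<beta> rule: list_induct2) auto

lemma bidegree_exponents_add:
  assumes "\<alpha> \<in> bidegree_exponents N s a b" "\<beta> \<in> bidegree_exponents N s a' b'"
  shows "map2 (+) \<alpha> \<beta> \<in> bidegree_exponents N s (a + a') (b + b')"
proof -
  have "take N (map2 (+) \<alpha> \<beta>) = map2 (+) (take N \<alpha>) (take N \<beta>)"
    "drop N (map2 (+) \<alpha> \<beta>) = map2 (+) (drop N \<alpha>) (drop N \<beta>)"
    by (simp_all add: take_map take_zip drop_map drop_zip)
  then show ?thesis using assms unfolding bidegree_exponents_def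
    by (simp add: sum_list_map2_add)
qed

lemma sum_list_take_drop_unit:
  assumes "j < n"
  shows "sum_list (take N ((replicate n 0)[j := 1::nat])) = (if j < N then 1 else 0)"
    and "sum_list (drop N ((replicate n 0)[j := 1::nat])) = (if j < N then 0 else 1)"
proof -
  have *: "sum_list ((replicate m 0)[i := 1::nat]) = (if i < m then 1 else 0)" for m i
    by (cases "i < m") (simp_all add: sum_list_update list_update_beyond sum_list_replicate)
  show "sum_list (take N ((replicate n 0)[j := 1::nat])) = (if j < N then 1 else 0)"
    using * assms by (simp add: take_update_swap)
  show "sum_list (drop N ((replicate n 0)[j := 1::nat])) = (if j < N then 0 else 1)"
    using *[of "n - N" "j - N"] assms by (auto simp: drop_update_swap)
qed

lemma unit_in_bidegree_exponents:
  assumes "j < N + s" "j < N \<Longrightarrow> 1 \<le> a" "N \<le> j \<Longrightarrow> 1 \<le> b"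
  shows "(replicate (N + s) 0)[j := 1] \<in> bidegree_exponents N s a b"
  unfolding bidegree_exponents_def mem_Collect_eq
    sum_list_take_drop_unit(1)[OF assms(1)] sum_list_take_drop_unit(2)[OF assms(1)]
  using assms by auto

lemma bipoly_in_span:
  assumes "bipoly N s a b f"
  shows "f \<in> fun_space.span (monomial_fun ` bidegree_exponents N s a b)"
  using assms
proof induction
  case (const a b c)
  have "(\<lambda>z. 1) \<in> monomial_fun ` bidegree_exponents N s a b"
    by (rule image_eqI[of _ _ "replicate (N + s) 0"])
      (auto simp: monomial_fun_def bidegree_exponents_def fun_eq_iff sum_list_replicate)
  from fun_space.span_scale[OF fun_space.span_base[OF this], of c] show ?case by simp
next
  case (xvar j a b)
  then have "(replicate (N + s) 0)[j := 1] \<in> bidegree_exponents N s a b"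
    by (intro unit_in_bidegree_exponents) auto
  from imageI[OF this, of monomial_fun] show ?case using xvar
    by (simp only: monomial_fun_unit trans_less_add1 fun_space.span_base)
next
  case (yvar i b a)
  then have "(replicate (N + s) 0)[N + i := 1] \<in> bidegree_exponents N s a b"
    by (intro unit_in_bidegree_exponents) auto
  from imageI[OF this, of monomial_fun] show ?case using yvar
    by (simp only: monomial_fun_unit nat_add_left_cancel_less fun_space.span_base)
next
  case (add a b f g)
  then show ?case using fun_space.span_add[of f _ g] by (simp add: plus_fun_def)
next
  case (mult a b f a' b' g)
  let ?S = "fun_space.span (monomial_fun ` bidegree_exponents N s (a + a') (b + b'))"
  \<comment> \<open>A product of two spans is treated one factor at a time; first the right factor
    is a single monomial.\<close>
  have mono: "(\<lambda>z. f z * monomial_fun \<beta> z) \<in> ?S" if \<beta>: "\<beta> \<in> bidegree_exponents N s a' b'" for \<beta>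
    using mult.IH(1)
  proof (induction rule: fun_space.span_induct_alt)
    case base
    show ?case using fun_space.span_zero by (simp add: zero_fun_def)
  next
    case (step c h y)
    then obtain \<alpha> where \<alpha>: "\<alpha> \<in> bidegree_exponents N s a b" "h = monomial_fun \<alpha>" by auto
    have "(\<lambda>z. h z * monomial_fun \<beta> z) = monomial_fun (map2 (+) \<alpha> \<beta>)"
      using \<alpha> \<beta> by (auto simp: monomial_fun_mult bidegree_exponents_def)
    then have "(\<lambda>z. h z * monomial_fun \<beta> z) \<in> ?S"
      using bidegree_exponents_add[OF \<alpha>(1) \<beta>] by (auto intro: fun_space.span_base)
    from fun_space.span_add[OF fun_space.span_scale[OF this, of c] step(2)]
    show ?case by (simp add: plus_fun_def algebra_simps)
  qed
  from mult.IH(2) show ?case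
  proof (induction rule: fun_space.span_induct_alt)
    case base
    show ?case using fun_space.span_zero by (simp add: zero_fun_def)
  next
    case (step c h y)
    then obtain \<beta> where \<beta>: "\<beta> \<in> bidegree_exponents N s a' b'" "h = monomial_fun \<beta>" by auto
    from fun_space.span_add[OF fun_space.span_scale[OF mono[OF \<beta>(1)], of c] step(2)]
    show ?case by (simp add: plus_fun_def algebra_simps \<beta>)
  qed
qed

text \<open>Induction on the number of variables. Terms are grouped by the exponent of the first
  variable; for fixed values of the others they form a real polynomial that vanishes everywhere, so
  each group vanishes by itself.\<close>

lemma monomials_independent:
  fixes c :: "nat list \<Rightarrow> real"
  assumes "finite A" "\<And>\<alpha>. \<alpha> \<in> A \<Longrightarrow> length \<alpha> = k"
    and "\<And>z. (\<Sum>\<alpha>\<in>A. c \<alpha> * monomial_fun \<alpha> z) = 0" "\<alpha> \<in> A"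
  shows "c \<alpha> = 0"
  using assms
proof (induction k arbitrary: A c \<alpha>)
  case 0
  then have "A = {[]}" by auto
  with 0 show ?case by (auto simp: monomial_fun_def)
next
  case (Suc k)
  obtain a \<beta> where \<alpha>: "\<alpha> = a # \<beta>" "length \<beta> = k" using Suc.prems(2,4) by (metis length_Suc_conv)
  define B where "B b = {\<beta>. b # \<beta> \<in> A}" for b
  define M where "M = hd ` A"
  have finB: "finite (B b)" for b
    unfolding B_def using finite_vimageI[OF Suc.prems(1), of "(#) b"] by (simp add: vimage_def inj_def)
  have finM: "finite M" using Suc.prems by (simp add: M_def)
  have split: "(\<Sum>\<alpha>\<in>A. g \<alpha>) = (\<Sum>b\<in>M. \<Sum>\<beta>\<in>B b. g (b # \<beta>))" for g :: "nat list \<Rightarrow> real"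
  proof -
    have "(\<Sum>b\<in>M. \<Sum>\<beta>\<in>B b. g (b # \<beta>)) = (\<Sum>(b, \<beta>)\<in>Sigma M B. g (b # \<beta>))"
      using finB finM by (simp add: sum.Sigma)
    also have "\<dots> = (\<Sum>p\<in>Sigma M B. g ((\<lambda>(b, \<beta>). b # \<beta>) p))"
      by (simp add: case_prod_unfold)
    also have "\<dots> = (\<Sum>\<alpha>\<in>A. g \<alpha>)"
    proof (rule sum.reindex_bij_betw)
      have ne: "\<gamma> \<noteq> []" if "\<gamma> \<in> A" for \<gamma> using Suc.prems(2)[OF that] by auto
      then have "hd \<gamma> # tl \<gamma> = \<gamma>" if "\<gamma> \<in> A" for \<gamma> using that by simp
      then show "bij_betw (\<lambda>(b, \<beta>). b # \<beta>) (Sigma M B) A"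
        by (intro bij_betwI[where g = "\<lambda>l. (hd l, tl l)"]) (auto simp: B_def M_def rev_image_eqI)
    qed
    finally show ?thesis by simp
  qed
  have "(\<Sum>\<beta>\<in>B a. c (a # \<beta>) * monomial_fun \<beta> z) = 0" for z
  proof -
    define P :: "real poly" where "P = (\<Sum>b\<in>M. monom (\<Sum>\<beta>\<in>B b. c (b # \<beta>) * monomial_fun \<beta> z) b)"
    have "poly P x = 0" for x
    proof -
      define z' where "z' i = (if i = 0 then x else z (i - 1))" for i
      have m: "monomial_fun (b # \<beta>) z' = x ^ b * monomial_fun \<beta> z" for b \<beta>
        unfolding monomial_fun_def
        by (simp add: prod.lessThan_Suc_shift z'_def del: prod.lessThan_Suc)
      have "poly P x = (\<Sum>b\<in>M. \<Sum>\<beta>\<in>B b. c (b # \<beta>) * monomial_fun (b # \<beta>) z')"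
        unfolding P_def by (simp add: poly_sum poly_monom m sum_distrib_right sum_distrib_left algebra_simps)
      also have "\<dots> = 0" using split[of "\<lambda>\<alpha>. c \<alpha> * monomial_fun \<alpha> z'"] Suc.prems(3) by simp
      finally show ?thesis .
    qed
    then have "P = 0" using poly_all_0_iff_0 by blast
    then have "coeff P a = 0" by simp
    moreover have "a \<in> M" using \<alpha> Suc.prems(4) by (force simp: M_def)
    ultimately show ?thesis
      using finM unfolding P_def by (simp add: coeff_sum)
  qed
  moreover have "length \<gamma> = k" if "\<gamma> \<in> B a" for \<gamma>
    using that Suc.prems(2)[of "a # \<gamma>"] by (simp add: B_def)
  ultimately show ?case
    using Suc.IH[OF finB, of a "\<lambda>\<beta>. c (a # \<beta>)" \<beta>] \<alpha> Suc.prems(4) by (auto simp: B_def)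
qed

section \<open>A multihomogeneous Bezout bound\<close>

lemma power_le_binomial_fact: "t ^ k \<le> ((k + t) choose k) * fact k"
proof (induction k)
  case (Suc k)
  have "t ^ Suc k \<le> (Suc k + t) * (((k + t) choose k) * fact k)"
    using mult_mono[OF _ Suc, of t "Suc k + t"] by simp
  also have "\<dots> = (Suc k * (Suc (k + t) choose Suc k)) * fact k"
    using Suc_times_binomial_eq[of "k + t" k] by (simp add: algebra_simps)
  finally show ?case by (simp add: algebra_simps)
qed auto

text \<open>The binomial products are polynomials in \<open>t\<close> of degree N + s. Their leading
  coefficients are M / (N + s)! and D ^ N / (N! s!); the fixed shift \<open>e\<close> disappears in
  the limit.\<close>

lemma multihomogeneous_leading_term:
  assumes le: "\<And>t. M * ((N + s + t) choose (N + s)) \<le> ((N + (e + D * t)) choose N) * ((s + t) choose s)"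
  shows "M \<le> D ^ N * ((N + s) choose N)"
proof -
  have fin: "real M * fact N * fact s \<le> fact (N + s) * ((real (N + e) / real t + real D) ^ N * (real s / real t + 1) ^ s)"
    if "t > 0" for t
  proof -
    have "M * t ^ (N + s) * fact N * fact s \<le> M * (((N + s + t) choose (N + s)) * fact (N + s)) * fact N * fact s"
      using power_le_binomial_fact[of t "N + s"] by (intro mult_right_mono mult_left_mono) auto
    also have "\<dots> = (M * ((N + s + t) choose (N + s))) * (fact (N + s) * fact N * fact s)" by simp
    also have "\<dots> \<le> (((N + (e + D * t)) choose N) * ((s + t) choose s)) * (fact (N + s) * fact N * fact s)"
      by (rule mult_right_mono[OF le]) auto
    also have "\<dots> = fact (N + s) * ((((N + (e + D * t)) choose N) * fact N) * (((s + t) choose s) * fact s))"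
      by simp
    also have "\<dots> \<le> fact (N + s) * ((N + (e + D * t)) ^ N * (s + t) ^ s)"
      by (intro mult_left_mono mult_mono binomial_fact_pow) auto
    finally have "real (M * t ^ (N + s) * fact N * fact s) \<le> real (fact (N + s) * ((N + (e + D * t)) ^ N * (s + t) ^ s))"
      by (rule of_nat_mono)
    then have "real M * fact N * fact s * (real t ^ N * real t ^ s) \<le>
        fact (N + s) * ((real N + real e + real D * real t) ^ N * (real s + real t) ^ s)"
      by (simp add: power_add algebra_simps)
    also have "\<dots> = fact (N + s) * (((real (N + e) / real t + real D) * real t) ^ N * ((real s / real t + 1) * real t) ^ s)"
    proof -
      have "(real (N + e) / real t + real D) * real t = real N + real e + real D * real t"
        "(real s / real t + 1) * real t = real s + real t"
        using that by (simp_all add: field_simps)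
      then show ?thesis by simp
    qed
    also have "\<dots> = fact (N + s) * ((real (N + e) / real t + real D) ^ N * (real s / real t + 1) ^ s) * (real t ^ N * real t ^ s)"
      by (simp add: power_mult_distrib)
    finally show ?thesis
      using that by (simp only: mult_le_cancel_right_pos[OF mult_pos_pos] zero_less_power of_nat_0_less_iff)
  qed
  have "(\<lambda>t. fact (N + s) * ((real (N + e) / real t + real D) ^ N * (real s / real t + 1) ^ s))
      \<longlonglongrightarrow> fact (N + s) * ((0 + real D) ^ N * (0 + 1) ^ s)"
    by (intro tendsto_intros lim_const_over_n)
  then have "real M * fact N * fact s \<le> fact (N + s) * ((0 + real D) ^ N * (0 + 1) ^ s)"
    by (rule LIMSEQ_le_const) (use fin in \<open>auto intro: exI[of _ 1]\<close>)
  also have "\<dots> = real D ^ N * (real ((N + s) choose N) * fact N * fact s)"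
    using binomial_fact[of N "N + s", where 'a = real] by simp
  finally have "real M * (fact N * fact s) \<le> (real D ^ N * real ((N + s) choose N)) * (fact N * fact s)"
    by (simp add: algebra_simps)
  then have "real M \<le> real D ^ N * real ((N + s) choose N)"
    by (simp only: mult_le_cancel_right_pos[OF mult_pos_pos] fact_gt_zero)
  then show ?thesis by (simp flip: of_nat_mult of_nat_power)
qed

lemma bipoly_line_continuous:
  assumes "bipoly N s a b f"
  shows "((\<lambda>t. f (\<lambda>j. z j + t * w j)) \<longlongrightarrow> f z) (at 0)"
proof -
  obtain f' where "((\<lambda>t. f (\<lambda>j. z j + t * w j)) has_real_derivative
       (\<Sum>j<N+s. w j * f' j (\<lambda>j. z j + 0 * w j))) (at 0)"
    using bipoly_has_gradient[OF assms] by blast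
  then have "isCont (\<lambda>t. f (\<lambda>j. z j + t * w j)) 0" by (rule DERIV_isCont)
  then show ?thesis by (simp add: isCont_def)
qed

text \<open>Bezout by linear algebra: if \<open>h p\<close> interpolates the zeros, then near a nondegenerate zero
  \<open>p\<close> the functions \<open>h p \<cdot> f ^ \<alpha>\<close> have leading term the monomial \<open>\<alpha>\<close> in the local coordinates
  \<open>f\<close>. Hence all \<open>h p \<cdot> f ^ \<alpha>\<close> are linearly independent, and counting them inside the space of
  polynomials of the same bidegree bounds the number of zeros.\<close>

lemma nondegenerate_zeros_bound:
  fixes f :: "nat \<Rightarrow> (nat \<Rightarrow> real) \<Rightarrow> real" and z :: "nat \<Rightarrow> nat \<Rightarrow> real"
  assumes f: "\<And>i. i < N + s \<Longrightarrow> bipoly N s D 1 (f i)"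
    and zero: "\<And>p i. p < M \<Longrightarrow> i < N + s \<Longrightarrow> f i (z p) = 0"
    and distinct: "\<And>p q. p < M \<Longrightarrow> q < M \<Longrightarrow> p \<noteq> q \<Longrightarrow> \<exists>j<N. z p j \<noteq> z q j"
    and nondeg: "\<And>p \<zeta>. p < M \<Longrightarrow> \<exists>w. \<forall>i<N+s.
      ((\<lambda>t. f i (\<lambda>j. z p j + t * w j)) has_real_derivative \<zeta> i) (at 0)"
  shows "M \<le> D ^ N * ((N + s) choose N)"
\<comment> \<open>The shift \<open>M\<close> pays for the interpolating factors \<open>h p\<close>,
  whose degree is at most M.\<close>
proof (rule multihomogeneous_leading_term[of M N s M])
  fix t
  obtain J where J: "\<And>p q. p < M \<Longrightarrow> q < M \<Longrightarrow> p \<noteq> q \<Longrightarrow> J p q < N \<and> z p (J p q) \<noteq> z q (J p q)"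
    using distinct by metis
  \<comment> \<open>The points differ already in the first N coordinates, so Lagrange interpolation
    costs no degree in the second group of variables.\<close>
  define h where "h p x = (\<Prod>q\<in>{..<M}-{p}. (x (J p q) + - z q (J p q)) * (1 / (z p (J p q) - z q (J p q))))"
    for p and x :: "nat \<Rightarrow> real"
  have h_poly: "bipoly N s M 0 (h p)" if "p < M" for p
  proof -
    have "bipoly N s (\<Sum>q\<in>{..<M}-{p}. 1 + 0) (\<Sum>q\<in>{..<M}-{p}. 0 + 0) (h p)"
      unfolding h_def
      by (intro bipoly_prod bipoly.mult bipoly.add bipoly.const bipoly.xvar) (use J that in auto)
    moreover have "card ({..<M} - {p}) \<le> M" using card_mono[of "{..<M}" "{..<M} - {p}"] by auto
    ultimately show ?thesis by (elim bipoly_mono) auto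
  qed
  have h_self: "h p (z p) = 1" if "p < M" for p
    unfolding h_def by (rule prod.neutral) (use J that in auto)
  have h_other: "h p (z q) = 0" if "p < M" "q < M" "p \<noteq> q" for p q
    unfolding h_def using that by (intro prod_zero) (auto intro!: bexI[of _ q])
  let ?E = "{\<alpha>::nat list. length \<alpha> = N + s \<and> sum_list \<alpha> \<le> t}"
  define I where "I = {..<M} \<times> ?E"
  define \<phi> where "\<phi> = (\<lambda>(p, \<alpha>) x. h p x * (\<Prod>i<N+s. f i x ^ (\<alpha> ! i)))"
  have finI: "finite I" by (simp add: I_def finite_length_sum_list_le)
  have "card I \<le> card (monomial_fun ` bidegree_exponents N s (M + D * t) t)"
  proof (rule card_family_le_spanning[where \<phi> = \<phi>])
    fix i assume "i \<in> I"
    then obtain p \<alpha> where i: "i = (p, \<alpha>)" "p < M" "length \<alpha> = N + s" "sum_list \<alpha> \<le> t"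
      by (auto simp: I_def)
    have "bipoly N s (M + (\<Sum>i<N+s. (\<alpha> ! i) * D)) (0 + (\<Sum>i<N+s. (\<alpha> ! i) * 1)) (\<phi> i)"
      unfolding i(1) \<phi>_def prod.case
      by (intro bipoly.mult bipoly_prod bipoly_power h_poly i f) auto
    moreover have "(\<Sum>i<N+s. \<alpha> ! i) \<le> t"
      using i by (simp add: sum_list_sum_nth atLeast0LessThan)
    ultimately have "bipoly N s (M + D * t) t (\<phi> i)"
      by (elim bipoly_mono) (auto simp flip: sum_distrib_right)
    then show "\<phi> i \<in> fun_space.span (monomial_fun ` bidegree_exponents N s (M + D * t) t)"
      by (rule bipoly_in_span)
  next
    fix c i0 assume sum0: "\<And>x. (\<Sum>i\<in>I. c i * \<phi> i x) = 0" and "i0 \<in> I"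
    \<comment> \<open>Induction on the total degree m of \<alpha>. Once the coefficients of lower
      degree are 0, the relation can be divided by u ^ m and evaluated for u tending to 0 on a line
      through \<open>z p\<close>.\<close>
    have "\<forall>p \<alpha>. (p, \<alpha>) \<in> I \<longrightarrow> sum_list \<alpha> = m \<longrightarrow> c (p, \<alpha>) = 0" for m
    proof (induction m rule: less_induct)
      case (less m)
      show ?case
      proof (intro allI impI)
        fix p \<alpha> assume p: "(p, \<alpha>) \<in> I" and \<alpha>: "sum_list \<alpha> = m"
        let ?A = "{\<alpha>::nat list. length \<alpha> = N + s \<and> sum_list \<alpha> = m}"
        have pM: "p < M" and m: "m \<le> t" using p \<alpha> by (auto simp: I_def)
        show "c (p, \<alpha>) = 0"
        proof (rule monomials_independent[of ?A "N + s" "\<lambda>\<alpha>. c (p, \<alpha>)"])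
          show "finite ?A"
            by (rule finite_subset[OF _ finite_length_sum_list_le[of "N + s" m]]) auto
          show "\<alpha> \<in> ?A" using p \<alpha> by (auto simp: I_def)
          fix \<zeta>
          from nondeg[OF pM] obtain w where w: "\<And>i. i < N + s \<Longrightarrow>
            ((\<lambda>t. f i (\<lambda>j. z p j + t * w j)) has_real_derivative \<zeta> i) (at 0)" by blast
          define r where "r u j = z p j + u * w j" for u j
          \<comment> \<open>Terms of degree below m have coefficient 0; setting them to 0 explicitly
            avoids the truncated subtraction in the exponent. In the limit 0 ^ 0 = 1 selects exactly
            degree m.\<close>
          define T where "T = (\<lambda>(q, \<beta>) u. if sum_list \<beta> < m then 0 else
            c (q, \<beta>) * h q (r u) * monomial_fun \<beta> (\<lambda>i. f i (r u) / u) * u ^ (sum_list \<beta> - m))"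
          define L where "L = (\<lambda>(q, \<beta>). if sum_list \<beta> < m then 0 else
            c (q, \<beta>) * h q (z p) * monomial_fun \<beta> \<zeta> * 0 ^ (sum_list \<beta> - m))"
          have "((\<lambda>u. \<Sum>i\<in>I. T i u) \<longlongrightarrow> (\<Sum>i\<in>I. L i)) (at 0)"
          proof (rule tendsto_sum)
            fix i assume i: "i \<in> I"
            obtain q \<beta> where q: "i = (q, \<beta>)" "q < M" "length \<beta> = N + s" using i by (auto simp: I_def)
            have 1: "((\<lambda>u. h q (r u)) \<longlongrightarrow> h q (z p)) (at 0)"
              unfolding r_def by (rule bipoly_line_continuous[OF h_poly[OF q(2)]])
            have 2: "((\<lambda>u. f l (r u) / u) \<longlongrightarrow> \<zeta> l) (at 0)" if "l < N + s" for l
              using w[OF that] zero[OF pM that] unfolding r_def by (simp add: DERIV_def)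
            show "(T i \<longlongrightarrow> L i) (at 0)"
              unfolding T_def L_def q(1) prod.case
              by (cases "sum_list \<beta> < m")
                (auto simp: monomial_fun_def intro!: tendsto_intros 1 2 q, simp add: q 2)
          qed
          moreover have "\<forall>\<^sub>F u in at 0. (\<Sum>i\<in>I. T i u) = 0"
          proof (rule eventually_mono[OF eventually_neq_at_within[of 0]])
            fix u :: real assume u: "u \<noteq> 0"
            have "T i u = c i * \<phi> i (r u) / u ^ m" if i: "i \<in> I" for i
            proof -
              obtain q \<beta> where q: "i = (q, \<beta>)" "q < M" "length \<beta> = N + s" using i by (auto simp: I_def)
              have "monomial_fun \<beta> (\<lambda>i. f i (r u) / u) = (\<Prod>i<N+s. f i (r u) ^ (\<beta> ! i)) / u ^ sum_list \<beta>"
                by (simp add: monomial_fun_def q power_divide prod_dividef power_sum sum_list_sum_nth atLeast0LessThan)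
              moreover have "c i = 0" if "sum_list \<beta> < m" using less i q that by blast
              ultimately show ?thesis using u
                by (auto simp: T_def \<phi>_def q power_diff)
            qed
            then have "(\<Sum>i\<in>I. T i u) = (\<Sum>i\<in>I. c i * \<phi> i (r u)) / u ^ m"
              by (simp add: sum_divide_distrib)
            then show "(\<Sum>i\<in>I. T i u) = 0" using sum0 by simp
          qed
          ultimately have "((\<lambda>u::real. 0) \<longlongrightarrow> (\<Sum>i\<in>I. L i)) (at 0)"
            by (rule Lim_transform_eventually)
          then have "(\<Sum>i\<in>I. L i) = 0" by (simp add: tendsto_const_iff)
          moreover have "(\<Sum>i\<in>I. L i) = (\<Sum>i\<in>{p} \<times> ?A. L i)"
          proof (rule sum.mono_neutral_right[OF finI])
            show "{p} \<times> ?A \<subseteq> I" using pM m by (auto simp: I_def)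
            show "\<forall>i\<in>I - {p} \<times> ?A. L i = 0"
            proof
              fix i assume "i \<in> I - {p} \<times> ?A"
              then obtain q \<beta> where q: "i = (q, \<beta>)" "q < M" "q \<noteq> p \<or> sum_list \<beta> \<noteq> m"
                by (auto simp: I_def)
              then show "L i = 0"
                using h_other[OF q(2) pM] by (cases "sum_list \<beta> < m") (auto simp: L_def)
            qed
          qed
          moreover have "\<dots> = (\<Sum>\<alpha>\<in>?A. c (p, \<alpha>) * monomial_fun \<alpha> \<zeta>)"
          proof -
            have "{p} \<times> ?A = Pair p ` ?A" by auto
            then show ?thesis using h_self[OF pM] by (simp add: L_def sum.reindex inj_on_def)
          qed
          ultimately show "(\<Sum>\<alpha>\<in>?A. c (p, \<alpha>) * monomial_fun \<alpha> \<zeta>) = 0" by simp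
        qed simp
      qed
    qed
    then show "c i0 = 0" using \<open>i0 \<in> I\<close> by (cases i0) auto
  qed (use finI finite_bidegree_exponents in auto)
  also have "\<dots> \<le> card (bidegree_exponents N s (M + D * t) t)"
    by (rule card_image_le[OF finite_bidegree_exponents])
  finally show "M * ((N + s + t) choose (N + s)) \<le> ((N + (M + D * t)) choose N) * ((s + t) choose s)"
    by (simp add: I_def card_cartesian_product card_length_sum_list_le card_bidegree_exponents)
qed

section \<open>The number of sign patterns of polynomials\<close>

text \<open>If there were no solution, the N columns of \<open>H\<close> together with \<gamma>
  would be N + 1 independent vectors in the span of N unit vectors.\<close>

lemma injective_imp_solvable:
  fixes H :: "nat \<Rightarrow> nat \<Rightarrow> real"
  assumes inj: "\<And>\<xi>. (\<And>j. j < N \<Longrightarrow> (\<Sum>l<N. H j l * \<xi> l) = 0) \<Longrightarrow> \<forall>l<N. \<xi> l = 0"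
  shows "\<exists>\<xi>. \<forall>j<N. (\<Sum>l<N. H j l * \<xi> l) = \<gamma> j"
proof (rule ccontr)
  assume no: "\<not> ?thesis"
  define \<phi> where "\<phi> l j = (if j < N then if l < N then H j l else \<gamma> j else 0)" for l j
  define \<delta> where "\<delta> j k = (if k = j then 1 else 0 :: real)" for j k :: nat
  have "card {..N} \<le> card (\<delta> ` {..<N})"
  proof (rule card_family_le_spanning[where \<phi> = \<phi>])
    fix l
    have "\<phi> l = (\<Sum>j<N. (\<lambda>k. \<phi> l j * \<delta> j k))"
      by (auto simp: fun_eq_iff sum_apply \<delta>_def \<phi>_def if_distrib[of "(*) _"] cong: if_cong)
    also have "\<dots> \<in> fun_space.span (\<delta> ` {..<N})"
      by (intro fun_space.span_sum fun_space.span_scale fun_space.span_base) auto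
    finally show "\<phi> l \<in> fun_space.span (\<delta> ` {..<N})" .
  next
    fix c l assume c: "\<And>x. (\<Sum>l\<le>N. c l * \<phi> l x) = 0" and l: "l \<in> {..N}"
    have eq: "(\<Sum>l<N. H j l * c l) = - c N * \<gamma> j" if "j < N" for j
      using c[of j] that by (simp add: \<phi>_def lessThan_Suc_atMost[symmetric] mult.commute)
    have "c N = 0"
    proof (rule ccontr)
      assume cN: "c N \<noteq> 0"
      have "(\<Sum>l<N. H j l * (- c l / c N)) = \<gamma> j" if "j < N" for j
      proof -
        have "(\<Sum>l<N. H j l * (- c l / c N)) = - (\<Sum>l<N. H j l * c l) / c N"
          by (simp add: sum_divide_distrib sum_negf)
        then show ?thesis using eq[OF that] cN by simp
      qed
      with no show False by metis
    qed
    then have "\<forall>l<N. c l = 0" using eq by (intro inj) auto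
    with \<open>c N = 0\<close> l show "c l = 0" by (cases "l = N") auto
  qed auto
  moreover have "card (\<delta> ` {..<N}) \<le> N" using card_image_le[of "{..<N}" \<delta>] by simp
  ultimately show False by simp
qed

text \<open>A positive second derivative would make \<phi>' positive just to the right of 0, and the
  mean value theorem would then give values above \<phi> 0.\<close>

lemma local_max_derivatives:
  fixes \<phi> \<phi>' :: "real \<Rightarrow> real"
  assumes "\<delta> > 0" and max: "\<And>t. \<bar>t\<bar> < \<delta> \<Longrightarrow> \<phi> t \<le> \<phi> 0"
    and d1: "\<And>t. \<bar>t\<bar> < \<delta> \<Longrightarrow> (\<phi> has_real_derivative \<phi>' t) (at t)"
    and d2: "(\<phi>' has_real_derivative c) (at 0)"
  shows "\<phi>' 0 = 0" "c \<le> 0"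
proof -
  show 0: "\<phi>' 0 = 0"
    by (rule DERIV_local_max[OF d1[of 0] \<open>\<delta> > 0\<close>]) (use assms in auto)
  show "c \<le> 0"
  proof (rule ccontr)
    assume "\<not> c \<le> 0"
    then obtain e where e: "e > 0" "\<And>h. h > 0 \<Longrightarrow> h < e \<Longrightarrow> \<phi>' 0 < \<phi>' (0 + h)"
      using DERIV_pos_inc_right[OF d2] by auto
    define h where "h = min e \<delta> / 2"
    have h: "h > 0" "h < e" "h < \<delta>" using e \<open>\<delta> > 0\<close> by (auto simp: h_def)
    have "\<exists>t. t > 0 \<and> t < h \<and> \<phi> h - \<phi> 0 = (h - 0) * \<phi>' t"
      by (rule MVT2) (use h in \<open>auto intro!: d1\<close>)
    then obtain t where t: "t > 0" "t < h" "\<phi> h - \<phi> 0 = h * \<phi>' t" by auto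
    have "\<phi>' t > 0" using e(2)[of t] t h 0 by simp
    then have "\<phi> h > \<phi> 0" using t h by (metis diff_gt_0_iff_gt mult_pos_pos)
    then show False using max[of h] h by simp
  qed
qed

lemma bipoly_continuous_on:
  assumes "bipoly N s a b f"
  shows "continuous_on A f"
  using assms
  by induction (auto intro!: continuous_intros continuous_on_product_coordinates
    intro: continuous_on_subset[OF continuous_on_product_coordinates])

lemma bipoly_continuous_on_component:
  assumes "bipoly N s a b f"
  shows "continuous_on A (\<lambda>X. f (X p))"
  by (rule continuous_on_compose2[OF bipoly_continuous_on[OF assms, of UNIV]])
    (auto intro: continuous_on_subset[OF continuous_on_product_coordinates])

text \<open>Tychonoff. Families of points are functions
  \<open>nat \<Rightarrow> nat \<Rightarrow> real\<close>, so a bound on every entry suffices for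
  compactness.\<close>

lemma compact_Pi_fun:
  fixes S :: "'i \<Rightarrow> 'a::topological_space set"
  assumes "\<And>i. compact (S i)"
  shows "compact {f. \<forall>i. f i \<in> S i}"
proof -
  have "compactin (product_topology (\<lambda>i. euclidean) UNIV) (PiE UNIV S)"
    using assms by (simp add: compactin_PiE)
  moreover have "PiE UNIV S = {f. \<forall>i. f i \<in> S i}" by (auto simp: PiE_def)
  ultimately show ?thesis by (simp add: euclidean_product_topology)
qed


text \<open>The term \<open>exp (\<Sum>j. (\<Sum>p. X p j)\<^sup>2 / 2)\<close> couples the \<open>M\<close> regions: at a joint maximum the critical
  points solve one common system, with the same \<open>U\<close>, and the extra convexity makes the Hessian of
  \<open>\<Sum>i. ln \<bar>F i\<bar>\<close> at each of them negative definite. No genericity argument is needed.\<close>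

lemma joint_critical_points:
  fixes F :: "nat \<Rightarrow> (nat \<Rightarrow> real) \<Rightarrow> real" and x :: "nat \<Rightarrow> nat \<Rightarrow> real"
  assumes F: "\<And>i. i < s \<Longrightarrow> bipoly N 0 D 0 (F i)"
    and nz: "\<And>p i. p < M \<Longrightarrow> i < s \<Longrightarrow> F i (x p) \<noteq> 0"
    and supp: "\<And>p j. N \<le> j \<Longrightarrow> x p j = 0"
    and barrier: "b < s" "F b = (\<lambda>z. R - (\<Sum>j<N. (z j)\<^sup>2))" "\<And>p. p < M \<Longrightarrow> F b (x p) > 0"
    and dF: "\<And>i z w t. i < s \<Longrightarrow> ((\<lambda>t. F i (\<lambda>j. z j + t * w j)) has_real_derivative
       (\<Sum>j<N. w j * DF i j (\<lambda>j. z j + t * w j))) (at t)"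
    and dDF: "\<And>i j z w t. i < s \<Longrightarrow> ((\<lambda>t. DF i j (\<lambda>j. z j + t * w j)) has_real_derivative
       (\<Sum>l<N. w l * DDF i j l (\<lambda>j. z j + t * w j))) (at t)"
  shows "\<exists>X U.
    (\<forall>p<M. \<forall>i<s. sgn (F i (X p)) = sgn (F i (x p))) \<and>
    (\<forall>p<M. \<forall>j<N. (\<Sum>i<s. DF i j (X p) / F i (X p)) + U j = 0) \<and>
    (\<forall>p<M. \<forall>w. (\<Sum>i<s. (\<Sum>j<N. w j * (\<Sum>l<N. w l * DDF i j l (X p))) / F i (X p) -
        ((\<Sum>j<N. w j * DF i j (X p)) / F i (X p))\<^sup>2) \<le> - (\<Sum>j<N. (w j)\<^sup>2))"
proof -
  define \<sigma> where "\<sigma> p i = sgn (F i (x p))" for p i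
  \<comment> \<open>The closed versions of the sign regions; the barrier polynomial
    \<open>F b\<close> keeps them bounded.\<close>
  define K where "K = {X. (\<forall>p j. M \<le> p \<or> N \<le> j \<longrightarrow> X p j = 0) \<and> (\<forall>p<M. \<forall>i<s. \<sigma> p i * F i (X p) \<ge> 0)}"
  \<comment> \<open>The exponential of the objective: unlike the logarithms it stays continuous
    where some \<open>F i\<close> vanishes, and it is 0 there, so a maximiser over the compact
    \<open>K\<close> lies in the open regions.\<close>
  define \<Theta> where "\<Theta> X = (\<Prod>p<M. \<Prod>i<s. \<bar>F i (X p)\<bar>) * exp (1/2 * (\<Sum>j<N. (\<Sum>p<M. X p j)\<^sup>2))"
    for X :: "nat \<Rightarrow> nat \<Rightarrow> real"
  have cF: "continuous_on A (\<lambda>X. F i (X p))" if "i < s" for A i and p :: nat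
    by (rule bipoly_continuous_on_component[OF F[OF that]])
  have cX: "continuous_on A (\<lambda>X::nat \<Rightarrow> nat \<Rightarrow> real. X p j)" for A p j
    by (rule continuous_on_compose2[of UNIV "\<lambda>f. f j" A "\<lambda>X. X p"])
      (auto intro: continuous_on_subset[OF continuous_on_product_coordinates])
  have "compact K"
  proof -
    let ?B = "{X::nat \<Rightarrow> nat \<Rightarrow> real. \<forall>p. X p \<in> {f. \<forall>j. f j \<in> {- sqrt \<bar>R\<bar> .. sqrt \<bar>R\<bar>}}}"
    have "compact ?B" by (intro compact_Pi_fun) simp
    moreover have "closed K"
    proof -
      have "K = (\<Inter>p. \<Inter>j. if M \<le> p \<or> N \<le> j then {X. X p j = 0} else UNIV) \<inter>
         (\<Inter>p\<in>{..<M}. \<Inter>i\<in>{..<s}. {X. \<sigma> p i * F i (X p) \<ge> 0})"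
        by (auto simp: K_def split: if_splits)
      moreover have "closed {X::nat \<Rightarrow> nat \<Rightarrow> real. X p j = 0}" for p j
        by (rule closed_Collect_eq) (auto intro!: cX)
      moreover have "closed {X. \<sigma> p i * F i (X p) \<ge> 0}" if "i < s" for p i
        by (rule closed_Collect_le) (auto intro!: continuous_intros cF that)
      ultimately show ?thesis by (auto intro!: closed_INT closed_Int)
    qed
    moreover have "K \<subseteq> ?B"
    proof safe
      fix X p j assume X: "X \<in> K"
      have "\<bar>X p j\<bar> \<le> sqrt \<bar>R\<bar>"
      proof (cases "p < M \<and> j < N")
        case True
        have "\<sigma> p b = 1" using barrier(3)[of p] True by (simp add: \<sigma>_def)
        moreover have "\<sigma> p b * F b (X p) \<ge> 0" using X True barrier(1) by (simp add: K_def)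
        ultimately have "(\<Sum>j<N. (X p j)\<^sup>2) \<le> R" by (simp add: barrier(2))
        moreover have "(X p j)\<^sup>2 \<le> (\<Sum>j<N. (X p j)\<^sup>2)"
          by (rule member_le_sum) (use True in auto)
        ultimately have "(X p j)\<^sup>2 \<le> \<bar>R\<bar>" by linarith
        from real_sqrt_le_mono[OF this] show ?thesis by simp
      next
        case False
        then have "X p j = 0" using X by (auto simp: K_def not_less)
        then show ?thesis by simp
      qed
      then show "X p j \<in> {- sqrt \<bar>R\<bar>..sqrt \<bar>R\<bar>}" by auto
    qed
    ultimately show ?thesis using compact_Int_closed[of ?B K] by (simp add: inf.absorb2)
  qed
  define x' where "x' p = (if p < M then x p else (\<lambda>j. 0))" for p
  have "x' \<in> K" using supp by (auto simp: K_def x'_def \<sigma>_def mult.commute[of "sgn _"] simp flip: abs_sgn)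
  moreover have "continuous_on K \<Theta>"
    unfolding \<Theta>_def by (intro continuous_intros cF cX) auto
  ultimately obtain X where X: "X \<in> K" "\<And>Y. Y \<in> K \<Longrightarrow> \<Theta> Y \<le> \<Theta> X"
    using continuous_attains_sup[OF \<open>compact K\<close>, of \<Theta>] by auto
  have "0 < \<Theta> x'" unfolding \<Theta>_def
    by (intro mult_pos_pos prod_pos ballI) (use nz in \<open>auto simp: x'_def\<close>)
  also have "\<Theta> x' \<le> \<Theta> X" by (rule X(2)[OF \<open>x' \<in> K\<close>])
  finally have "\<Theta> X > 0" .
  then have FX: "F i (X p) \<noteq> 0" if "p < M" "i < s" for p i
    using \<open>\<Theta> X > 0\<close> that by (auto simp: \<Theta>_def zero_less_mult_iff dest: order.strict_implies_not_eq)
  have pos: "\<sigma> p i * F i (X p) > 0" if "p < M" "i < s" for p i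
  proof -
    have "\<sigma> p i * F i (X p) \<ge> 0" using X(1) that by (simp add: K_def)
    moreover have "\<sigma> p i \<noteq> 0" using nz that by (simp add: \<sigma>_def sgn_zero_iff)
    ultimately show ?thesis using FX[OF that] by (simp add: less_le)
  qed
  define U where "U j = (\<Sum>p<M. X p j)" for j
  have crit: "(\<Sum>j<N. w j * ((\<Sum>i<s. DF i j (X p) / F i (X p)) + U j)) = 0"
    "(\<Sum>i<s. (\<Sum>j<N. w j * (\<Sum>l<N. w l * DDF i j l (X p))) / F i (X p) -
        ((\<Sum>j<N. w j * DF i j (X p)) / F i (X p))\<^sup>2) + (\<Sum>j<N. (w j)\<^sup>2) \<le> 0"
    if p: "p < M" for p and w :: "nat \<Rightarrow> real"
  proof -
    \<comment> \<open>The direction is cut off beyond N, so that the moved point still meets the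
      zero condition in \<open>K\<close>.\<close>
    define w' where "w' j = (if j < N then w j else 0)" for j
    define lin where "lin t = (\<lambda>j. X p j + t * w' j)" for t
    have w': "(\<Sum>j<N. w' j * g j) = (\<Sum>j<N. w j * g j)" for g
      by (simp add: w'_def)
    have l0: "lin 0 = X p" by (simp add: lin_def)
    have D1: "((\<lambda>t. F i (lin t)) has_real_derivative (\<Sum>j<N. w j * DF i j (lin t))) (at t)"
      if "i < s" for i t
      using dF[OF that, of "X p" w' t] by (simp add: lin_def w')
    have D2: "((\<lambda>t. DF i j (lin t)) has_real_derivative (\<Sum>l<N. w l * DDF i j l (lin t))) (at t)"
      if "i < s" for i j t
      using dDF[OF that, of j "X p" w' t] by (simp add: lin_def w')
    have "\<forall>\<^sub>F t in nhds 0. \<forall>i\<in>{..<s}. \<sigma> p i * F i (lin t) > 0"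
    proof (rule eventually_ball_finite, simp, rule ballI)
      fix i assume "i \<in> {..<s}"
      then have i: "i < s" by simp
      have "isCont (\<lambda>t. \<sigma> p i * F i (lin t)) 0"
        using DERIV_isCont[OF D1[OF i]] by (intro continuous_intros)
      then have "((\<lambda>t. \<sigma> p i * F i (lin t)) \<longlongrightarrow> \<sigma> p i * F i (lin 0)) (nhds 0)"
        using tendsto_at_iff_tendsto_nhds[of "\<lambda>t. \<sigma> p i * F i (lin t)" 0] unfolding isCont_def by blast
      then show "\<forall>\<^sub>F t in nhds 0. \<sigma> p i * F i (lin t) > 0"
        by (rule order_tendstoD) (use pos[OF p i] in \<open>simp add: l0\<close>)
    qed
    then obtain \<delta> where \<delta>: "\<delta> > 0" "\<And>t i. \<bar>t\<bar> < \<delta> \<Longrightarrow> i < s \<Longrightarrow> \<sigma> p i * F i (lin t) > 0"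
      by (auto simp: eventually_nhds_metric dist_real_def)
    define \<phi> where "\<phi> t = (\<Sum>i<s. ln (\<sigma> p i * F i (lin t))) + 1/2 * (\<Sum>j<N. (U j + t * w j)\<^sup>2)" for t
    define \<phi>' where "\<phi>' t = (\<Sum>i<s. (\<Sum>j<N. w j * DF i j (lin t)) / F i (lin t)) + (\<Sum>j<N. w j * (U j + t * w j))" for t
    \<comment> \<open>Only the point p moves, so the factors of all other points form a positive
      constant, and \<open>U j\<close> changes by t * w j.\<close>
    define C where "C = (\<Prod>q\<in>{..<M}-{p}. \<Prod>i<s. \<bar>F i (X q)\<bar>)"
    have "C > 0" unfolding C_def by (intro prod_pos ballI) (use FX in auto)
    have \<Theta>_eq: "\<Theta> (X(p := lin t)) = C * exp (\<phi> t)" if t: "\<bar>t\<bar> < \<delta>" for t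
    proof -
      have "(\<Prod>q<M. \<Prod>i<s. \<bar>F i ((X(p := lin t)) q)\<bar>) = (\<Prod>i<s. \<bar>F i (lin t)\<bar>) * C"
        using p by (subst prod.remove[of _ p]) (auto simp: C_def)
      moreover have "(\<Prod>i<s. \<bar>F i (lin t)\<bar>) = exp (\<Sum>i<s. ln (\<sigma> p i * F i (lin t)))"
      proof -
        have "\<bar>F i (lin t)\<bar> = exp (ln (\<sigma> p i * F i (lin t)))" if "i < s" for i
        proof -
          have "\<bar>\<sigma> p i\<bar> = 1" using nz[OF p that] by (simp add: \<sigma>_def abs_sgn_eq)
          then have "\<bar>F i (lin t)\<bar> = \<bar>\<sigma> p i * F i (lin t)\<bar>" by (simp add: abs_mult)
          then show ?thesis using \<delta>(2)[OF t that] by simp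
        qed
        then show ?thesis by (simp add: exp_sum)
      qed
      moreover have "(\<Sum>q<M. (X(p := lin t)) q j) = U j + t * w j" if "j < N" for j
      proof -
        have "U j = X p j + (\<Sum>q\<in>{..<M}-{p}. X q j)"
          unfolding U_def using p by (subst sum.remove[of _ p]) auto
        moreover have "(\<Sum>q<M. (X(p := lin t)) q j) = lin t j + (\<Sum>q\<in>{..<M}-{p}. X q j)"
          using p by (subst sum.remove[of _ p]) auto
        ultimately show ?thesis using that by (simp add: lin_def w'_def)
      qed
      ultimately show ?thesis unfolding \<Theta>_def \<phi>_def by (simp add: exp_add)
    qed
    have "\<phi> t \<le> \<phi> 0" if t: "\<bar>t\<bar> < \<delta>" for t
    proof -
      have "X(p := lin t) \<in> K"
        using X(1) p \<delta>(2)[OF t] by (auto simp: K_def lin_def w'_def less_imp_le)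
      then have "\<Theta> (X(p := lin t)) \<le> \<Theta> (X(p := lin 0))" using X(2) by (simp add: l0)
      then show ?thesis using \<open>C > 0\<close> \<delta>(1) by (simp add: \<Theta>_eq t)
    qed
    moreover have "(\<phi> has_real_derivative \<phi>' t) (at t)" if t: "\<bar>t\<bar> < \<delta>" for t
    proof -
      have "((\<lambda>t. ln (\<sigma> p i * F i (lin t))) has_real_derivative
          (\<Sum>j<N. w j * DF i j (lin t)) / F i (lin t)) (at t)" if "i < s" for i
      proof -
        have *: "\<sigma> p i * F i (lin t) > 0" using \<delta>(2)[OF t that] .
        have "((\<lambda>t. ln (\<sigma> p i * F i (lin t))) has_real_derivative
          inverse (\<sigma> p i * F i (lin t)) * (\<sigma> p i * (\<Sum>j<N. w j * DF i j (lin t)))) (at t)"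
          by (rule DERIV_chain2[OF DERIV_ln[OF *] DERIV_cmult[OF D1[OF that]]])
        moreover have "\<sigma> p i \<noteq> 0" "F i (lin t) \<noteq> 0" using * by auto
        ultimately show ?thesis by (simp add: field_simps)
      qed
      moreover have "((\<lambda>t. 1/2 * (\<Sum>j<N. (U j + t * w j)\<^sup>2)) has_real_derivative
        (\<Sum>j<N. w j * (U j + t * w j))) (at t)"
        by (auto intro!: derivative_eq_intros sum.cong simp: sum_distrib_left field_simps)
      ultimately show ?thesis unfolding \<phi>_def \<phi>'_def by (intro DERIV_add DERIV_sum) auto
    qed
    moreover have "(\<phi>' has_real_derivative
        ((\<Sum>i<s. (\<Sum>j<N. w j * (\<Sum>l<N. w l * DDF i j l (X p))) / F i (X p) -
        ((\<Sum>j<N. w j * DF i j (X p)) / F i (X p))\<^sup>2) + (\<Sum>j<N. (w j)\<^sup>2))) (at 0)"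
    proof -
      have "((\<lambda>t. (\<Sum>j<N. w j * DF i j (lin t)) / F i (lin t)) has_real_derivative
        ((\<Sum>j<N. w j * (\<Sum>l<N. w l * DDF i j l (lin 0))) * F i (lin 0) -
          (\<Sum>j<N. w j * DF i j (lin 0)) * (\<Sum>j<N. w j * DF i j (lin 0))) / (F i (lin 0) * F i (lin 0))) (at 0)"
        if "i < s" for i
        using FX[OF p that] by (intro DERIV_divide DERIV_sum DERIV_cmult D1 D2 that) (simp add: l0)
      moreover have "((\<Sum>j<N. w j * (\<Sum>l<N. w l * DDF i j l (lin 0))) * F i (lin 0) -
          (\<Sum>j<N. w j * DF i j (lin 0)) * (\<Sum>j<N. w j * DF i j (lin 0))) / (F i (lin 0) * F i (lin 0)) =
         (\<Sum>j<N. w j * (\<Sum>l<N. w l * DDF i j l (X p))) / F i (X p) -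
        ((\<Sum>j<N. w j * DF i j (X p)) / F i (X p))\<^sup>2" if "i < s" for i
        using FX[OF p that] by (simp add: l0 diff_divide_distrib power2_eq_square)
      moreover have "((\<lambda>t. \<Sum>j<N. w j * (U j + t * w j)) has_real_derivative (\<Sum>j<N. (w j)\<^sup>2)) (at 0)"
        by (auto intro!: derivative_eq_intros simp: power2_eq_square)
      ultimately show ?thesis unfolding \<phi>'_def by (intro DERIV_add[OF DERIV_sum]) auto
    qed
    ultimately have *: "\<phi>' 0 = 0" "(\<Sum>i<s. (\<Sum>j<N. w j * (\<Sum>l<N. w l * DDF i j l (X p))) / F i (X p) -
        ((\<Sum>j<N. w j * DF i j (X p)) / F i (X p))\<^sup>2) + (\<Sum>j<N. (w j)\<^sup>2) \<le> 0"
      using local_max_derivatives[OF \<delta>(1)] by blast+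
    show "(\<Sum>i<s. (\<Sum>j<N. w j * (\<Sum>l<N. w l * DDF i j l (X p))) / F i (X p) -
        ((\<Sum>j<N. w j * DF i j (X p)) / F i (X p))\<^sup>2) + (\<Sum>j<N. (w j)\<^sup>2) \<le> 0" by (rule *)
    have "(\<Sum>j<N. w j * ((\<Sum>i<s. DF i j (X p) / F i (X p)) + U j)) = \<phi>' 0"
      unfolding \<phi>'_def l0
      by (simp add: algebra_simps sum.distrib sum_distrib_left sum_divide_distrib sum.swap[of _ "{..<s}"])
    then show "(\<Sum>j<N. w j * ((\<Sum>i<s. DF i j (X p) / F i (X p)) + U j)) = 0" using * by simp
  qed
  show ?thesis
  proof (intro exI[of _ X] exI[of _ U] conjI allI impI)
    show "sgn (F i (X p)) = sgn (F i (x p))" if "p < M" "i < s" for p i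
      using pos[OF that] by (auto simp: \<sigma>_def sgn_if split: if_splits)
    show "(\<Sum>i<s. DF i j (X p) / F i (X p)) + U j = 0" if "p < M" "j < N" for p j
      using crit(1)[OF that(1), of "\<lambda>l. if l = j then 1 else 0"] that(2)
      by (simp add: if_distrib[of "\<lambda>c. c * _"] cong: if_cong)
    show "(\<Sum>i<s. (\<Sum>j<N. w j * (\<Sum>l<N. w l * DDF i j l (X p))) / F i (X p) -
        ((\<Sum>j<N. w j * DF i j (X p)) / F i (X p))\<^sup>2) \<le> - (\<Sum>j<N. (w j)\<^sup>2)"
      if "p < M" for p w
      using crit(2)[OF that, of w] by linarith
  qed
qed

text \<open>The extra polynomial counted by \<open>Suc s\<close> is positive exactly inside a ball
  containing all the given points. It bounds the regions, and its degree 2 is the reason for the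
  assumption on \<open>D\<close>.\<close>

theorem strict_sign_patterns_bound:
  fixes F :: "nat \<Rightarrow> (nat \<Rightarrow> real) \<Rightarrow> real" and x :: "nat \<Rightarrow> nat \<Rightarrow> real"
  assumes F: "\<And>i. i < s \<Longrightarrow> bipoly N 0 D 0 (F i)" and D: "D \<ge> 2"
    and nz: "\<And>p i. p < M \<Longrightarrow> i < s \<Longrightarrow> F i (x p) \<noteq> 0"
    and distinct: "\<And>p q. p < M \<Longrightarrow> q < M \<Longrightarrow> p \<noteq> q \<Longrightarrow> \<exists>i<s. sgn (F i (x p)) \<noteq> sgn (F i (x q))"
  shows "M \<le> D ^ N * ((N + Suc s) choose N)"
proof -
  define x0 where "x0 p j = (if j < N then x p j else 0)" for p j
  have Fx0: "F i (x0 p) = F i (x p)" if "i < s" for i p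
    by (rule bipoly_cong_vars[OF F[OF that]]) (simp add: x0_def)
  define R where "R = 1 + (\<Sum>p<M. \<Sum>j<N. (x p j)\<^sup>2)"
  define B where "B = (\<lambda>z. R - (\<Sum>j<N. (z j)\<^sup>2))"
  have B: "bipoly N 0 D 0 B"
  proof -
    have "bipoly N 0 D 0 (\<lambda>z. R + (\<Sum>j<N. (-1) * (z j * z j)))"
    proof (intro bipoly.add bipoly.const bipoly_sum)
      fix j assume "j \<in> {..<N}"
      then have "bipoly N 0 (0 + (1 + 1)) (0 + (0 + 0)) (\<lambda>z. (-1) * (z j * z j))"
        by (intro bipoly.mult bipoly.const bipoly.xvar) auto
      then show "bipoly N 0 D 0 (\<lambda>z. (-1) * (z j * z j))"
        by (rule bipoly_mono) (use D in auto)
    qed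
    then show ?thesis by (simp add: B_def sum_negf power2_eq_square)
  qed
  have Bx0: "B (x0 p) > 0" if "p < M" for p
  proof -
    have "(\<Sum>j<N. (x p j)\<^sup>2) \<le> (\<Sum>p<M. \<Sum>j<N. (x p j)\<^sup>2)"
      by (rule member_le_sum) (use that in \<open>auto intro: sum_nonneg\<close>)
    then show ?thesis by (simp add: B_def R_def x0_def)
  qed
  define F' where "F' i = (if i < s then F i else B)" for i
  have F': "bipoly N 0 D 0 (F' i)" for i using F B by (simp add: F'_def)
  have "\<forall>i. \<exists>f'. (\<forall>j. bipoly N 0 D 0 (f' j)) \<and>
    (\<forall>z w t. ((\<lambda>t. F' i (\<lambda>j. z j + t * w j)) has_real_derivative
       (\<Sum>j<N. w j * f' j (\<lambda>j. z j + t * w j))) (at t))"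
    using bipoly_has_gradient[OF F'] by simp
  from choice[OF this] obtain DF where "\<forall>i. (\<forall>j. bipoly N 0 D 0 (DF i j)) \<and>
    (\<forall>z w t. ((\<lambda>t. F' i (\<lambda>j. z j + t * w j)) has_real_derivative
       (\<Sum>j<N. w j * DF i j (\<lambda>j. z j + t * w j))) (at t))" ..
  then have DF: "\<And>i j. bipoly N 0 D 0 (DF i j)"
    "\<And>i z w t. ((\<lambda>t. F' i (\<lambda>j. z j + t * w j)) has_real_derivative
       (\<Sum>j<N. w j * DF i j (\<lambda>j. z j + t * w j))) (at t)"
    by blast+
  have "\<forall>ij. \<exists>f'. (\<forall>l. bipoly N 0 D 0 (f' l)) \<and>
    (\<forall>z w t. ((\<lambda>t. DF (fst ij) (snd ij) (\<lambda>j. z j + t * w j)) has_real_derivative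
       (\<Sum>l<N. w l * f' l (\<lambda>j. z j + t * w j))) (at t))"
    using bipoly_has_gradient[OF DF(1)] by simp
  from choice[OF this] obtain G where G: "\<forall>ij. (\<forall>l. bipoly N 0 D 0 (G ij l)) \<and>
    (\<forall>z w t. ((\<lambda>t. DF (fst ij) (snd ij) (\<lambda>j. z j + t * w j)) has_real_derivative
       (\<Sum>l<N. w l * G ij l (\<lambda>j. z j + t * w j))) (at t))" ..
  define DDF where "DDF i j = G (i, j)" for i j
  have DDF: "bipoly N 0 D 0 (DDF i j l)"
    "((\<lambda>t. DF i j (\<lambda>j. z j + t * w j)) has_real_derivative
       (\<Sum>l<N. w l * DDF i j l (\<lambda>j. z j + t * w j))) (at t)" for i j l z w t
    using G[rule_format, of "(i, j)"] by (auto simp: DDF_def)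
  let ?s = "Suc s"
  have F'x0: "F' i (x0 p) \<noteq> 0" if "p < M" "i < ?s" for p i
    using nz[OF that(1), of i] Fx0[of i p] Bx0[OF that(1)] that(2) by (auto simp: F'_def)
  have Fs: "F' s = (\<lambda>z. R - (\<Sum>j<N. (z j)\<^sup>2))" by (simp add: F'_def B_def)
  have Fs_pos: "F' s (x0 p) > 0" if "p < M" for p using Bx0[OF that] by (simp add: F'_def)
  have x0_supp: "x0 p j = 0" if "N \<le> j" for p j using that by (simp add: x0_def)
  from joint_critical_points[of ?s N D F' M x0 s R DF DDF, OF F' F'x0 x0_supp lessI Fs Fs_pos DF(2) DDF(2)]
  obtain X U where
    XU: "(\<forall>p<M. \<forall>i<?s. sgn (F' i (X p)) = sgn (F' i (x0 p))) \<and>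
    (\<forall>p<M. \<forall>j<N. (\<Sum>i<?s. DF i j (X p) / F' i (X p)) + U j = 0) \<and>
    (\<forall>p<M. \<forall>w. (\<Sum>i<?s. (\<Sum>j<N. w j * (\<Sum>l<N. w l * DDF i j l (X p))) / F' i (X p) -
        ((\<Sum>j<N. w j * DF i j (X p)) / F' i (X p))\<^sup>2) \<le> - (\<Sum>j<N. (w j)\<^sup>2))"
    by blast
  have sgnX: "sgn (F' i (X p)) = sgn (F' i (x0 p))" if "p < M" "i < ?s" for p i
    using XU[THEN conjunct1] that by simp
  have crit: "(\<Sum>i<?s. DF i j (X p) / F' i (X p)) + U j = 0" if "p < M" "j < N" for p j
    using XU[THEN conjunct2, THEN conjunct1] that by simp
  have hess: "(\<Sum>i<?s. (\<Sum>j<N. w j * (\<Sum>l<N. w l * DDF i j l (X p))) / F' i (X p) -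
        ((\<Sum>j<N. w j * DF i j (X p)) / F' i (X p))\<^sup>2) \<le> - (\<Sum>j<N. (w j)\<^sup>2)" if "p < M" for p w
    using XU[THEN conjunct2, THEN conjunct2] that by simp
  have F'X: "F' i (X p) \<noteq> 0" if "p < M" "i < ?s" for p i
    using sgnX[OF that] F'x0[OF that] by (auto simp: sgn_if split: if_splits)
  define y where "y p i = 1 / F' i (X p)" for p i
  define z where "z p j = (if j < N then X p j else y p (j - N))" for p j
  have zX: "f (z p) = f (X p)" if "bipoly N 0 D 0 f" for f p
    by (rule bipoly_cong_vars[OF that]) (simp add: z_def)
  have F'z: "F' i (z p) = F' i (X p)" and DFz: "DF i j (z p) = DF i j (X p)"
    and DDFz: "DDF i j l (z p) = DDF i j l (X p)" for i j l p
    using zX[OF F'] zX[OF DF(1)] zX[OF DDF(1)] by simp_all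
  have zy: "z p (N + i) = y p i" for p i by (simp add: z_def)
  \<comment> \<open>The critical equations with 1 / F' l replaced by a variable, followed by the
    equations that define these variables. Since \<open>U\<close> is common to all points, every
    \<open>z p\<close> solves this one system.\<close>
  define f where "f i = (if i < N then (\<lambda>z. (\<Sum>l<?s. z (N + l) * DF l i z) + U i)
    else (\<lambda>z. z (N + (i - N)) * F' (i - N) z + (-1)))" for i
  show ?thesis
  proof (rule nondegenerate_zeros_bound[of N ?s D f M z])
    fix i assume i: "i < N + ?s"
    have "bipoly N ?s (0 + D) (1 + 0) (\<lambda>z. z (N + l) * DF l i z)" if "l < ?s" for l
      by (rule bipoly.mult[OF bipoly.yvar bipoly_more_vars[OF DF(1)]]) (use that in auto)
    moreover have "bipoly N ?s (0 + D) (1 + 0) (\<lambda>z. z (N + (i - N)) * F' (i - N) z)" if "\<not> i < N"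
      by (rule bipoly.mult[OF bipoly.yvar bipoly_more_vars[OF F']]) (use i that in auto)
    ultimately show "bipoly N ?s D 1 (f i)"
      by (cases "i < N") (simp_all only: f_def if_True if_False add_0,
        (intro bipoly.add bipoly_sum bipoly.const; simp)+)
  next
    fix p i assume p: "p < M" and i: "i < N + ?s"
    show "f i (z p) = 0"
    proof (cases "i < N")
      case True
      have "f i (z p) = (\<Sum>l<?s. DF l i (X p) / F' l (X p)) + U i"
        using True by (simp add: f_def zy DFz y_def del: sum.lessThan_Suc)
      then show ?thesis using crit[OF p True] by simp
    next
      case False
      then show ?thesis using F'X[OF p, of "i - N"] i
        by (simp only: f_def if_False zy F'z y_def) simp
    qed
  next
    fix p q assume pq: "p < M" "q < M" "p \<noteq> q"
    from distinct[OF this] obtain i where i: "i < s" "sgn (F i (x p)) \<noteq> sgn (F i (x q))" by auto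
    have "sgn (F i (X p)) = sgn (F i (x p))" "sgn (F i (X q)) = sgn (F i (x q))"
      using sgnX[of p i] sgnX[of q i] pq i Fx0 by (auto simp: F'_def)
    with i have "F i (X p) \<noteq> F i (X q)" by metis
    then show "\<exists>j<N. z p j \<noteq> z q j"
      using bipoly_cong_vars[OF F[OF i(1)], of "X p" "X q"] by (auto simp: z_def)
  next
    fix p \<zeta> assume p: "p < M"
    \<comment> \<open>The Hessian of the sum of ln |F' i| at \<open>X p\<close>. Nondegeneracy of
      the whole system reduces, after eliminating the y part, to a linear system with this matrix,
      which is injective because it is negative definite.\<close>
    define H where "H j l = (\<Sum>i<?s. y p i * DDF i j l (X p) - (y p i)\<^sup>2 * DF i l (X p) * DF i j (X p))" for j l
    have "\<exists>\<xi>. \<forall>j<N. (\<Sum>l<N. H j l * \<xi> l) = \<zeta> j - (\<Sum>i<?s. y p i * \<zeta> (N + i) * DF i j (X p))"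
    proof (rule injective_imp_solvable)
      fix \<xi> assume 0: "\<And>j. j < N \<Longrightarrow> (\<Sum>l<N. H j l * \<xi> l) = 0"
      have "(\<Sum>j<N. \<xi> j * (\<Sum>l<N. H j l * \<xi> l)) =
        (\<Sum>i<?s. (\<Sum>j<N. \<xi> j * (\<Sum>l<N. \<xi> l * DDF i j l (X p))) / F' i (X p) -
        ((\<Sum>j<N. \<xi> j * DF i j (X p)) / F' i (X p))\<^sup>2)" (is "?l = ?r")
      proof -
        have "?l = (\<Sum>j<N. \<Sum>l<N. \<Sum>i<?s. \<xi> j * ((y p i * DDF i j l (X p) - (y p i)\<^sup>2 * DF i l (X p) * DF i j (X p)) * \<xi> l))"
          by (simp only: H_def sum_distrib_left sum_distrib_right)
        also have "\<dots> = (\<Sum>i<?s. \<Sum>j<N. \<Sum>l<N. \<xi> j * ((y p i * DDF i j l (X p) - (y p i)\<^sup>2 * DF i l (X p) * DF i j (X p)) * \<xi> l))"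
          by (simp only: sum.swap[of _ "{..<?s}"])
        also have "\<dots> = ?r"
        proof (rule sum.cong[OF refl])
          fix i
          have "(\<Sum>j<N. \<Sum>l<N. \<xi> j * ((y p i * DDF i j l (X p) - (y p i)\<^sup>2 * DF i l (X p) * DF i j (X p)) * \<xi> l))
            = y p i * (\<Sum>j<N. \<Sum>l<N. \<xi> j * (\<xi> l * DDF i j l (X p))) -
              (y p i)\<^sup>2 * (\<Sum>j<N. \<Sum>l<N. (\<xi> j * DF i j (X p)) * (\<xi> l * DF i l (X p)))"
            by (simp add: sum_distrib_left sum_subtractf algebra_simps)
          also have "(\<Sum>j<N. \<Sum>l<N. (\<xi> j * DF i j (X p)) * (\<xi> l * DF i l (X p))) = (\<Sum>j<N. \<xi> j * DF i j (X p))\<^sup>2"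
            by (simp add: power2_eq_square sum_product)
          finally show "(\<Sum>j<N. \<Sum>l<N. \<xi> j * ((y p i * DDF i j l (X p) - (y p i)\<^sup>2 * DF i l (X p) * DF i j (X p)) * \<xi> l)) =
            (\<Sum>j<N. \<xi> j * (\<Sum>l<N. \<xi> l * DDF i j l (X p))) / F' i (X p) -
             ((\<Sum>j<N. \<xi> j * DF i j (X p)) / F' i (X p))\<^sup>2"
            by (simp add: y_def power_divide flip: sum_distrib_left)
        qed
        finally show ?thesis .
      qed
      then have "(\<Sum>j<N. (\<xi> j)\<^sup>2) \<le> 0" using hess[OF p, of \<xi>] 0 by simp
      then have "(\<Sum>j<N. (\<xi> j)\<^sup>2) = 0" by (intro antisym sum_nonneg) auto
      then show "\<forall>l<N. \<xi> l = 0" by (subst (asm) sum_nonneg_eq_0_iff) auto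
    qed
    then obtain \<xi> where \<xi>: "\<And>j. j < N \<Longrightarrow>
      (\<Sum>l<N. H j l * \<xi> l) = \<zeta> j - (\<Sum>i<?s. y p i * \<zeta> (N + i) * DF i j (X p))" by blast
    \<comment> \<open>The y part of the direction, obtained by differentiating y l * F' l - 1,
      setting the result to its prescribed value and solving in terms of \<xi>.\<close>
    define \<eta> where "\<eta> i = y p i * (\<zeta> (N + i) - y p i * (\<Sum>l<N. \<xi> l * DF i l (X p)))" for i
    define w where "w j = (if j < N then \<xi> j else \<eta> (j - N))" for j
    have wN: "w (N + i) = \<eta> i" for i by (simp add: w_def)
    have w_sum: "(\<Sum>l<N. w l * g l) = (\<Sum>l<N. \<xi> l * g l)" for g by (simp add: w_def)
    have D1: "((\<lambda>t. F' i (\<lambda>j. z p j + t * w j)) has_real_derivative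
       (\<Sum>j<N. \<xi> j * DF i j (X p))) (at 0)" for i
      using DF(2)[of i "z p" w 0] by (simp add: w_sum DFz)
    have D2: "((\<lambda>t. DF i j (\<lambda>j. z p j + t * w j)) has_real_derivative
       (\<Sum>l<N. \<xi> l * DDF i j l (X p))) (at 0)" for i j
      using DDF(2)[of i j "z p" w 0] by (simp add: w_sum DDFz)
    have Dy: "((\<lambda>t. z p (N + l) + t * w (N + l)) has_real_derivative \<eta> l) (at 0)" for l
      by (auto intro!: derivative_eq_intros simp: wN)
    show "\<exists>w. \<forall>i<N + ?s. ((\<lambda>t. f i (\<lambda>j. z p j + t * w j)) has_real_derivative \<zeta> i) (at 0)"
    proof (intro exI[of _ w] allI impI)
      fix i assume i: "i < N + ?s"
      show "((\<lambda>t. f i (\<lambda>j. z p j + t * w j)) has_real_derivative \<zeta> i) (at 0)"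
      proof (cases "i < N")
        case True
        have "((\<lambda>t. (z p (N + l) + t * w (N + l)) * DF l i (\<lambda>j. z p j + t * w j)) has_real_derivative
            \<eta> l * DF l i (X p) + (\<Sum>m<N. \<xi> m * DDF l i m (X p)) * y p l) (at 0)" for l
          using DERIV_mult[OF Dy D2, of l l i] by (simp add: DFz zy)
        then have "((\<lambda>t. f i (\<lambda>j. z p j + t * w j)) has_real_derivative
            (\<Sum>l<?s. \<eta> l * DF l i (X p) + (\<Sum>m<N. \<xi> m * DDF l i m (X p)) * y p l) + 0) (at 0)"
          unfolding f_def if_P[OF True] by (intro DERIV_add DERIV_sum DERIV_const)
        moreover have "(\<Sum>l<?s. \<eta> l * DF l i (X p) + (\<Sum>m<N. \<xi> m * DDF l i m (X p)) * y p l) =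
            (\<Sum>l<?s. y p l * \<zeta> (N + l) * DF l i (X p)) + (\<Sum>m<N. H i m * \<xi> m)"
        proof -
          have "(\<Sum>m<N. H i m * \<xi> m) = (\<Sum>l<?s. \<Sum>m<N. (y p l * DDF l i m (X p) - (y p l)\<^sup>2 * DF l m (X p) * DF l i (X p)) * \<xi> m)"
            unfolding H_def sum_distrib_right by (rule sum.swap)
          also have "\<dots> = (\<Sum>l<?s. (\<Sum>m<N. \<xi> m * DDF l i m (X p)) * y p l -
              (y p l)\<^sup>2 * (\<Sum>m<N. \<xi> m * DF l m (X p)) * DF l i (X p))"
            by (intro sum.cong refl)
              (simp add: sum_distrib_left sum_distrib_right sum_subtractf algebra_simps)
          finally show ?thesis
            by (simp only: flip: sum.distrib)
              (intro sum.cong refl, simp add: \<eta>_def algebra_simps power2_eq_square)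
        qed
        ultimately show ?thesis using \<xi>[OF True] by simp
      next
        case False
        define l where "l = i - N"
        have l: "l < ?s" "i = N + l" using False i by (auto simp: l_def)
        have "((\<lambda>t. (z p (N + l) + t * w (N + l)) * F' l (\<lambda>j. z p j + t * w j) + (-1)) has_real_derivative
            \<eta> l * F' l (X p) + (\<Sum>m<N. \<xi> m * DF l m (X p)) * y p l + 0) (at 0)"
          using DERIV_add[OF DERIV_mult[OF Dy D1, of l l] DERIV_const[of "-1"]]
          by (simp add: F'z zy)
        moreover have "\<eta> l * F' l (X p) + (\<Sum>m<N. \<xi> m * DF l m (X p)) * y p l + 0 = \<zeta> i"
          using F'X[OF p l(1)] l(2) by (simp add: \<eta>_def y_def field_simps)
        ultimately show ?thesis using False by (simp add: f_def l(2))
      qed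
    qed
  qed
qed

lemma finite_sgn_patterns:
  assumes "finite I"
  shows "finite (range (\<lambda>x. restrict (\<lambda>i. sgn (P i x :: real)) I))"
proof (rule finite_subset)
  show "range (\<lambda>x. restrict (\<lambda>i. sgn (P i x)) I) \<subseteq> PiE I (\<lambda>_. {-1, 0, 1 :: real})"
    by (auto simp: sgn_if split: if_splits)
  show "finite (PiE I (\<lambda>_. {-1, 0, 1 :: real}))"
    using assms by (intro finite_PiE) auto
qed

text \<open>A sign in {-1, 0, 1} can be read off from the strict signs of P - \<epsilon> and P +
  \<epsilon>, provided \<epsilon> is below all nonzero absolute values at the chosen points. This
  doubles the number of polynomials.\<close>

theorem sign_patterns_bound:
  fixes P :: "'i \<Rightarrow> (nat \<Rightarrow> real) \<Rightarrow> real"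
  assumes fin: "finite I" and P: "\<And>i. i \<in> I \<Longrightarrow> bipoly N 0 D 0 (P i)" and D: "D \<ge> 2"
  shows "card (range (\<lambda>x. restrict (\<lambda>i. sgn (P i x)) I)) \<le> D ^ N * ((N + Suc (2 * card I)) choose N)"
proof -
  let ?pat = "\<lambda>x. restrict (\<lambda>i. sgn (P i x)) I"
  define M where "M = card (range ?pat)"
  define c where "c = card I"
  obtain e where e: "bij_betw e {..<M} (range ?pat)"
    using ex_bij_betw_nat_finite[OF finite_sgn_patterns[OF fin]] by (auto simp: M_def atLeast0LessThan)
  obtain h where h: "bij_betw h {..<c} I"
    using ex_bij_betw_nat_finite[OF fin] by (auto simp: c_def atLeast0LessThan)
  have "\<forall>p. \<exists>x. p < M \<longrightarrow> e p = ?pat x"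
    using bij_betw_imp_surj_on[OF e] by auto
  from choice[OF this] obtain x where x: "\<And>p. p < M \<Longrightarrow> e p = ?pat (x p)" by auto
  \<comment> \<open>The element 1 keeps the minimum defined and positive even if all values
    vanish.\<close>
  define E where "E = insert 1 ((\<lambda>(i, p). \<bar>P i (x p)\<bar>) ` (I \<times> {..<M}) - {0})"
  have finE: "finite E" using fin by (simp add: E_def)
  define \<epsilon> where "\<epsilon> = Min E / 2"
  have "0 < Min E" using finE by (subst Min_gr_iff) (auto simp: E_def)
  then have e0: "\<epsilon> > 0" by (simp add: \<epsilon>_def)
  have small: "\<epsilon> < \<bar>P i (x p)\<bar>" if "i \<in> I" "p < M" "P i (x p) \<noteq> 0" for i p
  proof -
    have "\<bar>P i (x p)\<bar> \<in> E" using that by (auto simp: E_def)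
    from Min_le[OF finE this] show ?thesis using \<open>0 < Min E\<close> by (simp add: \<epsilon>_def)
  qed
  define F where "F k = (if k < c then (\<lambda>z. P (h k) z + (-\<epsilon>)) else (\<lambda>z. P (h (k - c)) z + \<epsilon>))" for k
  have hI: "h k \<in> I" if "k < c" for k using h that by (auto simp: bij_betw_def)
  show ?thesis
  proof (fold M_def, fold c_def, rule strict_sign_patterns_bound[of "2 * c" N D F M x])
    fix k assume "k < 2 * c"
    then show "bipoly N 0 D 0 (F k)"
      by (cases "k < c") (auto simp: F_def simp del: diff_conv_add_uminus add_uminus_conv_diff
        intro!: bipoly.add P bipoly.const hI)
  next
    fix p k assume "p < M" "k < 2 * c"
    then show "F k (x p) \<noteq> 0"
      using small[of "h k" p] small[of "h (k - c)" p] hI[of k] hI[of "k - c"] e0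
      by (cases "k < c") (auto simp: F_def)
  next
    fix p q assume pq: "p < M" "q < M" "p \<noteq> q"
    then have "e p \<noteq> e q" using e by (auto simp: bij_betw_def inj_on_def)
    then have "?pat (x p) \<noteq> ?pat (x q)" using x pq by simp
    then obtain i where i: "i \<in> I" "sgn (P i (x p)) \<noteq> sgn (P i (x q))"
      by (auto simp: fun_eq_iff restrict_def split: if_splits)
    then obtain k where k: "k < c" "i = h k" using h by (auto simp: bij_betw_def)
    have "sgn (F k (x p)) \<noteq> sgn (F k (x q)) \<or> sgn (F (k + c) (x p)) \<noteq> sgn (F (k + c) (x q))"
      using i(2) small[OF i(1) pq(1)] small[OF i(1) pq(2)] e0 k
      by (auto simp: F_def sgn_if split: if_splits)
    then show "\<exists>k<2 * c. sgn (F k (x p)) \<noteq> sgn (F k (x q))"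
    proof
      assume "sgn (F k (x p)) \<noteq> sgn (F k (x q))"
      then show ?thesis using k by (intro exI[of _ k]) auto
    next
      assume "sgn (F (k + c) (x p)) \<noteq> sgn (F (k + c) (x q))"
      then show ?thesis using k by (intro exI[of _ "k + c"]) auto
    qed
  qed (rule D)
qed

section \<open>Faces of zonotopes and covectors\<close>

text \<open>Numbered generators make covectors sign vectors on {..<n}, and make it possible to speak
  of labelled zonotopes.\<close>

definition zon :: "(nat \<Rightarrow> 'a::euclidean_space) \<Rightarrow> nat \<Rightarrow> 'a set" where
  "zon v n = {\<Sum>i<n. t i *\<^sub>R v i | t. \<forall>i<n. 0 \<le> t i \<and> t i \<le> 1}"

definition covector :: "(nat \<Rightarrow> 'a::euclidean_space) \<Rightarrow> nat \<Rightarrow> 'a \<Rightarrow> nat \<Rightarrow> real" where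
  "covector v n u = (\<lambda>i. if i < n then sgn (v i \<bullet> u) else 0)"

text \<open>The usual partial order on covectors: \<tau> may differ from \<sigma> only at zeros of
  \<sigma>. It is the reverse of inclusion of faces.\<close>

definition conforms :: "(nat \<Rightarrow> real) \<Rightarrow> (nat \<Rightarrow> real) \<Rightarrow> bool" where
  "conforms \<sigma> \<tau> \<longleftrightarrow> (\<forall>i. \<sigma> i \<noteq> 0 \<longrightarrow> \<tau> i = \<sigma> i)"

definition zon_support :: "(nat \<Rightarrow> 'a::euclidean_space) \<Rightarrow> nat \<Rightarrow> 'a \<Rightarrow> real" where
  "zon_support v n u = (\<Sum>i<n. max 0 (v i \<bullet> u))"

definition zon_face :: "(nat \<Rightarrow> 'a::euclidean_space) \<Rightarrow> nat \<Rightarrow> 'a \<Rightarrow> 'a set" where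
  "zon_face v n u = zon v n \<inter> {x. u \<bullet> x = zon_support v n u}"

lemma conforms_antisym: "conforms \<sigma> \<tau> \<Longrightarrow> conforms \<tau> \<sigma> \<Longrightarrow> \<sigma> = \<tau>"
  unfolding conforms_def by (metis ext)

text \<open>Adding a generator is a Minkowski sum with a segment, that is, a linear image of a
  product of polytopes.\<close>

lemma polytope_zon: "polytope (zon v n)"
proof (induction n)
  case 0
  have "zon v 0 = convex hull {0}" by (auto simp: zon_def)
  then show ?case by (metis finite.emptyI finite.insertI polytope_convex_hull)
next
  case (Suc n)
  have "zon v (Suc n) = (\<lambda>z. fst z + snd z) ` (zon v n \<times> closed_segment 0 (v n))"
  proof safe
    fix x assume "x \<in> zon v (Suc n)"
    then obtain t where t: "\<And>i. i < Suc n \<Longrightarrow> 0 \<le> t i \<and> t i \<le> 1" "x = (\<Sum>i<Suc n. t i *\<^sub>R v i)"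
      by (auto simp: zon_def)
    have "(\<Sum>i<n. t i *\<^sub>R v i) \<in> zon v n" using t by (auto simp: zon_def)
    moreover have "t n *\<^sub>R v n \<in> closed_segment 0 (v n)"
      using t(1)[of n] by (auto simp: closed_segment_def)
    ultimately show "x \<in> (\<lambda>z. fst z + snd z) ` (zon v n \<times> closed_segment 0 (v n))"
      using t(2) by (force simp: image_iff)
  next
    fix a b assume "a \<in> zon v n" "b \<in> closed_segment 0 (v n)"
    then obtain t c where t: "\<And>i. i < n \<Longrightarrow> 0 \<le> t i \<and> t i \<le> 1" "a = (\<Sum>i<n. t i *\<^sub>R v i)"
      and c: "0 \<le> c" "c \<le> 1" "b = c *\<^sub>R v n"
      by (auto simp: zon_def closed_segment_def)
    have "a + b = (\<Sum>i<Suc n. (t(n := c)) i *\<^sub>R v i)" using t(2) c(3) by simp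
    moreover have "\<forall>i<Suc n. 0 \<le> (t(n := c)) i \<and> (t(n := c)) i \<le> 1" using t(1) c by (auto simp: less_Suc_eq)
    ultimately show "fst (a, b) + snd (a, b) \<in> zon v (Suc n)"
      unfolding zon_def fst_conv snd_conv by (intro CollectI exI[of _ "t(n := c)"] conjI)
  qed
  moreover have "linear (\<lambda>z::'a \<times> 'a. fst z + snd z)"
    by (intro linear_compose_add linear_fst linear_snd)
  moreover have "polytope (closed_segment 0 (v n))" by (simp add: segment_convex_hull polytope_convex_hull)
  ultimately show ?case using Suc by (auto intro!: polytope_linear_image polytope_Times)
qed

lemma inner_zon_sum:
  fixes v :: "nat \<Rightarrow> 'a::euclidean_space"
  shows "u \<bullet> (\<Sum>i<n. t i *\<^sub>R v i) = (\<Sum>i<n. t i * (v i \<bullet> u))"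
  by (simp add: inner_sum_right inner_commute)

lemma zon_term_le:
  fixes t c :: real
  assumes "0 \<le> t" "t \<le> 1"
  shows "t * c \<le> max 0 c" "t * c = max 0 c \<longleftrightarrow> (c > 0 \<longrightarrow> t = 1) \<and> (c < 0 \<longrightarrow> t = 0)"
  using assms by (auto simp: max_def mult_left_le_one_le mult_nonneg_nonpos mult_less_0_iff)

lemma inner_le_zon_support:
  assumes "x \<in> zon v n"
  shows "u \<bullet> x \<le> zon_support v n u"
  using assms by (auto simp: zon_def inner_zon_sum zon_support_def intro!: sum_mono zon_term_le)

text \<open>The support function is a sum of separate maxima, so the total is attained only when
  every summand attains its own maximum.\<close>

lemma inner_zon_eq_support_iff:
  assumes "\<forall>i<n. 0 \<le> t i \<and> t i \<le> 1"
  shows "u \<bullet> (\<Sum>i<n. t i *\<^sub>R v i) = zon_support v n u \<longleftrightarrow>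
    (\<forall>i<n. (v i \<bullet> u > 0 \<longrightarrow> t i = 1) \<and> (v i \<bullet> u < 0 \<longrightarrow> t i = 0))"
proof -
  have "u \<bullet> (\<Sum>i<n. t i *\<^sub>R v i) = zon_support v n u \<longleftrightarrow>
    (\<forall>i\<in>{..<n}. t i * (v i \<bullet> u) = max 0 (v i \<bullet> u))"
  proof
    assume eq: "u \<bullet> (\<Sum>i<n. t i *\<^sub>R v i) = zon_support v n u"
    show "\<forall>i\<in>{..<n}. t i * (v i \<bullet> u) = max 0 (v i \<bullet> u)"
    proof
      fix i assume "i \<in> {..<n}"
      from sum_mono_inv[OF eq[unfolded inner_zon_sum zon_support_def] _ this]
      show "t i * (v i \<bullet> u) = max 0 (v i \<bullet> u)" using assms zon_term_le(1) by auto
    qed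
  qed (simp add: inner_zon_sum zon_support_def)
  then show ?thesis using assms zon_term_le(2) by auto
qed

lemma zon_face_eq: "zon_face v n u = {\<Sum>i<n. t i *\<^sub>R v i | t. (\<forall>i<n. 0 \<le> t i \<and> t i \<le> 1) \<and>
    (\<forall>i<n. (v i \<bullet> u > 0 \<longrightarrow> t i = 1) \<and> (v i \<bullet> u < 0 \<longrightarrow> t i = 0))}" (is "_ = ?R")
proof (intro equalityI subsetI)
  fix x assume "x \<in> zon_face v n u"
  then obtain t where t: "\<forall>i<n. 0 \<le> t i \<and> t i \<le> 1" "x = (\<Sum>i<n. t i *\<^sub>R v i)" "u \<bullet> x = zon_support v n u"
    by (auto simp: zon_face_def zon_def)
  with inner_zon_eq_support_iff[OF t(1)] show "x \<in> ?R" by blast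
next
  fix x assume "x \<in> ?R"
  then obtain t where t: "\<forall>i<n. 0 \<le> t i \<and> t i \<le> 1" "x = (\<Sum>i<n. t i *\<^sub>R v i)"
     "\<forall>i<n. (v i \<bullet> u > 0 \<longrightarrow> t i = 1) \<and> (v i \<bullet> u < 0 \<longrightarrow> t i = 0)" by blast
  with inner_zon_eq_support_iff[OF t(1)] show "x \<in> zon_face v n u"
    by (auto simp: zon_face_def zon_def)
qed

lemma zon_face_point: "(\<Sum>i<n. (if v i \<bullet> u > 0 then 1 else 0) *\<^sub>R v i) \<in> zon_face v n u"
  unfolding zon_face_eq by (intro CollectI exI[of _ "\<lambda>i. if v i \<bullet> u > 0 then 1 else 0"]) auto

lemma zon_face_nonempty: "zon_face v n u \<noteq> {}"
  using zon_face_point by blast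

text \<open>Faces of a polytope are exposed, and a supporting hyperplane that meets the polytope
  must sit at the support value.\<close>

lemma face_of_zon_iff: "F face_of zon v n \<longleftrightarrow> F = {} \<or> (\<exists>u. F = zon_face v n u)"
proof
  assume "F face_of zon v n"
  then have "F exposed_face_of zon v n"
    using exposed_face_of_polyhedron polytope_imp_polyhedron polytope_zon by blast
  then obtain a b where ab: "zon v n \<subseteq> {x. a \<bullet> x \<le> b}" "F = zon v n \<inter> {x. a \<bullet> x = b}"
    by (auto simp: exposed_face_of_def)
  show "F = {} \<or> (\<exists>u. F = zon_face v n u)"
  proof (cases "F = {}")
    case False
    then obtain x where "x \<in> zon v n" "a \<bullet> x = b" using ab by auto
    then have "b \<le> zon_support v n a" using inner_le_zon_support by blast
    moreover have "zon_support v n a \<le> b"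
      using zon_face_point[of v a n] ab(1) by (auto simp: zon_face_def)
    ultimately show ?thesis using ab(2) by (auto simp: zon_face_def)
  qed simp
next
  assume "F = {} \<or> (\<exists>u. F = zon_face v n u)"
  then show "F face_of zon v n"
    using face_of_Int_supporting_hyperplane_le[of "zon v n"] polytope_imp_convex[OF polytope_zon]
      inner_le_zon_support by (fastforce simp: zon_face_def)
qed

lemma zon_face_subset_iff:
  "zon_face v n u \<subseteq> zon_face v n w \<longleftrightarrow> conforms (covector v n w) (covector v n u)"
proof
  assume sub: "zon_face v n u \<subseteq> zon_face v n w"
  show "conforms (covector v n w) (covector v n u)"
    unfolding conforms_def
  proof (intro allI impI, rule ccontr)
    fix k assume k: "covector v n w k \<noteq> 0" "covector v n u k \<noteq> covector v n w k"
    then have kn: "k < n" and nz: "v k \<bullet> w \<noteq> 0"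
      by (auto simp: covector_def split: if_splits)
    \<comment> \<open>A point of the face of u that violates the condition of w at k. If v k is
      orthogonal to u, its coefficient is free and is set to the wrong end; otherwise u and w have
      opposite signs at k and the forced coefficient is already wrong.\<close>
    define t where "t i = (if i = k \<and> v k \<bullet> u = 0 then (if v k \<bullet> w > 0 then 0 else 1)
       else if v i \<bullet> u > 0 then 1 else 0 :: real)" for i
    have t01: "\<forall>i<n. 0 \<le> t i \<and> t i \<le> 1" by (auto simp: t_def)
    have "(\<Sum>i<n. t i *\<^sub>R v i) \<in> zon_face v n u"
      unfolding zon_face_eq by (intro CollectI exI[of _ t]) (auto simp: t_def)
    then have "w \<bullet> (\<Sum>i<n. t i *\<^sub>R v i) = zon_support v n w" using sub by (auto simp: zon_face_def)
    with inner_zon_eq_support_iff[OF t01] kn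
    have "(v k \<bullet> w > 0 \<longrightarrow> t k = 1) \<and> (v k \<bullet> w < 0 \<longrightarrow> t k = 0)" by blast
    then show False using k(2) kn nz by (auto simp: t_def covector_def sgn_if split: if_splits)
  qed
next
  assume c: "conforms (covector v n w) (covector v n u)"
  have "(v i \<bullet> w > 0 \<longrightarrow> v i \<bullet> u > 0) \<and> (v i \<bullet> w < 0 \<longrightarrow> v i \<bullet> u < 0)" if "i < n" for i
    using c[unfolded conforms_def, rule_format, of i] that
    by (auto simp: covector_def sgn_if split: if_splits)
  then show "zon_face v n u \<subseteq> zon_face v n w"
    unfolding zon_face_eq by blast
qed

lemma zon_face_eq_iff: "zon_face v n u = zon_face v n w \<longleftrightarrow> covector v n u = covector v n w"
  by (metis zon_face_subset_iff conforms_antisym order_refl subset_antisym)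

text \<open>Inclusion of faces is a relation between covectors, so matching equal covectors is an
  isomorphism. The choice of a vector for each face is harmless because equal faces have equal
  covectors.\<close>

lemma same_comb_type_zon:
  assumes "range (covector v n) = range (covector w n)"
  shows "same_comb_type (zon v n) (zon w n)"
proof -
  have "\<forall>u. \<exists>u'. covector w n u' = covector v n u" using assms by (metis rangeE rangeI)
  from choice[OF this] obtain \<alpha> where \<alpha>: "\<And>u. covector w n (\<alpha> u) = covector v n u" by blast
  have sub: "zon_face v n u \<subseteq> zon_face v n u' \<longleftrightarrow> zon_face w n (\<alpha> u) \<subseteq> zon_face w n (\<alpha> u')" for u u'
    by (simp add: zon_face_subset_iff \<alpha>)
  define d where "d F = (SOME u. F = zon_face v n u)" for F
  have d: "zon_face v n (d (zon_face v n u)) = zon_face v n u" for u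
    unfolding d_def by (metis (mono_tags, lifting) someI)
  define f where "f F = (if F = {} then {} else zon_face w n (\<alpha> (d F)))" for F
  have f_face: "f (zon_face v n u) = zon_face w n (\<alpha> u)" for u
    using d[of u] sub[of u "d (zon_face v n u)"] sub[of "d (zon_face v n u)" u]
    by (simp add: f_def zon_face_nonempty)
  have f_sub: "f F \<subseteq> f F' \<longleftrightarrow> F \<subseteq> F'" if "F face_of zon v n" "F' face_of zon v n" for F F'
  proof -
    have 0: "f {} = {}" by (simp add: f_def)
    from that[unfolded face_of_zon_iff] show ?thesis
      by (elim disjE exE) (simp_all only: f_face 0 sub empty_subsetI subset_empty zon_face_nonempty simp_thms)
  qed
  have "bij_betw f {F. F face_of zon v n} {F. F face_of zon w n}"
    unfolding bij_betw_def
  proof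
    show "inj_on f {F. F face_of zon v n}"
      by (rule inj_onI) (metis f_sub mem_Collect_eq order_refl subset_antisym)
    have "\<exists>u'. zon_face w n u = zon_face w n (\<alpha> u')" for u
      using assms \<alpha> by (metis rangeE rangeI zon_face_eq_iff)
    then have "range (\<lambda>u. zon_face w n (\<alpha> u)) = range (zon_face w n)" by blast
    moreover have faces: "{F. F face_of zon v n} = insert {} (range (zon_face v n))"
      "{F. F face_of zon w n} = insert {} (range (zon_face w n))"
      by (auto simp: face_of_zon_iff)
    moreover have "f {} = {}" by (simp add: f_def)
    ultimately show "f ` {F. F face_of zon v n} = {F. F face_of zon w n}"
      by (simp add: image_image f_face)
  qed
  then show ?thesis unfolding same_comb_type_def using f_sub by blast
qed

section \<open>Combinatorial type as an equivalence, and zonotopes with numbered generators\<close>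

lemma same_comb_typeI:
  assumes "bij_betw f {F. F face_of P} {F. F face_of Q}"
    and "\<And>F F'. F face_of P \<Longrightarrow> F' face_of P \<Longrightarrow> F \<subseteq> F' \<longleftrightarrow> f F \<subseteq> f F'"
  shows "same_comb_type P Q"
  unfolding same_comb_type_def by (rule exI[of _ f]) (use assms in auto)

lemma same_comb_typeE:
  assumes "same_comb_type P Q"
  obtains f where "bij_betw f {F. F face_of P} {F. F face_of Q}"
    and "\<forall>F F'. F face_of P \<longrightarrow> F' face_of P \<longrightarrow> (F \<subseteq> F' \<longleftrightarrow> f F \<subseteq> f F')"
proof -
  from assms obtain f where f: "bij_betw f {F. F face_of P} {F. F face_of Q} \<and>
     (\<forall>F\<in>{F. F face_of P}. \<forall>F'\<in>{F. F face_of P}. F \<subseteq> F' \<longleftrightarrow> f F \<subseteq> f F')"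
    unfolding same_comb_type_def ..
  show thesis by (rule that[of f]) (use f in simp_all)
qed

lemma same_comb_type_refl: "same_comb_type P P"
  by (rule same_comb_typeI[of id]) auto

lemma same_comb_type_sym:
  assumes "same_comb_type P Q"
  shows "same_comb_type Q P"
proof -
  from assms obtain f where f: "bij_betw f {F. F face_of P} {F. F face_of Q}"
    "\<forall>F F'. F face_of P \<longrightarrow> F' face_of P \<longrightarrow> (F \<subseteq> F' \<longleftrightarrow> f F \<subseteq> f F')"
    by (elim same_comb_typeE)
  let ?g = "inv_into {F. F face_of P} f"
  have g: "bij_betw ?g {F. F face_of Q} {F. F face_of P}" by (rule bij_betw_inv_into[OF f(1)])
  have fg: "f (?g F) = F" if "F face_of Q" for F
    using bij_betw_inv_into_right[OF f(1)] that by simp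
  show ?thesis
  proof (rule same_comb_typeI[OF g])
    fix F F' assume F: "F face_of Q" "F' face_of Q"
    then have "?g F face_of P" "?g F' face_of P" using bij_betwE[OF g] by auto
    from f(2)[rule_format, OF this] show "F \<subseteq> F' \<longleftrightarrow> ?g F \<subseteq> ?g F'" by (simp add: fg F)
  qed
qed

lemma same_comb_type_trans:
  assumes "same_comb_type P Q" "same_comb_type Q R"
  shows "same_comb_type P R"
proof -
  from assms(1) obtain f where f: "bij_betw f {F. F face_of P} {F. F face_of Q}"
    "\<forall>F F'. F face_of P \<longrightarrow> F' face_of P \<longrightarrow> (F \<subseteq> F' \<longleftrightarrow> f F \<subseteq> f F')"
    by (elim same_comb_typeE)
  from assms(2) obtain g where g: "bij_betw g {F. F face_of Q} {F. F face_of R}"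
    "\<forall>F F'. F face_of Q \<longrightarrow> F' face_of Q \<longrightarrow> (F \<subseteq> F' \<longleftrightarrow> g F \<subseteq> g F')"
    by (elim same_comb_typeE)
  show ?thesis
  proof (rule same_comb_typeI[OF bij_betw_trans[OF f(1) g(1)]])
    fix F F' assume F: "F face_of P" "F' face_of P"
    then have "f F face_of Q" "f F' face_of Q" using bij_betwE[OF f(1)] by auto
    then show "F \<subseteq> F' \<longleftrightarrow> (g \<circ> f) F \<subseteq> (g \<circ> f) F'" by (simp add: f(2)[rule_format, OF F] g(2))
  qed
qed

lemma same_comb_type_translation:
  fixes P :: "'a::euclidean_space set"
  shows "same_comb_type P ((\<lambda>x. a + x) ` P)"
  unfolding same_comb_type_def
proof (intro exI[of _ "image ((+) a)"] conjI ballI)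
  have inj: "inj ((+) a)" by simp
  have "G \<in> image ((+) a) ` {F. F face_of P}" if "G face_of (+) a ` P" for G
  proof -
    have "G = (+) a ` ((+) (-a) ` G)" by (simp add: image_image)
    moreover from this have "(+) (-a) ` G face_of P" using that face_of_translation_eq[of a] by metis
    ultimately show ?thesis by blast
  qed
  then have "image ((+) a) ` {F. F face_of P} = {F. F face_of (+) a ` P}"
    using face_of_translation_eq by auto
  then show "bij_betw ((`) ((+) a)) {F. F face_of P} {F. F face_of (+) a ` P}"
    by (auto simp: bij_betw_def intro!: inj_onI inj_image_eq_iff[OF inj, THEN iffD1])
  show "F \<subseteq> F' \<longleftrightarrow> (+) a ` F \<subseteq> (+) a ` F'" for F F'
    by (simp add: inj_image_subset_iff[OF inj])
qed

lemma zonotope_of_image: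
  fixes v :: "nat \<Rightarrow> 'a::euclidean_space"
  assumes "inj_on v {..<n}"
  shows "zonotope_of (v ` {..<n}) = zon v n"
proof (intro equalityI subsetI)
  fix x assume "x \<in> zonotope_of (v ` {..<n})"
  then obtain t where t: "x = (\<Sum>g\<in>v ` {..<n}. t g *\<^sub>R g)" "\<forall>g\<in>v ` {..<n}. 0 \<le> t g \<and> t g \<le> 1"
    by (auto simp: zonotope_of_def)
  then have "x = (\<Sum>i<n. (t \<circ> v) i *\<^sub>R v i)" using assms by (simp add: sum.reindex)
  then show "x \<in> zon v n" using t(2) unfolding zon_def by (intro CollectI exI[of _ "t \<circ> v"]) auto
next
  fix x assume "x \<in> zon v n"
  then obtain t where t: "x = (\<Sum>i<n. t i *\<^sub>R v i)" "\<forall>i<n. 0 \<le> t i \<and> t i \<le> 1"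
    by (auto simp: zon_def)
  let ?t = "t \<circ> inv_into {..<n} v"
  have "x = (\<Sum>g\<in>v ` {..<n}. ?t g *\<^sub>R g)" using assms t(1) by (simp add: sum.reindex)
  moreover have "\<forall>g\<in>v ` {..<n}. 0 \<le> ?t g \<and> ?t g \<le> 1" using t(2) assms by auto
  ultimately show "x \<in> zonotope_of (v ` {..<n})" unfolding zonotope_of_def by blast
qed

lemma zon_subset_span: "zon v n \<subseteq> span (v ` {..<n})"
proof
  fix x assume "x \<in> zon v n"
  then obtain t where x: "x = (\<Sum>i<n. t i *\<^sub>R v i)" by (auto simp: zon_def)
  show "x \<in> span (v ` {..<n})" unfolding x
    by (rule span_sum, rule span_scale, rule span_base) simp
qed

lemma generators_in_zon:
  assumes "i < n"
  shows "v i \<in> zon v n"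
  unfolding zon_def
  by (rule CollectI, rule exI[of _ "\<lambda>j. if j = i then 1 else 0"])
    (use assms in \<open>simp add: if_distrib[of "\<lambda>c. c *\<^sub>R _"] cong: if_cong\<close>)

lemma aff_dim_zon: "aff_dim (zon v n) = int (dim (v ` {..<n}))"
proof -
  have "0 \<in> zon v n" by (auto simp: zon_def intro!: exI[of _ "\<lambda>_. 0"])
  then have "aff_dim (zon v n) = int (dim (zon v n))"
    by (intro aff_dim_zero hull_inc)
  moreover have "span (zon v n) = span (v ` {..<n})"
  proof (rule span_eq[THEN iffD2], intro conjI)
    show "zon v n \<subseteq> span (v ` {..<n})" by (rule zon_subset_span)
    show "v ` {..<n} \<subseteq> span (zon v n)"
      using generators_in_zon[of _ n v] span_base by blast
  qed
  then have "dim (zon v n) = dim (v ` {..<n})" by (metis dim_span)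
  ultimately show ?thesis by simp
qed

lemma zonotopes_dim_obtain:
  fixes Z :: "(real^'d) set"
  assumes "Z \<in> zonotopes_dim TYPE('d::finite) n"
  obtains v :: "nat \<Rightarrow> real^'d" where "same_comb_type Z (zon v n)" "span (v ` {..<n}) = UNIV" "\<forall>i<n. v i \<noteq> 0"
proof -
  from assms obtain G a where G: "generator_set G" "card G = n" "Z = (\<lambda>x. a + x) ` zonotope_of G"
    and Z: "aff_dim Z = int CARD('d)"
    unfolding zonotopes_dim_def zonotope_with_gens_def by blast
  have "finite G" using G by (simp add: generator_set_def)
  then obtain v where v: "bij_betw v {..<n} G"
    using ex_bij_betw_nat_finite G(2) by (metis atLeast0LessThan)
  then have eq: "zonotope_of G = zon v n" and Gv: "v ` {..<n} = G"
    using zonotope_of_image[of v n] by (auto simp: bij_betw_def)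
  have "same_comb_type Z (zon v n)"
    unfolding G(3) eq by (rule same_comb_type_sym[OF same_comb_type_translation])
  moreover have "span (v ` {..<n}) = UNIV"
  proof -
    have "aff_dim Z = int (dim (v ` {..<n}))"
      using aff_dim_translation_eq[of a] G(3) eq by (simp add: aff_dim_zon)
    then have "dim (v ` {..<n}) = DIM(real^'d)" using Z by simp
    then show ?thesis using dim_eq_full by metis
  qed
  moreover have "\<forall>i<n. v i \<noteq> 0" using G(1) Gv by (force simp: generator_set_def)
  ultimately show thesis by (rule that)
qed

lemma zon_in_zonotopes_dim:
  fixes v :: "nat \<Rightarrow> real^'d::finite"
  assumes "inj_on v {..<n}" "generator_set (v ` {..<n})" "span (v ` {..<n}) = UNIV"
  shows "zon v n \<in> zonotopes_dim TYPE('d) n"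
proof -
  have "dim (v ` {..<n}) = CARD('d)" using assms(3) by (metis dim_span dim_UNIV DIM_cart DIM_real mult.right_neutral)
  moreover have "zonotope_with_gens (zon v n) n"
    unfolding zonotope_with_gens_def
    by (intro exI[of _ "v ` {..<n}"] exI[of _ 0])
      (use assms in \<open>simp add: zonotope_of_image card_image\<close>)
  ultimately show ?thesis by (simp add: zonotopes_dim_def aff_dim_zon)
qed

section \<open>The chirotope determines the covectors\<close>

lemma det_rows_eq_0_iff:
  fixes R :: "'d::finite \<Rightarrow> real^'d"
  shows "det (\<chi> a. R a) = 0 \<longleftrightarrow> (\<exists>x. x \<noteq> 0 \<and> (\<forall>a. R a \<bullet> x = 0))"
proof -
  have "det (\<chi> a. R a) = 0 \<longleftrightarrow> (\<exists>x. x \<noteq> 0 \<and> (\<chi> a. R a) *v x = 0)"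
    using invertible_det_nz[of "\<chi> a. R a"] invertible_left_inverse[of "\<chi> a. R a"]
      matrix_left_invertible_ker[of "\<chi> a. R a"] by auto
  also have "\<dots> \<longleftrightarrow> (\<exists>x. x \<noteq> 0 \<and> (\<forall>a. R a \<bullet> x = 0))"
    by (simp add: vec_eq_iff matrix_vector_mul_component)
  finally show ?thesis .
qed

lemma det_rows_solvable:
  fixes R :: "'d::finite \<Rightarrow> real^'d"
  assumes "det (\<chi> a. R a) \<noteq> 0"
  shows "\<exists>x. \<forall>a. R a \<bullet> x = y a"
proof -
  have "(\<chi> a. R a) *v (\<chi> k. det (\<chi> i j. if j = k then (\<chi> a. y a) $ i else (\<chi> a. R a) $ i $ j) / det (\<chi> a. R a)) = (\<chi> a. y a)"
    using cramer[OF assms] by blast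
  then show ?thesis
    by (auto simp: vec_eq_iff matrix_vector_mul_component)
qed

definition row_functional :: "('d::finite \<Rightarrow> real^'d) \<Rightarrow> 'd \<Rightarrow> real^'d \<Rightarrow> real" where
  "row_functional V a x = det (\<chi> b. if b = a then x else V b)"

lemma linear_row_functional: "linear (row_functional V a)"
proof (rule linearI)
  show "row_functional V a (x + y) = row_functional V a x + row_functional V a y" for x y
    unfolding row_functional_def using det_row_add[of a "\<lambda>_. x" "\<lambda>_. y" V] by simp
  show "row_functional V a (c *\<^sub>R x) = c *\<^sub>R row_functional V a x" for c x
    unfolding row_functional_def using det_row_mul[of a c "\<lambda>_. x" V]
    unfolding scalar_mult_eq_scaleR by simp
qed

lemma row_functional_row:
  assumes "b \<noteq> a"
  shows "row_functional V a (V b) = 0"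
proof -
  have "det (\<chi> c. if c = a then V b else V c) = 0"
    by (rule det_identical_rows[of a b]) (use assms in \<open>auto simp: row_def vec_eq_iff\<close>)
  then show ?thesis by (simp add: row_functional_def)
qed

text \<open>The generalised cross product of the rows other than \<open>a\<close>.\<close>

definition row_normal :: "('d::finite \<Rightarrow> real^'d) \<Rightarrow> 'd \<Rightarrow> real^'d" where
  "row_normal V a = (\<chi> i. row_functional V a (axis i 1))"

lemma inner_row_normal: "row_normal V a \<bullet> x = row_functional V a x"
proof -
  have "row_functional V a x = row_functional V a (\<Sum>i\<in>UNIV. x $ i *\<^sub>R axis i 1)"
    by (simp add: basis_expansion scalar_mult_eq_scaleR[symmetric])
  also have "\<dots> = (\<Sum>i\<in>UNIV. x $ i * row_functional V a (axis i 1))"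
    by (simp add: linear_sum[OF linear_row_functional] linear_scale[OF linear_row_functional])
  finally show ?thesis by (simp add: row_normal_def inner_vec_def mult.commute)
qed

lemma row_normal_inner_row: "b \<noteq> a \<Longrightarrow> row_normal V a \<bullet> V b = 0"
  by (simp add: inner_row_normal row_functional_row)

text \<open>Both functionals vanish on the orthogonal complement of u. At u itself the determinant
  is nonzero, because only 0 is orthogonal to u and to all other rows.\<close>

lemma row_functional_proportional:
  fixes V :: "'d::finite \<Rightarrow> real^'d"
  assumes orth: "\<And>b. b \<noteq> a \<Longrightarrow> V b \<bullet> u = 0"
    and uniq: "\<And>w. (\<And>b. b \<noteq> a \<Longrightarrow> V b \<bullet> w = 0) \<Longrightarrow> w \<in> span {u}" and "u \<noteq> 0"
  shows "\<exists>c. c \<noteq> 0 \<and> (\<forall>x. row_functional V a x = c * (u \<bullet> x))"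
proof -
  have ker: "row_functional V a x = 0" if "u \<bullet> x = 0" for x
    unfolding row_functional_def det_rows_eq_0_iff
    by (rule exI[of _ u]) (use that orth \<open>u \<noteq> 0\<close> in \<open>auto simp: inner_commute\<close>)
  have nz: "row_functional V a u \<noteq> 0"
  proof
    assume "row_functional V a u = 0"
    then obtain w where w: "w \<noteq> 0" "\<And>b. (if b = a then u else V b) \<bullet> w = 0"
      unfolding row_functional_def det_rows_eq_0_iff by blast
    then have "w \<in> span {u}" by (intro uniq) (metis)
    then obtain k where "w = k *\<^sub>R u" by (auto simp: span_singleton)
    with w(2)[of a] w(1) show False by auto
  qed
  define c where "c = row_functional V a u / (u \<bullet> u)"
  have "row_functional V a x = c * (u \<bullet> x)" for x
  proof -
    let ?k = "(u \<bullet> x) / (u \<bullet> u)"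
    have "u \<bullet> (x - ?k *\<^sub>R u) = 0" using \<open>u \<noteq> 0\<close> by (simp add: inner_diff_right)
    from ker[OF this] have "row_functional V a x = ?k * row_functional V a u"
      by (simp add: linear_diff[OF linear_row_functional] linear_scale[OF linear_row_functional])
    then show ?thesis by (simp add: c_def)
  qed
  moreover have "c \<noteq> 0" using nz \<open>u \<noteq> 0\<close> by (simp add: c_def)
  ultimately show ?thesis by blast
qed

definition chirotope :: "(nat \<Rightarrow> real^'d::finite) \<Rightarrow> ('d \<Rightarrow> nat) \<Rightarrow> real" where
  "chirotope v J = sgn (det (\<chi> a. v (J a)))"

lemma orthogonal_to_spanning_eq_0:
  fixes u :: "'a::euclidean_space"
  assumes "span S = UNIV" "\<And>x. x \<in> S \<Longrightarrow> x \<bullet> u = 0"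
  shows "u = 0"
proof -
  have "orthogonal u u"
    by (rule orthogonal_to_span[of _ S]) (use assms in \<open>auto simp: orthogonal_def inner_commute\<close>)
  then show ?thesis by (simp add: orthogonal_def)
qed

text \<open>Among the vectors inducing a covector below the one of \<open>u\<close> and nonzero at \<open>i\<close>, one with the most
  zeros is orthogonal to a hyperplane spanned by generators: otherwise it could be moved, keeping
  its zeros, until another coordinate vanishes.\<close>

lemma maximal_zero_set:
  fixes v :: "nat \<Rightarrow> 'a::euclidean_space"
  assumes span: "span (v ` {..<n}) = UNIV" and i: "i < n" "v i \<bullet> u \<noteq> 0"
  obtains u' where "conforms (covector v n u') (covector v n u)" "v i \<bullet> u' \<noteq> 0"
    "\<forall>w. (\<forall>j<n. v j \<bullet> u' = 0 \<longrightarrow> v j \<bullet> w = 0) \<longrightarrow> w \<in> span {u'}"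
proof -
  define Z where "Z x = {j. j < n \<and> v j \<bullet> x = 0}" for x
  define P where "P x \<longleftrightarrow> conforms (covector v n x) (covector v n u) \<and> v i \<bullet> x \<noteq> 0" for x
  have fin: "finite (Z x)" for x by (simp add: Z_def)
  have "P u" using i by (auto simp: P_def conforms_def)
  moreover have "card (Z x) \<le> n" for x
    using card_mono[of "{..<n}" "Z x"] by (auto simp: Z_def)
  ultimately have "\<exists>x. P x \<and> (\<forall>y. P y \<longrightarrow> card (Z y) \<le> card (Z x))"
    by (intro ex_has_greatest_nat[of P u _ "Suc n"]) (auto simp: less_Suc_eq_le)
  then obtain u' where u': "P u'" "\<forall>x. P x \<longrightarrow> card (Z x) \<le> card (Z u')" by (elim exE conjE)
  have sg: "sgn (v j \<bullet> u') = sgn (v j \<bullet> u)" if "j < n" "v j \<bullet> u' \<noteq> 0" for j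
    using u'(1)[unfolded P_def conforms_def, THEN conjunct1, rule_format, of j] that
    by (simp add: covector_def sgn_zero_iff)
  show thesis
  proof
    show "conforms (covector v n u') (covector v n u)" "v i \<bullet> u' \<noteq> 0"
      using u'(1) by (auto simp: P_def)
    have "w \<in> span {u'}" if w: "\<And>j. j < n \<Longrightarrow> v j \<bullet> u' = 0 \<Longrightarrow> v j \<bullet> w = 0" for w
    proof (rule ccontr)
      assume notin: "w \<notin> span {u'}"
      have vi: "v i \<bullet> u' \<noteq> 0" using u'(1) by (simp add: P_def)
      \<comment> \<open>Subtracting a multiple of u' makes the direction vanish at v i, so that
        moving along it keeps the value there.\<close>
      define w1 where "w1 = w - ((v i \<bullet> w) / (v i \<bullet> u')) *\<^sub>R u'"
      have w1i: "v i \<bullet> w1 = 0" using vi by (simp add: w1_def inner_diff_right)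
      have w1Z: "v j \<bullet> w1 = 0" if "j < n" "v j \<bullet> u' = 0" for j
        using w[OF that] that by (simp add: w1_def inner_diff_right)
      have "w1 \<noteq> 0"
      proof
        assume "w1 = 0"
        then have "w = ((v i \<bullet> w) / (v i \<bullet> u')) *\<^sub>R u'" by (simp add: w1_def)
        then show False using notin by (metis span_base span_scale singletonI)
      qed
      then obtain j where j: "j < n" "v j \<bullet> w1 \<noteq> 0"
        using orthogonal_to_spanning_eq_0[OF span, of w1] by auto
      then have ju': "v j \<bullet> u' \<noteq> 0" using w1Z by blast
      \<comment> \<open>The sign is chosen such that coordinate j moves towards 0.\<close>
      define w2 where "w2 = (- sgn (v j \<bullet> u') * sgn (v j \<bullet> w1)) *\<^sub>R w1"
      have w2i: "v i \<bullet> w2 = 0" using w1i by (simp add: w2_def)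
      have w2Z: "v k \<bullet> w2 = 0" if "k < n" "v k \<bullet> u' = 0" for k
        using w1Z[OF that] by (simp add: w2_def)
      define T where "T = {k. k < n \<and> (v k \<bullet> u') * (v k \<bullet> w2) < 0}"
      have "(v j \<bullet> u') * (v j \<bullet> w2) < 0"
      proof -
        have "(v j \<bullet> u') * (v j \<bullet> w2) = - ((v j \<bullet> u') * sgn (v j \<bullet> u') * ((v j \<bullet> w1) * sgn (v j \<bullet> w1)))"
          by (simp add: w2_def)
        also have "\<dots> = - (\<bar>v j \<bullet> u'\<bar> * \<bar>v j \<bullet> w1\<bar>)"
          by (simp only: abs_sgn)
        finally show ?thesis using ju' j(2) by simp
      qed
      then have "j \<in> T" using j by (simp add: T_def)
      define r where "r k = - (v k \<bullet> u') / (v k \<bullet> w2)" for k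
      have "finite T" by (simp add: T_def)
      \<comment> \<open>The first time at which a coordinate reaches 0; up to then no sign has been
        reversed.\<close>
      define t where "t = Min (r ` T)"
      have "t \<in> r ` T" unfolding t_def using \<open>finite T\<close> \<open>j \<in> T\<close> by (intro Min_in) auto
      then obtain m where m: "m \<in> T" "t = r m" by blast
      have r_pos: "r k > 0" if "k \<in> T" for k
        using that unfolding T_def r_def by (auto simp: mult_less_0_iff divide_less_0_iff zero_less_divide_iff)
      have tle: "t \<le> r k" if "k \<in> T" for k
        unfolding t_def using \<open>finite T\<close> that by (intro Min_le) auto
      have "t > 0" using m r_pos by simp
      define x where "x = u' + t *\<^sub>R w2"
      have x_inner: "v k \<bullet> x = v k \<bullet> u' + t * (v k \<bullet> w2)" for k
        by (simp add: x_def inner_add_right)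
      have x_sgn: "v k \<bullet> x = 0 \<or> sgn (v k \<bullet> x) = sgn (v k \<bullet> u')" if k: "k < n" for k
      proof (cases "k \<in> T")
        case True
        have "t \<le> - (v k \<bullet> u') / (v k \<bullet> w2)" using tle[OF True] by (simp add: r_def)
        then show ?thesis using True \<open>t > 0\<close> unfolding x_inner T_def
          by (auto simp: mult_less_0_iff sgn_if field_simps)
      next
        case False
        then have "(v k \<bullet> u') * (v k \<bullet> w2) \<ge> 0" using k by (simp add: T_def)
        then consider "v k \<bullet> u' = 0" | "v k \<bullet> u' > 0" "v k \<bullet> w2 \<ge> 0" | "v k \<bullet> u' < 0" "v k \<bullet> w2 \<le> 0"
          unfolding zero_le_mult_iff by linarith
        then show ?thesis
        proof cases
          case 1
          then show ?thesis using w2Z[OF k] by (simp add: x_inner)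
        next
          case 2
          then have "t * (v k \<bullet> w2) \<ge> 0" using \<open>t > 0\<close> by simp
          with 2 show ?thesis by (simp add: x_inner)
        next
          case 3
          then have "t * (v k \<bullet> w2) \<le> 0" using \<open>t > 0\<close> by (simp add: mult_nonneg_nonpos)
          with 3 show ?thesis by (simp add: x_inner)
        qed
      qed
      have "P x"
        unfolding P_def conforms_def
      proof (intro conjI allI impI)
        show "v i \<bullet> x \<noteq> 0" using vi by (simp add: x_inner w2i)
        fix k assume "covector v n x k \<noteq> 0"
        then have k: "k < n" "v k \<bullet> x \<noteq> 0" by (auto simp: covector_def split: if_splits)
        then have "v k \<bullet> u' \<noteq> 0" using w2Z[OF k(1)] by (auto simp: x_inner)
        then show "covector v n u k = covector v n x k"
          using x_sgn[OF k(1)] sg[OF k(1)] k by (auto simp: covector_def)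
      qed
      moreover have "Z u' \<subset> Z x"
      proof
        show "Z u' \<subseteq> Z x" using w2Z by (auto simp: Z_def x_inner)
        have "m < n" "v m \<bullet> u' \<noteq> 0" "v m \<bullet> w2 \<noteq> 0" using m by (auto simp: T_def)
        then have "m \<in> Z x" "m \<notin> Z u'" using m(2) by (auto simp: Z_def x_inner r_def)
        then show "Z u' \<noteq> Z x" by blast
      qed
      ultimately show False using u'(2)[rule_format, of x] psubset_card_mono[OF fin, of "Z u'" x] by simp
    qed
    then show "\<forall>w. (\<forall>j<n. v j \<bullet> u' = 0 \<longrightarrow> v j \<bullet> w = 0) \<longrightarrow> w \<in> span {u'}" by blast
  qed
qed

text \<open>The functional of \<open>maximal_zero_set\<close> is determined up to scale by the
  generators in its kernel; d - 1 independent ones among them turn it into a minor with row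
  \<open>a\<close> free, that is, a cocircuit. Since row \<open>a\<close> is the free one, any index
  below n may serve as \<open>J a\<close>.\<close>

lemma cocircuit_below_covector:
  fixes v :: "nat \<Rightarrow> real^'d::finite"
  assumes span: "span (v ` {..<n}) = UNIV" and i: "i < n" "v i \<bullet> u \<noteq> 0"
  shows "\<exists>J \<epsilon>. (\<forall>b. J b < n) \<and>
    (\<forall>j<n. sgn (\<epsilon> * row_functional (v \<circ> J) a (v j)) \<in> {0, sgn (v j \<bullet> u)}) \<and>
    sgn (\<epsilon> * row_functional (v \<circ> J) a (v i)) = sgn (v i \<bullet> u)"
proof -
  obtain u' where conf: "conforms (covector v n u') (covector v n u)" and iu': "v i \<bullet> u' \<noteq> 0"
    and uniq': "\<forall>w. (\<forall>j<n. v j \<bullet> u' = 0 \<longrightarrow> v j \<bullet> w = 0) \<longrightarrow> w \<in> span {u'}"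
    by (rule maximal_zero_set[OF span i])
  have uniq: "w \<in> span {u'}" if "\<And>j. j < n \<Longrightarrow> v j \<bullet> u' = 0 \<Longrightarrow> v j \<bullet> w = 0" for w
    using uniq' that by blast
  have u'0: "u' \<noteq> 0" using iu' by auto
  define Z where "Z = {j. j < n \<and> v j \<bullet> u' = 0}"
  let ?H = "{x. u' \<bullet> x = 0}"
  obtain B where B: "B \<subseteq> v ` Z" "independent B" "v ` Z \<subseteq> span B"
    using maximal_independent_subset[of "v ` Z"] by auto
  have BH: "span B \<subseteq> ?H"
  proof (rule span_minimal)
    show "B \<subseteq> ?H" using B(1) by (auto simp: Z_def inner_commute)
  qed (rule subspace_hyperplane)
  \<comment> \<open>Otherwise a nonzero vector of the hyperplane would be orthogonal to all
    generators in it, hence a multiple of the normal u'.\<close>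
  have "span B = ?H"
  proof (rule ccontr)
    assume "span B \<noteq> ?H"
    then have "span B \<subset> span ?H" using BH by (simp add: subspace_hyperplane span_eq_iff[THEN iffD2] psubset_eq)
    from orthogonal_to_subspace_exists_gen[OF this]
    obtain x where x: "x \<noteq> 0" "x \<in> span ?H" "\<And>y. y \<in> span B \<Longrightarrow> orthogonal x y" by blast
    have "x \<in> span {u'}"
    proof (rule uniq)
      fix j assume "j < n" "v j \<bullet> u' = 0"
      then have "v j \<in> span B" using B(3) by (auto simp: Z_def)
      from x(3)[OF this] show "v j \<bullet> x = 0" by (simp add: orthogonal_def inner_commute)
    qed
    then obtain k where "x = k *\<^sub>R u'" by (auto simp: span_singleton)
    moreover have "u' \<bullet> x = 0" using x(2) by (simp add: subspace_hyperplane span_eq_iff[THEN iffD2])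
    ultimately show False using x(1) u'0 by auto
  qed
  then have "card B = card (UNIV - {a})"
    using dim_hyperplane[OF u'0] B(2) dim_span_eq_card_independent by fastforce
  then obtain \<beta> where \<beta>: "bij_betw \<beta> (UNIV - {a}) B"
    using finite_same_card_bij[of "UNIV - {a}" B] independent_imp_finite[OF B(2)] by auto
  define J where "J b = (if b = a then i else (SOME j. j \<in> Z \<and> v j = \<beta> b))" for b
  have J: "J b \<in> Z \<and> v (J b) = \<beta> b" if "b \<noteq> a" for b
  proof -
    have "\<beta> b \<in> v ` Z" using \<beta> that B(1) by (auto simp: bij_betw_def)
    then have "\<exists>j. j \<in> Z \<and> v j = \<beta> b" by auto
    from someI_ex[OF this] show ?thesis using that by (simp add: J_def)
  qed
  have "\<exists>c. c \<noteq> 0 \<and> (\<forall>x. row_functional (v \<circ> J) a x = c * (u' \<bullet> x))"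
  proof (rule row_functional_proportional)
    show "(v \<circ> J) b \<bullet> u' = 0" if "b \<noteq> a" for b using J[OF that] unfolding Z_def by auto
    show "w \<in> span {u'}" if w: "\<And>b. b \<noteq> a \<Longrightarrow> (v \<circ> J) b \<bullet> w = 0" for w
    proof (rule uniq)
      fix j assume "j < n" "v j \<bullet> u' = 0"
      then have "v j \<in> span B" using B(3) by (auto simp: Z_def)
      moreover have "orthogonal w y" if "y \<in> B" for y
      proof -
        have "y \<in> \<beta> ` (UNIV - {a})" using \<beta> that by (simp add: bij_betw_def)
        then obtain b where "b \<noteq> a" "y = \<beta> b" by blast
        then show ?thesis using w[of b] J[of b] by (simp add: orthogonal_def inner_commute)
      qed
      ultimately have "orthogonal w (v j)" using orthogonal_to_span by blast
      then show "v j \<bullet> w = 0" by (simp add: orthogonal_def inner_commute)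
    qed
  qed (rule u'0)
  then obtain c where c: "c \<noteq> 0" "\<And>x. row_functional (v \<circ> J) a x = c * (u' \<bullet> x)" by blast
  have sg: "sgn (c * row_functional (v \<circ> J) a x) = sgn (x \<bullet> u')" for x
    using c(1) by (simp add: c(2) sgn_mult inner_commute)
  have "sgn (v j \<bullet> u') \<in> {0, sgn (v j \<bullet> u)}" if "j < n" for j
    using conf[unfolded conforms_def, rule_format, of j] that
    by (cases "sgn (v j \<bullet> u') = 0") (simp_all add: covector_def)
  moreover have "sgn (v i \<bullet> u') = sgn (v i \<bullet> u)"
    using conf[unfolded conforms_def, rule_format, of i] i(1) iu' by (auto simp: covector_def sgn_zero_iff)
  moreover have "J b < n" for b using J[of b] i(1) by (cases "b = a") (auto simp: J_def Z_def)
  ultimately show ?thesis using sg by (intro exI[of _ J] exI[of _ c]) auto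
qed

lemma sgn_sum_conforming:
  fixes x :: "'i \<Rightarrow> real"
  assumes "finite S" "\<And>i. i \<in> S \<Longrightarrow> sgn (x i) \<in> {0, \<sigma>}"
  shows "sgn (\<Sum>i\<in>S. x i) = (if \<exists>i\<in>S. sgn (x i) \<noteq> 0 then \<sigma> else 0)"
proof (cases "\<exists>i\<in>S. sgn (x i) \<noteq> 0")
  case True
  then obtain k where k: "k \<in> S" "sgn (x k) \<noteq> 0" by blast
  then have \<sigma>: "\<sigma> = sgn (x k)" using assms(2) by auto
  show ?thesis
  proof (cases "x k > 0")
    case pos: True
    have "x i \<ge> 0" if "i \<in> S" for i
      using assms(2)[OF that] pos \<sigma> by (auto simp: sgn_if split: if_splits)
    then have "(\<Sum>i\<in>S. x i) > 0" using assms(1) k pos by (intro sum_pos2[of S k]) auto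
    then show ?thesis using True \<sigma> pos by simp
  next
    case False
    then have neg: "x k < 0" using k by (auto simp: sgn_if split: if_splits)
    have "x i \<le> 0" if "i \<in> S" for i
      using assms(2)[OF that] neg \<sigma> by (auto simp: sgn_if split: if_splits)
    then have "(\<Sum>i\<in>S. - x i) > 0" using assms(1) k neg by (intro sum_pos2[of S k]) auto
    then show ?thesis using True \<sigma> neg by (simp add: sum_negf)
  qed
next
  case False
  then show ?thesis by (auto simp: sgn_zero_iff)
qed

text \<open>Every covector is a conformal sum of cocircuits below it, one for each nonzero
  coordinate. Their signs on the generators are chirotope values up to a factor, so the same
  combination of minors formed from w has the same covector.\<close>

lemma chirotope_determines_covectors_subset:
  fixes v w :: "nat \<Rightarrow> real^'d::finite"
  assumes span: "span (v ` {..<n}) = UNIV"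
    and chi: "\<And>J. (\<And>a. J a < n) \<Longrightarrow> chirotope v J = chirotope w J"
  shows "range (covector v n) \<subseteq> range (covector w n)"
proof
  fix \<sigma> assume "\<sigma> \<in> range (covector v n)"
  then obtain u where u: "\<sigma> = covector v n u" by blast
  fix a :: 'd
  let ?S = "{i. i < n \<and> v i \<bullet> u \<noteq> 0}"
  have "\<forall>i\<in>?S. \<exists>J \<epsilon>. (\<forall>b. J b < n) \<and>
    (\<forall>j<n. sgn (\<epsilon> * row_functional (v \<circ> J) a (v j)) \<in> {0, sgn (v j \<bullet> u)}) \<and>
    sgn (\<epsilon> * row_functional (v \<circ> J) a (v i)) = sgn (v i \<bullet> u)"
    using cocircuit_below_covector[OF span] by simp
  from bchoice[OF this] obtain J where "\<forall>i\<in>?S. \<exists>\<epsilon>. (\<forall>b. J i b < n) \<and>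
    (\<forall>j<n. sgn (\<epsilon> * row_functional (v \<circ> J i) a (v j)) \<in> {0, sgn (v j \<bullet> u)}) \<and>
    sgn (\<epsilon> * row_functional (v \<circ> J i) a (v i)) = sgn (v i \<bullet> u)" ..
  from bchoice[OF this] obtain \<epsilon> where J: "\<forall>i\<in>?S. (\<forall>b. J i b < n) \<and>
    (\<forall>j<n. sgn (\<epsilon> i * row_functional (v \<circ> J i) a (v j)) \<in> {0, sgn (v j \<bullet> u)}) \<and>
    sgn (\<epsilon> i * row_functional (v \<circ> J i) a (v i)) = sgn (v i \<bullet> u)" ..
  have tr: "sgn (row_functional (w \<circ> J) a (w j)) = sgn (row_functional (v \<circ> J) a (v j))"
    if "\<And>b. J b < n" "j < n" for J j
  proof -
    have eq: "row_functional (x \<circ> J) a (x j) = det (\<chi> b. x ((J(a := j)) b))" for x :: "nat \<Rightarrow> real^'d"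
      unfolding row_functional_def by (intro arg_cong[of _ _ det]) (simp add: vec_eq_iff)
    show ?thesis using chi[of "J(a := j)"] that by (simp add: eq chirotope_def)
  qed
  define u' where "u' = (\<Sum>i\<in>?S. \<epsilon> i *\<^sub>R row_normal (w \<circ> J i) a)"
  have "sgn (w j \<bullet> u') = sgn (v j \<bullet> u)" if j: "j < n" for j
  proof -
    define x where "x i = \<epsilon> i * row_functional (w \<circ> J i) a (w j)" for i
    have sx: "sgn (x i) = sgn (\<epsilon> i * row_functional (v \<circ> J i) a (v j))" if "i \<in> ?S" for i
      unfolding x_def using tr[OF _ j, of "J i"] J[rule_format, OF that] by (simp add: sgn_mult)
    have "w j \<bullet> u' = (\<Sum>i\<in>?S. x i)"
      by (simp add: u'_def x_def inner_sum_right inner_row_normal[symmetric] inner_commute)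
    also have "sgn \<dots> = (if \<exists>i\<in>?S. sgn (x i) \<noteq> 0 then sgn (v j \<bullet> u) else 0)"
      by (rule sgn_sum_conforming) (use J j sx in auto)
    also have "\<dots> = sgn (v j \<bullet> u)"
    proof (cases "v j \<bullet> u = 0")
      case False
      then have jS: "j \<in> ?S" using j by simp
      have "sgn (x j) \<noteq> 0" unfolding sx[OF jS] using J[rule_format, OF jS] False by (simp add: sgn_zero_iff)
      with jS show ?thesis by auto
    qed auto
    finally show ?thesis .
  qed
  then have "\<sigma> = covector w n u'" by (auto simp: u covector_def)
  then show "\<sigma> \<in> range (covector w n)" by blast
qed

lemma chirotope_determines_covectors:
  fixes v w :: "nat \<Rightarrow> real^'d::finite"
  assumes "span (v ` {..<n}) = UNIV" "span (w ` {..<n}) = UNIV"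
    and "\<And>J. (\<And>a. J a < n) \<Longrightarrow> chirotope v J = chirotope w J"
  shows "range (covector v n) = range (covector w n)"
  using assms by (intro equalityI chirotope_determines_covectors_subset) auto

section \<open>The upper bound\<close>

lemma bipoly_det:
  assumes "\<And>a b. bipoly N s 1 0 (\<lambda>x. A x $ a $ b)"
  shows "bipoly N s CARD('d) 0 (\<lambda>x. det (A x :: real^'d^'d::finite))"
proof -
  have "bipoly N s (0 + (\<Sum>i\<in>(UNIV::'d set). 1)) (0 + (\<Sum>i\<in>(UNIV::'d set). 0))
      (\<lambda>x. of_int (sign p) * (\<Prod>i\<in>UNIV. A x $ i $ p i))" for p :: "'d \<Rightarrow> 'd"
    by (rule bipoly.mult[OF bipoly.const bipoly_prod[OF assms]])
  then have "bipoly N s CARD('d) 0 (\<lambda>x. \<Sum>p | p permutes UNIV. of_int (sign p) * (\<Prod>i\<in>UNIV. A x $ i $ p i))"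
    by (intro bipoly_sum) simp
  then show ?thesis by (simp add: det_def)
qed

definition index_tuples :: "nat \<Rightarrow> ('d::finite \<Rightarrow> nat) set" where
  "index_tuples n = {J. \<forall>a. J a < n}"

lemma finite_index_tuples: "finite (index_tuples n :: ('d::finite \<Rightarrow> nat) set)"
  and card_index_tuples: "card (index_tuples n :: ('d::finite \<Rightarrow> nat) set) = n ^ CARD('d)"
proof -
  have "index_tuples n = PiE (UNIV::'d set) (\<lambda>_. {..<n})" by (auto simp: index_tuples_def PiE_def)
  then show "finite (index_tuples n :: ('d \<Rightarrow> nat) set)"
    "card (index_tuples n :: ('d \<Rightarrow> nat) set) = n ^ CARD('d)"
    by (simp_all add: finite_PiE card_PiE)
qed

definition chirotope_patterns :: "'d::finite itself \<Rightarrow> nat \<Rightarrow> (('d \<Rightarrow> nat) \<Rightarrow> real) set" where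
  "chirotope_patterns _ n = {restrict (chirotope v) (index_tuples n) | v :: nat \<Rightarrow> real^'d. \<forall>i<n. v i \<noteq> 0}"

text \<open>The first factor counts the charts: which entry of each vector is normalised, and with
  which sign. The rest is \<open>sign_patterns_bound\<close> for n ^ d determinants of degree d in n
  (d - 1) variables.\<close>

definition chirotope_bound :: "nat \<Rightarrow> nat \<Rightarrow> nat" where
  "chirotope_bound d n = (2 * d) ^ n *
     (d ^ (n * (d - 1)) * ((n * (d - 1) + Suc (2 * n ^ d)) choose (n * (d - 1))))"

text \<open>Rescaling a vector by a positive factor keeps the chirotope. Every vector is therefore
  normalised to have an entry \<open>\<plusminus>1\<close>, which leaves \<open>d - 1\<close> instead of \<open>d\<close> variables per vector.\<close>

lemma chirotope_patterns_bound:
  assumes "CARD('d::finite) \<ge> 2"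
  shows "finite (chirotope_patterns TYPE('d) n)"
    and "card (chirotope_patterns TYPE('d) n) \<le> chirotope_bound CARD('d) n"
proof -
  let ?d = "CARD('d)"
  define N where "N = n * (?d - 1)"
  have "\<forall>k::'d. \<exists>e. bij_betw e (UNIV - {k}) {..<?d - 1}"
    by (intro allI finite_same_card_bij) auto
  from choice[OF this] obtain e where e: "\<And>k::'d. bij_betw (e k) (UNIV - {k}) {..<?d - 1}" by blast
  \<comment> \<open>Block i of d - 1 variables fills the entries of vector i except the normalised
    one.\<close>
  define V :: "(nat \<Rightarrow> 'd \<times> real) \<Rightarrow> (nat \<Rightarrow> real) \<Rightarrow> nat \<Rightarrow> real^'d" where
    "V \<phi> x i = (\<chi> b. if b = fst (\<phi> i) then snd (\<phi> i) else x (i * (?d - 1) + e (fst (\<phi> i)) b))" for \<phi> x i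
  define charts where "charts = PiE {..<n} (\<lambda>_. (UNIV :: 'd set) \<times> {1, -1 :: real})"
  define pats where "pats \<phi> = range (\<lambda>x. restrict (chirotope (V \<phi> x)) (index_tuples n))" for \<phi>
  have fin_charts: "finite charts" by (simp add: charts_def finite_PiE)
  have card_charts: "card charts = (2 * ?d) ^ n"
    by (simp add: charts_def card_PiE card_cartesian_product mult.commute flip: mult_2)
  have pats_eq: "pats \<phi> = range (\<lambda>x. restrict (\<lambda>J. sgn (det (\<chi> a. V \<phi> x (J a)))) (index_tuples n))" for \<phi>
    by (simp add: pats_def chirotope_def[abs_def])
  have poly: "bipoly N 0 ?d 0 (\<lambda>x. det (\<chi> a. V \<phi> x (J a)))" if J: "J \<in> index_tuples n" for \<phi> J
  proof (rule bipoly_det)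
    fix a b
    show "bipoly N 0 1 0 (\<lambda>x. (\<chi> a. V \<phi> x (J a)) $ a $ b)"
    proof (cases "b = fst (\<phi> (J a))")
      case False
      have "e (fst (\<phi> (J a))) b < ?d - 1" using e[of "fst (\<phi> (J a))"] False by (auto simp: bij_betw_def)
      moreover have "Suc (J a) * (?d - 1) \<le> N" using J unfolding N_def index_tuples_def
        by (intro mult_right_mono) (auto simp: Suc_le_eq)
      ultimately have "J a * (?d - 1) + e (fst (\<phi> (J a))) b < N" by simp
      then show ?thesis using False by (simp add: V_def bipoly.xvar)
    qed (simp add: V_def bipoly.const)
  qed
  have fin_pats: "finite (pats \<phi>)" for \<phi>
    unfolding pats_eq by (rule finite_sgn_patterns[OF finite_index_tuples])
  have card_pats: "card (pats \<phi>) \<le> ?d ^ N * ((N + Suc (2 * n ^ ?d)) choose N)" for \<phi>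
    unfolding pats_eq
    using sign_patterns_bound[of "index_tuples n" N ?d "\<lambda>J x. det (\<chi> a. V \<phi> x (J a))", OF finite_index_tuples poly assms]
    by (simp only: card_index_tuples)
  have sub: "chirotope_patterns TYPE('d) n \<subseteq> (\<Union>\<phi>\<in>charts. pats \<phi>)"
  proof
    fix p assume "p \<in> chirotope_patterns TYPE('d) n"
    then obtain v :: "nat \<Rightarrow> real^'d" where v: "p = restrict (chirotope v) (index_tuples n)" "\<And>i. i < n \<Longrightarrow> v i \<noteq> 0"
      unfolding chirotope_patterns_def by blast
    have "\<forall>i. \<exists>k. i < n \<longrightarrow> v i $ k \<noteq> 0" using v(2) by (metis vec_eq_iff zero_index)
    from choice[OF this] obtain \<kappa> where \<kappa>: "\<And>i. i < n \<Longrightarrow> v i $ \<kappa> i \<noteq> 0" by blast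
    define \<phi> where "\<phi> = restrict (\<lambda>i. (\<kappa> i, sgn (v i $ \<kappa> i))) {..<n}"
    have "\<phi> \<in> charts" using \<kappa> by (auto simp: charts_def \<phi>_def sgn_if)
    define c where "c i = \<bar>v i $ \<kappa> i\<bar>" for i
    have c: "c i > 0" if "i < n" for i using \<kappa>[OF that] by (simp add: c_def)
    define x where "x m = (let i = m div (?d - 1) in
       v i $ inv_into (UNIV - {\<kappa> i}) (e (\<kappa> i)) (m mod (?d - 1)) / c i)" for m
    have Vx: "v i = c i *s V \<phi> x i" if i: "i < n" for i
    proof -
      have "v i $ b = c i * V \<phi> x i $ b" for b
      proof (cases "b = \<kappa> i")
        case True
        then show ?thesis using i by (simp add: V_def \<phi>_def c_def mult_sgn_abs mult.commute[of "\<bar>_\<bar>"])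
      next
        case False
        have lt: "e (\<kappa> i) b < ?d - 1" using e[of "\<kappa> i"] False by (auto simp: bij_betw_def)
        have "inv_into (UNIV - {\<kappa> i}) (e (\<kappa> i)) (e (\<kappa> i) b) = b"
          using bij_betw_inv_into_left[OF e] False by simp
        then have "x (i * (?d - 1) + e (\<kappa> i) b) = v i $ b / c i"
          using lt by (simp add: x_def)
        then show ?thesis using False i c[OF i] by (simp add: V_def \<phi>_def)
      qed
      then show ?thesis by (simp add: vec_eq_iff)
    qed
    have "chirotope v J = chirotope (V \<phi> x) J" if J: "J \<in> index_tuples n" for J
    proof -
      have Jn: "J a < n" for a using J by (simp add: index_tuples_def)
      have "(\<chi> a. v (J a)) = (\<chi> a. c (J a) *s V \<phi> x (J a))"
        using Vx[OF Jn] by (simp add: vec_eq_iff)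
      then have "det (\<chi> a. v (J a)) = (\<Prod>a\<in>UNIV. c (J a)) * det (\<chi> a. V \<phi> x (J a))"
        by (simp add: det_rows_mul)
      moreover have "(\<Prod>a\<in>UNIV. c (J a)) > 0" using c Jn by (intro prod_pos) auto
      ultimately show ?thesis by (simp add: chirotope_def sgn_mult)
    qed
    then have "p \<in> pats \<phi>" unfolding pats_def v(1) by (intro image_eqI[of _ _ x]) (auto simp: restrict_def)
    with \<open>\<phi> \<in> charts\<close> show "p \<in> (\<Union>\<phi>\<in>charts. pats \<phi>)" by blast
  qed
  have fin_un: "finite (\<Union>\<phi>\<in>charts. pats \<phi>)" using fin_charts fin_pats by blast
  show "finite (chirotope_patterns TYPE('d) n)" by (rule finite_subset[OF sub fin_un])
  have "card (chirotope_patterns TYPE('d) n) \<le> card (\<Union>\<phi>\<in>charts. pats \<phi>)"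
    by (rule card_mono[OF fin_un sub])
  also have "\<dots> \<le> (\<Sum>\<phi>\<in>charts. card (pats \<phi>))" by (rule card_UN_le[OF fin_charts])
  also have "\<dots> \<le> (\<Sum>\<phi>\<in>charts. ?d ^ N * ((N + Suc (2 * n ^ ?d)) choose N))"
    by (rule sum_mono[OF card_pats])
  finally show "card (chirotope_patterns TYPE('d) n) \<le> chirotope_bound CARD('d) n"
    by (simp add: card_charts chirotope_bound_def N_def)
qed

definition comb_type_rel :: "'d::finite itself \<Rightarrow> nat \<Rightarrow> ((real^'d) set \<times> (real^'d) set) set" where
  "comb_type_rel D n = {(P, Q). P \<in> zonotopes_dim D n \<and> Q \<in> zonotopes_dim D n \<and> same_comb_type P Q}"

lemma zcount_eq: "zcount D n = card (zonotopes_dim D n // comb_type_rel D n)"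
  by (simp add: zcount_def comb_type_rel_def)

lemma comb_type_class_eq_iff:
  assumes "P \<in> zonotopes_dim D n" "Q \<in> zonotopes_dim D n"
  shows "comb_type_rel D n `` {P} = comb_type_rel D n `` {Q} \<longleftrightarrow> same_comb_type P Q"
proof
  assume "comb_type_rel D n `` {P} = comb_type_rel D n `` {Q}"
  moreover have "Q \<in> comb_type_rel D n `` {Q}"
    using assms by (simp add: comb_type_rel_def same_comb_type_refl)
  ultimately have "Q \<in> comb_type_rel D n `` {P}" by simp
  then show "same_comb_type P Q" by (simp add: comb_type_rel_def)
next
  assume "same_comb_type P Q"
  then show "comb_type_rel D n `` {P} = comb_type_rel D n `` {Q}"
    using assms by (auto simp: comb_type_rel_def intro: same_comb_type_trans same_comb_type_sym)
qed

text \<open>A representative of each class is described by its chirotope. Equal chirotopes give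
  equal covectors and thus isomorphic face lattices, so the classes inject into the chirotope
  patterns.\<close>

lemma zcount_upper_bound:
  assumes "CARD('d::finite) \<ge> 2"
  shows "finite (zonotopes_dim TYPE('d) n // comb_type_rel TYPE('d) n)"
    and "zcount TYPE('d) n \<le> chirotope_bound CARD('d) n"
proof -
  let ?Z = "zonotopes_dim TYPE('d) n" and ?R = "comb_type_rel TYPE('d) n"
  have "\<forall>Z\<in>?Z. \<exists>v :: nat \<Rightarrow> real^'d. same_comb_type Z (zon v n) \<and> span (v ` {..<n}) = UNIV \<and> (\<forall>i<n. v i \<noteq> 0)"
  proof
    fix Z :: "(real^'d) set" assume "Z \<in> ?Z"
    then obtain v :: "nat \<Rightarrow> real^'d" where "same_comb_type Z (zon v n)" "span (v ` {..<n}) = UNIV" "\<forall>i<n. v i \<noteq> 0"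
      by (rule zonotopes_dim_obtain)
    then show "\<exists>v :: nat \<Rightarrow> real^'d. same_comb_type Z (zon v n) \<and> span (v ` {..<n}) = UNIV \<and> (\<forall>i<n. v i \<noteq> 0)"
      by blast
  qed
  from bchoice[OF this] obtain v :: "(real^'d) set \<Rightarrow> nat \<Rightarrow> real^'d" where
    v: "\<forall>Z\<in>?Z. same_comb_type Z (zon (v Z) n) \<and> span (v Z ` {..<n}) = UNIV \<and> (\<forall>i<n. v Z i \<noteq> 0)" ..
  define rep where "rep C = (SOME Z. Z \<in> ?Z \<and> C = ?R `` {Z})" for C
  have rep: "rep C \<in> ?Z" "?R `` {rep C} = C" if "C \<in> ?Z // ?R" for C
  proof -
    have "\<exists>Z. Z \<in> ?Z \<and> C = ?R `` {Z}" using that by (auto simp: quotient_def)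
    from someI_ex[OF this] show "rep C \<in> ?Z" "?R `` {rep C} = C" by (auto simp: rep_def)
  qed
  define q where "q C = restrict (chirotope (v (rep C))) (index_tuples n)" for C
  have inj: "inj_on q (?Z // ?R)"
  proof (rule inj_onI)
    fix C C' assume C: "C \<in> ?Z // ?R" "C' \<in> ?Z // ?R" and eq: "q C = q C'"
    let ?P = "rep C" and ?Q = "rep C'"
    have P: "same_comb_type ?P (zon (v ?P) n)" "span (v ?P ` {..<n}) = UNIV"
      and Q: "same_comb_type ?Q (zon (v ?Q) n)" "span (v ?Q ` {..<n}) = UNIV"
      using v rep(1)[OF C(1)] rep(1)[OF C(2)] by blast+
    have "range (covector (v ?P) n) = range (covector (v ?Q) n)"
    proof (rule chirotope_determines_covectors[OF P(2) Q(2)])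
      show "chirotope (v ?P) J = chirotope (v ?Q) J" if "\<And>a. J a < n" for J
        using fun_cong[OF eq, of J] that by (simp add: q_def index_tuples_def)
    qed
    then have "same_comb_type (zon (v ?P) n) (zon (v ?Q) n)" by (rule same_comb_type_zon)
    then have "same_comb_type ?P ?Q"
      by (rule same_comb_type_trans[OF same_comb_type_trans[OF P(1)] same_comb_type_sym[OF Q(1)]])
    then show "C = C'"
      using comb_type_class_eq_iff[OF rep(1)[OF C(1)] rep(1)[OF C(2)]] rep(2)[OF C(1)] rep(2)[OF C(2)] by simp
  qed
  have sub: "q ` (?Z // ?R) \<subseteq> chirotope_patterns TYPE('d) n"
    using v rep(1) by (auto simp: q_def chirotope_patterns_def)
  note fin = chirotope_patterns_bound(1)[OF assms, of n]
  show "finite (?Z // ?R)" by (rule inj_on_finite[OF inj sub fin])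
  show "zcount TYPE('d) n \<le> chirotope_bound CARD('d) n"
    unfolding zcount_eq using card_inj_on_le[OF inj sub fin] chirotope_patterns_bound(2)[OF assms, of n] by linarith
qed

section \<open>Reconstructing the topes from the face lattice\<close>

definition sign_vectors :: "nat \<Rightarrow> (nat \<Rightarrow> real) set" where
  "sign_vectors n = {T. (\<forall>i<n. T i = 1 \<or> T i = -1) \<and> (\<forall>i\<ge>n. T i = 0)}"

definition sign_dist :: "nat \<Rightarrow> (nat \<Rightarrow> real) \<Rightarrow> (nat \<Rightarrow> real) \<Rightarrow> nat" where
  "sign_dist n S T = card {i. i < n \<and> S i \<noteq> T i}"

definition flip :: "nat \<Rightarrow> (nat \<Rightarrow> real) \<Rightarrow> nat \<Rightarrow> real" where
  "flip i T = T(i := - T i)"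

lemma sign_dist_commute: "sign_dist n S T = sign_dist n T S"
  unfolding sign_dist_def by metis

lemma sign_dist_triangle: "sign_dist n S U \<le> sign_dist n S T + sign_dist n T U"
proof -
  have "card {i. i < n \<and> S i \<noteq> U i} \<le> card ({i. i < n \<and> S i \<noteq> T i} \<union> {i. i < n \<and> T i \<noteq> U i})"
    by (rule card_mono) auto
  also have "\<dots> \<le> card {i. i < n \<and> S i \<noteq> T i} + card {i. i < n \<and> T i \<noteq> U i}" by (rule card_Un_le)
  finally show ?thesis by (simp add: sign_dist_def)
qed

lemma sign_dist_eq_0_iff:
  assumes "S \<in> sign_vectors n" "T \<in> sign_vectors n"
  shows "sign_dist n S T = 0 \<longleftrightarrow> S = T"
proof
  assume "sign_dist n S T = 0"
  then have "S i = T i" if "i < n" for i using that by (auto simp: sign_dist_def)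
  then show "S = T" using assms by (auto simp: sign_vectors_def fun_eq_iff) (metis not_le)
qed (simp add: sign_dist_def)

lemma sign_dist_flip:
  assumes "S \<in> sign_vectors n" "T \<in> sign_vectors n" "i < n"
  shows "S i \<noteq> T i \<Longrightarrow> Suc (sign_dist n S (flip i T)) = sign_dist n S T"
    and "S i = T i \<Longrightarrow> sign_dist n S (flip i T) = Suc (sign_dist n S T)"
proof -
  have vals: "S i = 1 \<or> S i = -1" "T i = 1 \<or> T i = -1" using assms by (auto simp: sign_vectors_def)
  { assume "S i \<noteq> T i"
    then have "{j. j < n \<and> S j \<noteq> T j} = insert i {j. j < n \<and> S j \<noteq> flip i T j}"
      "i \<notin> {j. j < n \<and> S j \<noteq> flip i T j}"
      using vals assms(3) by (auto simp: flip_def)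
    then show "Suc (sign_dist n S (flip i T)) = sign_dist n S T" by (simp add: sign_dist_def) }
  { assume "S i = T i"
    then have "{j. j < n \<and> S j \<noteq> flip i T j} = insert i {j. j < n \<and> S j \<noteq> T j}"
      "i \<notin> {j. j < n \<and> S j \<noteq> T j}"
      using vals assms(3) by (auto simp: flip_def)
    then show "sign_dist n S (flip i T) = Suc (sign_dist n S T)" by (simp add: sign_dist_def) }
qed

lemma sign_dist_flip_self:
  assumes "T \<in> sign_vectors n" "i < n"
  shows "sign_dist n T (flip i T) = 1"
  using sign_dist_flip(2)[OF assms(1) assms(1) assms(2)] by (simp add: sign_dist_def)

lemma sign_dist_1_flip:
  assumes "S \<in> sign_vectors n" "T \<in> sign_vectors n" "sign_dist n S T = 1"
  shows "\<exists>i<n. T = flip i S"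
proof -
  obtain i where i: "{i. i < n \<and> S i \<noteq> T i} = {i}"
    using assms(3) by (auto simp: sign_dist_def card_1_singleton_iff)
  then have "i < n" "S i \<noteq> T i" by auto
  then have "T i = - S i" using assms(1,2) unfolding sign_vectors_def by fastforce
  moreover have "S j = T j" if "j \<noteq> i" for j
    using assms i that by (cases "j < n") (auto simp: sign_vectors_def)
  ultimately have "T = flip i S" by (auto simp: flip_def fun_eq_iff)
  with \<open>i < n\<close> show ?thesis by blast
qed

text \<open>By \<open>gated\<close>, any two members are joined inside \<open>A\<close> by a path
  whose length is their Hamming distance, and \<phi> maps it to a path of the same length.\<close>

lemma adjacency_map_contracts:
  assumes A: "A \<subseteq> sign_vectors n"
    and gated: "\<And>S T. S \<in> A \<Longrightarrow> T \<in> A \<Longrightarrow> S \<noteq> T \<Longrightarrow> \<exists>i<n. S i \<noteq> T i \<and> flip i S \<in> A"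
    and adj: "\<And>S T. S \<in> A \<Longrightarrow> T \<in> A \<Longrightarrow> sign_dist n S T = 1 \<Longrightarrow> sign_dist n (\<phi> S) (\<phi> T) = 1"
    and "S \<in> A" "T \<in> A"
  shows "sign_dist n (\<phi> S) (\<phi> T) \<le> sign_dist n S T"
  using \<open>S \<in> A\<close>
proof (induction "sign_dist n S T" arbitrary: S)
  case 0
  then have "S = T" using sign_dist_eq_0_iff[of S n T] A \<open>T \<in> A\<close> by auto
  then show ?case by (simp add: sign_dist_def)
next
  case (Suc k)
  then have "S \<noteq> T" by (auto simp: sign_dist_def)
  then obtain i where i: "i < n" "S i \<noteq> T i" "flip i S \<in> A" using gated[OF Suc.prems \<open>T \<in> A\<close>] by auto
  have "Suc (sign_dist n T (flip i S)) = sign_dist n T S"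
    using sign_dist_flip(1)[of T n S i] i A Suc.prems \<open>T \<in> A\<close> by auto
  then have k: "k = sign_dist n (flip i S) T" using Suc.hyps(2) by (simp add: sign_dist_commute)
  have "sign_dist n (\<phi> S) (\<phi> T) \<le> sign_dist n (\<phi> S) (\<phi> (flip i S)) + sign_dist n (\<phi> (flip i S)) (\<phi> T)"
    by (rule sign_dist_triangle)
  also have "sign_dist n (\<phi> S) (\<phi> (flip i S)) = 1"
    using adj[OF Suc.prems i(3)] sign_dist_flip_self[of S n i] i(1) A Suc.prems by auto
  also have "sign_dist n (\<phi> (flip i S)) (\<phi> T) \<le> k"
    using Suc.hyps(1)[OF k i(3)] k by simp
  finally show ?case using Suc.hyps(2) by simp
qed

definition signed_permute :: "nat \<Rightarrow> (nat \<Rightarrow> nat) \<Rightarrow> (nat \<Rightarrow> real) \<Rightarrow> (nat \<Rightarrow> real) \<Rightarrow> nat \<Rightarrow> real" where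
  "signed_permute n \<rho> s T = (\<lambda>j. if j < n then s j * T (\<rho> j) else 0)"

text \<open>An isometric embedding into the cube is determined by the images of pairs of neighbours,
  one pair in each of the \<open>n\<close> directions.\<close>

lemma adjacency_bijection_signed_permute:
  assumes A: "A \<subseteq> sign_vectors n" and B: "B \<subseteq> sign_vectors n" and \<phi>: "bij_betw \<phi> A B"
    and gatedA: "\<And>S T. S \<in> A \<Longrightarrow> T \<in> A \<Longrightarrow> S \<noteq> T \<Longrightarrow> \<exists>i<n. S i \<noteq> T i \<and> flip i S \<in> A"
    and gatedB: "\<And>S T. S \<in> B \<Longrightarrow> T \<in> B \<Longrightarrow> S \<noteq> T \<Longrightarrow> \<exists>i<n. S i \<noteq> T i \<and> flip i S \<in> B"
    and adj: "\<And>S T. S \<in> A \<Longrightarrow> T \<in> A \<Longrightarrow> sign_dist n S T = 1 \<longleftrightarrow> sign_dist n (\<phi> S) (\<phi> T) = 1"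
    and walls: "\<And>i. i < n \<Longrightarrow> \<exists>T\<in>A. flip i T \<in> A"
  shows "\<exists>\<rho> s. \<rho> \<in> PiE {..<n} (\<lambda>_. {..<n}) \<and> s \<in> PiE {..<n} (\<lambda>_. {1, -1}) \<and> B = signed_permute n \<rho> s ` A"
proof -
  let ?\<psi> = "inv_into A \<phi>"
  have \<psi>: "bij_betw ?\<psi> B A" by (rule bij_betw_inv_into[OF \<phi>])
  have \<phi>\<psi>: "\<phi> (?\<psi> T) = T" if "T \<in> B" for T by (rule bij_betw_inv_into_right[OF \<phi> that])
  have \<psi>\<phi>: "?\<psi> (\<phi> T) = T" if "T \<in> A" for T by (rule bij_betw_inv_into_left[OF \<phi> that])
  have \<phi>B: "\<phi> T \<in> B" if "T \<in> A" for T using bij_betwE[OF \<phi>] that by blast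
  have \<psi>A: "?\<psi> T \<in> A" if "T \<in> B" for T using bij_betwE[OF \<psi>] that by blast
  have iso: "sign_dist n (\<phi> S) (\<phi> T) = sign_dist n S T" if "S \<in> A" "T \<in> A" for S T
  proof (rule antisym)
    show "sign_dist n (\<phi> S) (\<phi> T) \<le> sign_dist n S T"
      by (rule adjacency_map_contracts[OF A gatedA]) (use adj that in auto)
    have "sign_dist n (?\<psi> (\<phi> S)) (?\<psi> (\<phi> T)) \<le> sign_dist n (\<phi> S) (\<phi> T)"
    proof (rule adjacency_map_contracts[OF B gatedB])
      show "sign_dist n (?\<psi> U) (?\<psi> V) = 1" if "U \<in> B" "V \<in> B" "sign_dist n U V = 1" for U V
        using adj[OF \<psi>A[OF that(1)] \<psi>A[OF that(2)]] that by (simp add: \<phi>\<psi>)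
    qed (use \<phi>B that in auto)
    then show "sign_dist n S T \<le> sign_dist n (\<phi> S) (\<phi> T)" using that by (simp add: \<psi>\<phi>)
  qed
  \<comment> \<open>One edge of A in each direction i; its image is an edge in some direction, to be
    called \<pi> i.\<close>
  obtain E where E: "\<And>i. i < n \<Longrightarrow> E i \<in> A \<and> flip i (E i) \<in> A" using walls by metis
  have "\<exists>q<n. \<phi> (flip i (E i)) = flip q (\<phi> (E i))" if i: "i < n" for i
  proof (rule sign_dist_1_flip)
    show "\<phi> (E i) \<in> sign_vectors n" "\<phi> (flip i (E i)) \<in> sign_vectors n" using E[OF i] \<phi>B B by blast+
    show "sign_dist n (\<phi> (E i)) (\<phi> (flip i (E i))) = 1"
      using iso[of "E i" "flip i (E i)"] E[OF i] sign_dist_flip_self[of "E i" n i] i A by auto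
  qed
  then obtain \<pi> where \<pi>: "\<And>i. i < n \<Longrightarrow> \<pi> i < n \<and> \<phi> (flip i (E i)) = flip (\<pi> i) (\<phi> (E i))" by metis
  \<comment> \<open>On which side of direction i the vector T lies is decided by the nearer end of
    the edge, and \<phi> preserves distances.\<close>
  have coord: "\<phi> T (\<pi> i) = \<phi> (E i) (\<pi> i) \<longleftrightarrow> T i = E i i" if T: "T \<in> A" and i: "i < n" for T i
  proof -
    have "T i = E i i \<longleftrightarrow> sign_dist n T (E i) < sign_dist n T (flip i (E i))"
      using sign_dist_flip[of T n "E i" i] T E[OF i] i A by (metis lessI not_less_eq subsetD less_asym)
    also have "\<dots> \<longleftrightarrow> sign_dist n (\<phi> T) (\<phi> (E i)) < sign_dist n (\<phi> T) (flip (\<pi> i) (\<phi> (E i)))"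
      using iso T E[OF i] \<pi>[OF i] by metis
    also have "\<dots> \<longleftrightarrow> \<phi> T (\<pi> i) = \<phi> (E i) (\<pi> i)"
      using sign_dist_flip[of "\<phi> T" n "\<phi> (E i)" "\<pi> i"] \<phi>B[OF T] \<phi>B[of "E i"] E[OF i] \<pi>[OF i] B
      by (metis lessI not_less_eq subsetD less_asym)
    finally show ?thesis by simp
  qed
  \<comment> \<open>If \<pi> i = \<pi> j, the edge in direction j would keep coordinate i while its
    image changes coordinate \<pi> i.\<close>
  have "inj_on \<pi> {..<n}"
  proof (rule inj_onI, rule ccontr)
    fix i j assume ij: "i \<in> {..<n}" "j \<in> {..<n}" "\<pi> i = \<pi> j" "i \<noteq> j"
    have "\<phi> (E j) (\<pi> i) = \<phi> (flip j (E j)) (\<pi> i)"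
    proof -
      have "E j i = flip j (E j) i" using ij by (simp add: flip_def)
      moreover have "\<phi> (E j) (\<pi> i) \<in> {1, -1}" "\<phi> (flip j (E j)) (\<pi> i) \<in> {1, -1}" "\<phi> (E i) (\<pi> i) \<in> {1, -1}"
        using E[of i] E[of j] \<phi>B B \<pi>[of i] ij by (auto simp: sign_vectors_def subset_iff)
      ultimately show ?thesis
        using coord[of "E j" i] coord[of "flip j (E j)" i] E[of j] ij by auto
    qed
    moreover have "\<phi> (flip j (E j)) (\<pi> j) = - \<phi> (E j) (\<pi> j)" using \<pi>[of j] ij by (simp add: flip_def)
    moreover have "\<phi> (E j) (\<pi> j) \<in> {1, -1}"
      using E[of j] \<phi>B B \<pi>[of j] ij by (auto simp: sign_vectors_def subset_iff)
    ultimately show False using ij by auto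
  qed
  moreover have "\<pi> ` {..<n} \<subseteq> {..<n}" using \<pi> by auto
  ultimately have bij: "bij_betw \<pi> {..<n} {..<n}"
    using endo_inj_surj[of "{..<n}" \<pi>] by (simp add: bij_betw_def)
  \<comment> \<open>\<open>signed_permute\<close> looks up the source coordinate of each target
    coordinate, hence the inverse of \<pi>.\<close>
  define \<rho> where "\<rho> = restrict (inv_into {..<n} \<pi>) {..<n}"
  have \<rho>: "\<rho> j < n" "\<pi> (\<rho> j) = j" if "j < n" for j
    using bij_betw_inv_into[OF bij] bij_betw_inv_into_right[OF bij, of j] that
    by (auto simp: \<rho>_def dest!: bij_betwE)
  define s where "s = restrict (\<lambda>j. \<phi> (E (\<rho> j)) j * E (\<rho> j) (\<rho> j)) {..<n}"
  have "\<phi> T = signed_permute n \<rho> s T" if T: "T \<in> A" for T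
  proof
    fix j
    show "\<phi> T j = signed_permute n \<rho> s T j"
    proof (cases "j < n")
      case True
      have "\<phi> T j \<in> {1, -1}" "\<phi> (E (\<rho> j)) j \<in> {1, -1}" "T (\<rho> j) \<in> {1, -1}" "E (\<rho> j) (\<rho> j) \<in> {1, -1}"
        using E[OF \<rho>(1)[OF True]] \<phi>B T A B \<rho>(1)[OF True] True by (auto simp: sign_vectors_def subset_iff)
      then show ?thesis using coord[OF T \<rho>(1)[OF True]] True
        by (auto simp: signed_permute_def s_def \<rho>(2))
    next
      case False
      then show ?thesis using \<phi>B[OF T] B by (auto simp: signed_permute_def sign_vectors_def subset_iff)
    qed
  qed
  then have "B = signed_permute n \<rho> s ` A" using \<phi> by (auto simp: bij_betw_def image_iff)
  moreover have "\<rho> \<in> PiE {..<n} (\<lambda>_. {..<n})" using \<rho>(1) by (auto simp: \<rho>_def)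
  moreover have "s \<in> PiE {..<n} (\<lambda>_. {1, -1})"
  proof -
    have "\<phi> (E (\<rho> j)) j * E (\<rho> j) (\<rho> j) \<in> {1, -1}" if "j < n" for j
    proof -
      have "\<phi> (E (\<rho> j)) j \<in> {1, -1}" "E (\<rho> j) (\<rho> j) \<in> {1, -1}"
        using E[OF \<rho>(1)[OF that]] \<phi>B A B \<rho>(1)[OF that] that by (auto simp: sign_vectors_def subset_iff)
      then show ?thesis by auto
    qed
    then show ?thesis by (simp add: s_def)
  qed
  ultimately show ?thesis by blast
qed

section \<open>General position and the graph of topes\<close>

definition uniform :: "(nat \<Rightarrow> real^'d::finite) \<Rightarrow> nat \<Rightarrow> bool" where
  "uniform v n \<longleftrightarrow> (\<forall>J::'d \<Rightarrow> nat. inj J \<longrightarrow> (\<forall>a. J a < n) \<longrightarrow> det (\<chi> a. v (J a)) \<noteq> 0)"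

text \<open>These label the regions of the arrangement of hyperplanes orthogonal to the generators,
  or equally the vertices of the zonotope.\<close>

definition topes :: "(nat \<Rightarrow> 'a::euclidean_space) \<Rightarrow> nat \<Rightarrow> (nat \<Rightarrow> real) set" where
  "topes v n = {covector v n u | u. \<forall>i<n. v i \<bullet> u \<noteq> 0}"

lemma topes_subset_sign_vectors: "topes v n \<subseteq> sign_vectors n"
  by (auto simp: topes_def covector_def sign_vectors_def sgn_if split: if_splits)

lemma inj_fun_updI: "inj_on f (UNIV - {a}) \<Longrightarrow> y \<notin> f ` (UNIV - {a}) \<Longrightarrow> inj (f(a := y))"
  by (auto simp: inj_on_def)

lemma tendsto_eventually_same_sgn:
  fixes l :: real
  assumes lim: "(f \<longlongrightarrow> l) F" and "l \<noteq> 0"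
  shows "\<forall>\<^sub>F x in F. sgn (f x) = sgn l"
proof (cases "l > 0")
  case True
  then have "\<forall>\<^sub>F x in F. f x > 0" by (rule order_tendstoD(1)[OF lim])
  then show ?thesis by eventually_elim (use True in simp)
next
  case False
  then have neg: "l < 0" using assms(2) by simp
  then have "\<forall>\<^sub>F x in F. f x < 0" by (rule order_tendstoD(2)[OF lim])
  then show ?thesis by eventually_elim (use neg in simp)
qed

text \<open>This realises the composition of covectors: the first one prevails and the second one
  fills its zeros.\<close>

lemma small_perturbation:
  fixes v :: "nat \<Rightarrow> 'a::real_inner"
  shows "\<exists>\<delta>>0. \<forall>i<n. sgn (v i \<bullet> (u + \<delta> *\<^sub>R w)) = (if v i \<bullet> u \<noteq> 0 then sgn (v i \<bullet> u) else sgn (v i \<bullet> w))"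
proof -
  have "\<forall>\<^sub>F \<delta> in at_right 0. \<forall>i\<in>{..<n}. v i \<bullet> u \<noteq> 0 \<longrightarrow> sgn (v i \<bullet> u + \<delta> * (v i \<bullet> w)) = sgn (v i \<bullet> u)"
  proof (rule eventually_ball_finite, simp, rule ballI)
    fix i
    have "((\<lambda>\<delta>. v i \<bullet> u + \<delta> * (v i \<bullet> w)) \<longlongrightarrow> v i \<bullet> u + 0 * (v i \<bullet> w)) (at_right 0)"
      by (intro tendsto_intros)
    from tendsto_eventually_same_sgn[OF this]
    show "\<forall>\<^sub>F \<delta> in at_right 0. v i \<bullet> u \<noteq> 0 \<longrightarrow> sgn (v i \<bullet> u + \<delta> * (v i \<bullet> w)) = sgn (v i \<bullet> u)"
      by (cases "v i \<bullet> u = 0") simp_all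
  qed
  moreover have "\<forall>\<^sub>F \<delta> in at_right (0::real). \<delta> > 0" by (rule eventually_at_right_less)
  ultimately have "\<forall>\<^sub>F \<delta> in at_right 0. \<delta> > 0 \<and>
      (\<forall>i\<in>{..<n}. v i \<bullet> u \<noteq> 0 \<longrightarrow> sgn (v i \<bullet> u + \<delta> * (v i \<bullet> w)) = sgn (v i \<bullet> u))"
    by eventually_elim simp
  then obtain \<delta> where "\<delta> > 0" "\<forall>i\<in>{..<n}. v i \<bullet> u \<noteq> 0 \<longrightarrow> sgn (v i \<bullet> u + \<delta> * (v i \<bullet> w)) = sgn (v i \<bullet> u)"
    using eventually_happens[of _ "at_right (0::real)"] by (auto simp: trivial_limit_at_right_real)
  then show ?thesis
    by (intro exI[of _ \<delta>]) (simp add: inner_add_right sgn_mult)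
qed

context
  fixes v :: "nat \<Rightarrow> real^'d::finite" and n :: nat
  assumes unif: "uniform v n" and n: "CARD('d) \<le> n"
begin

lemma uniform_extend_index:
  assumes "Z \<subseteq> {..<n}" "card Z \<le> CARD('d)"
  shows "\<exists>J::'d \<Rightarrow> nat. inj J \<and> (\<forall>a. J a < n) \<and> Z \<subseteq> range J"
proof -
  obtain Y where Y: "Z \<subseteq> Y" "Y \<subseteq> {..<n}" "card Y = CARD('d)"
    using exists_subset_between[OF assms(2) _ assms(1)] n by auto
  then have "finite Y" using finite_subset by blast
  then obtain J where "bij_betw J (UNIV::'d set) Y"
    using finite_same_card_bij[of "UNIV::'d set" Y] Y(3) by auto
  then show ?thesis using Y by (intro exI[of _ J]) (auto simp: bij_betw_def)
qed

lemma uniform_solvable: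
  assumes "Z \<subseteq> {..<n}" "card Z \<le> CARD('d)"
  shows "\<exists>w. \<forall>i\<in>Z. v i \<bullet> w = y i"
proof -
  obtain J :: "'d \<Rightarrow> nat" where J: "inj J" "\<forall>a. J a < n" "Z \<subseteq> range J"
    using uniform_extend_index[OF assms] by blast
  then have "det (\<chi> a. v (J a)) \<noteq> 0" using unif by (simp add: uniform_def)
  from det_rows_solvable[OF this, of "\<lambda>a. y (J a)"] J(3) show ?thesis by blast
qed

lemma uniform_zero_set_card:
  assumes "u \<noteq> 0"
  shows "card {i. i < n \<and> v i \<bullet> u = 0} < CARD('d)"
proof (rule ccontr)
  assume "\<not> ?thesis"
  then have "CARD('d) \<le> card {i. i < n \<and> v i \<bullet> u = 0}" by simp
  then obtain J :: "'d \<Rightarrow> nat" where J: "J ` UNIV \<subseteq> {i. i < n \<and> v i \<bullet> u = 0}" "inj J"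
    using card_le_inj[of "UNIV::'d set" "{i. i < n \<and> v i \<bullet> u = 0}"] by auto
  have Jz: "J a < n" "v (J a) \<bullet> u = 0" for a using J(1) by auto
  then have "det (\<chi> a. v (J a)) \<noteq> 0" using unif J(2) by (simp add: uniform_def)
  moreover have "det (\<chi> a. v (J a)) = 0"
    unfolding det_rows_eq_0_iff using Jz assms by (intro exI[of _ u]) simp
  ultimately show False by simp
qed

text \<open>Fewer than d generators vanish at a nonzero u, and they are independent, so a small
  perturbation can give them any prescribed signs.\<close>

lemma uniform_fill:
  assumes "u \<noteq> 0"
  shows "\<exists>u'. \<forall>i<n. sgn (v i \<bullet> u') = (if v i \<bullet> u \<noteq> 0 then sgn (v i \<bullet> u) else sgn (y i))"
proof -
  obtain w where w: "\<forall>i\<in>{i. i < n \<and> v i \<bullet> u = 0}. v i \<bullet> w = y i"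
    using uniform_solvable[of "{i. i < n \<and> v i \<bullet> u = 0}" y] uniform_zero_set_card[OF assms]
    by (auto simp: less_imp_le)
  obtain \<delta> where "\<forall>i<n. sgn (v i \<bullet> (u + \<delta> *\<^sub>R w)) = (if v i \<bullet> u \<noteq> 0 then sgn (v i \<bullet> u) else sgn (v i \<bullet> w))"
    using small_perturbation[of n v u w] by blast
  then show ?thesis using w by (intro exI[of _ "u + \<delta> *\<^sub>R w"]) auto
qed

lemma uniform_span: "span (v ` {..<n}) = UNIV"
proof -
  obtain J :: "'d \<Rightarrow> nat" where J: "inj J" "\<forall>a. J a < n" using uniform_extend_index[of "{}"] by auto
  then have det: "det (\<chi> a. v (J a)) \<noteq> 0" using unif by (simp add: uniform_def)
  have "u = 0" if "\<And>x. x \<in> span (v ` {..<n}) \<Longrightarrow> orthogonal u x" for u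
  proof (rule ccontr)
    assume "u \<noteq> 0"
    moreover have "v (J a) \<bullet> u = 0" for a
      using that[of "v (J a)"] J(2) span_base[of "v (J a)" "v ` {..<n}"]
      by (auto simp: orthogonal_def inner_commute)
    ultimately show False using det det_rows_eq_0_iff[of "\<lambda>a. v (J a)"] by blast
  qed
  then show ?thesis using orthogonal_to_subspace_exists_gen[of "v ` {..<n}" UNIV]
    by (metis psubsetI span_UNIV subset_UNIV)
qed

end

lemma uniform_vector_nonzero:
  fixes v :: "nat \<Rightarrow> real^'d::finite"
  assumes "uniform v n" "CARD('d) \<le> n" "i < n"
  shows "v i \<noteq> 0"
proof -
  have "\<exists>w. \<forall>k\<in>{i}. v k \<bullet> w = 1"
    using uniform_solvable[OF assms(1,2), of "{i}" "\<lambda>_. 1"] assms(3) by (simp add: Suc_le_eq)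
  then show ?thesis by auto
qed

lemma uniform_in_zonotopes_dim:
  fixes v :: "nat \<Rightarrow> real^'d::finite"
  assumes "uniform v n" "CARD('d) \<le> n" "2 \<le> CARD('d)" "0 < n"
  shows "zon v n \<in> zonotopes_dim TYPE('d) n"
proof -
  have pair: "\<exists>w. v i \<bullet> w = 1 \<and> v j \<bullet> w = 0" if "i < n" "j < n" "i \<noteq> j" for i j
    using uniform_solvable[OF assms(1,2), of "{i, j}" "\<lambda>k. if k = i then 1 else 0"] that assms(3) by auto
  note nz = uniform_vector_nonzero[OF assms(1,2)]
  have inj: "inj_on v {..<n}"
  proof (rule inj_onI, rule ccontr)
    fix i j assume "i \<in> {..<n}" "j \<in> {..<n}" "v i = v j" "i \<noteq> j"
    with pair[of i j] show False by auto
  qed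
  moreover have "generator_set (v ` {..<n})"
    unfolding generator_set_def
  proof (intro conjI ballI impI notI)
    show "finite (v ` {..<n})" by simp
    show False if "v ` {..<n} = {}" using that assms(4) by blast
    show False if "0 \<in> v ` {..<n}" using that nz by force
    fix g h assume gh: "g \<in> v ` {..<n}" "h \<in> v ` {..<n}" "g \<noteq> h" "\<exists>c. h = c *\<^sub>R g"
    then obtain i j c where ij: "i < n" "j < n" "g = v i" "h = v j" "v j = c *\<^sub>R v i" by auto
    then have "j \<noteq> i" using gh(3) by auto
    then obtain w where "v j \<bullet> w = 1" "v i \<bullet> w = 0" using pair[of j i] ij(1,2) by blast
    then show False using ij(5) by simp
  qed
  ultimately show ?thesis
    using uniform_span[OF assms(1,2)] by (rule zon_in_zonotopes_dim)
qed

lemma topes_memI: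
  assumes "\<And>i. i < n \<Longrightarrow> sgn (v i \<bullet> u) = T i" "\<And>i. i < n \<Longrightarrow> T i \<noteq> 0" "\<And>i. \<not> i < n \<Longrightarrow> T i = 0"
  shows "T \<in> topes v n"
proof -
  have "T = covector v n u" using assms by (auto simp: covector_def fun_eq_iff)
  moreover have "\<forall>i<n. v i \<bullet> u \<noteq> 0" using assms by (metis sgn_zero)
  ultimately show ?thesis unfolding topes_def by blast
qed

context
  fixes v :: "nat \<Rightarrow> real^'d::finite" and n :: nat
  assumes unif: "uniform v n" and n: "CARD('d) \<le> n" and d2: "2 \<le> CARD('d)"
begin

text \<open>Take u on the hyperplane of v i and fill its zeros twice, with opposite signs at i. A
  second generator with value 1 at u guarantees that u is nonzero; this takes d \<ge> 2.\<close>

lemma topes_walls: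
  assumes i: "i < n"
  shows "\<exists>T\<in>topes v n. flip i T \<in> topes v n"
proof -
  obtain j where j: "j < n" "j \<noteq> i"
  proof -
    have "(if i = 0 then 1 else 0) < n" "(if i = 0 then 1 else 0) \<noteq> i" using n d2 by auto
    then show thesis by (rule that)
  qed
  obtain u where u: "v i \<bullet> u = 0" "v j \<bullet> u = 1"
    using uniform_solvable[OF unif n, of "{i, j}" "\<lambda>k. if k = i then 0 else 1"] i j d2 by auto
  then have "u \<noteq> 0" by auto
  define T where "T k = (if k < n then if v k \<bullet> u \<noteq> 0 then sgn (v k \<bullet> u) else 1 else 0)" for k
  obtain x where "\<forall>k<n. sgn (v k \<bullet> x) = (if v k \<bullet> u \<noteq> 0 then sgn (v k \<bullet> u) else sgn 1)"
    using uniform_fill[OF unif n \<open>u \<noteq> 0\<close>, of "\<lambda>_. 1"] by blast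
  then have "T \<in> topes v n"
    by (intro topes_memI[of _ _ x]) (auto simp: T_def sgn_zero_iff)
  moreover obtain y where "\<forall>k<n. sgn (v k \<bullet> y) = (if v k \<bullet> u \<noteq> 0 then sgn (v k \<bullet> u) else sgn (if k = i then -1 else 1))"
    using uniform_fill[OF unif n \<open>u \<noteq> 0\<close>, of "\<lambda>k. if k = i then -1 else 1"] by blast
  then have "flip i T \<in> topes v n"
    by (intro topes_memI[of _ _ y]) (use u i in \<open>auto simp: T_def flip_def sgn_zero_iff\<close>)
  ultimately show ?thesis by blast
qed

text \<open>The path from one tope to another will be a segment between realising vectors; it has to
  avoid 0, which holds once the endpoint is off the line through the start.\<close>

lemma tope_realizer_off_line:
  assumes "T \<in> topes v n"
  shows "\<exists>u'. u' \<notin> span {u} \<and> T = covector v n u' \<and> (\<forall>i<n. v i \<bullet> u' \<noteq> 0)"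
proof -
  obtain x where x: "T = covector v n x" "\<forall>i<n. v i \<bullet> x \<noteq> 0" using assms by (auto simp: topes_def)
  show ?thesis
  proof (cases "x \<in> span {u}")
    case True
    have "span {u} \<noteq> (UNIV :: (real^'d) set)"
    proof
      assume "span {u} = (UNIV :: (real^'d) set)"
      then have "dim (UNIV :: (real^'d) set) \<le> card {u}" by (metis dim_le_card finite.emptyI finite.insertI subset_refl)
      then show False using d2 by simp
    qed
    then obtain w where w: "w \<notin> span {u}" by blast
    obtain \<delta> where \<delta>: "\<delta> > 0" "\<forall>i<n. sgn (v i \<bullet> (x + \<delta> *\<^sub>R w)) = sgn (v i \<bullet> x)"
      using small_perturbation[of n v x w] x(2) by auto
    have "x + \<delta> *\<^sub>R w \<notin> span {u}"
    proof
      assume "x + \<delta> *\<^sub>R w \<in> span {u}"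
      then have "(1 / \<delta>) *\<^sub>R ((x + \<delta> *\<^sub>R w) - x) \<in> span {u}" using True by (intro span_scale span_diff)
      then show False using w \<delta>(1) by simp
    qed
    moreover have "T = covector v n (x + \<delta> *\<^sub>R w)" using x(1) \<delta>(2) by (auto simp: covector_def fun_eq_iff)
    moreover have "\<forall>i<n. v i \<bullet> (x + \<delta> *\<^sub>R w) \<noteq> 0" using x(2) \<delta>(2) by (metis sgn_zero_iff)
    ultimately show ?thesis by blast
  qed (use x in blast)
qed

text \<open>Walk on a segment from u to w and stop at the first hyperplane met. Several may be met
  at once, but general position allows leaving that point with the sign at just one of them
  flipped.\<close>

lemma topes_gated:
  assumes S: "S \<in> topes v n" and T: "T \<in> topes v n" and "S \<noteq> T"
  shows "\<exists>i<n. S i \<noteq> T i \<and> flip i S \<in> topes v n"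
proof -
  obtain u where u: "S = covector v n u" "\<forall>i<n. v i \<bullet> u \<noteq> 0" using S by (auto simp: topes_def)
  obtain w where w: "w \<notin> span {u}" "T = covector v n w" "\<forall>i<n. v i \<bullet> w \<noteq> 0"
    using tope_realizer_off_line[OF T] by blast
  define D where "D = {i. i < n \<and> S i \<noteq> T i}"
  define r where "r i = (v i \<bullet> u) / (v i \<bullet> u - v i \<bullet> w)" for i
  have opp: "(v i \<bullet> u > 0 \<and> v i \<bullet> w < 0) \<or> (v i \<bullet> u < 0 \<and> v i \<bullet> w > 0)" if "i \<in> D" for i
    using that u w by (auto simp: D_def covector_def sgn_if split: if_splits)
  have same: "(v i \<bullet> u > 0 \<and> v i \<bullet> w > 0) \<or> (v i \<bullet> u < 0 \<and> v i \<bullet> w < 0)" if "i < n" "i \<notin> D" for i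
  proof -
    have "sgn (v i \<bullet> u) = sgn (v i \<bullet> w)" using that u w by (simp add: D_def covector_def)
    moreover have "v i \<bullet> u \<noteq> 0" "v i \<bullet> w \<noteq> 0" using that u w by auto
    ultimately show ?thesis by (auto simp: sgn_if split: if_splits)
  qed
  have "D \<noteq> {}"
  proof
    assume "D = {}"
    then have "S i = T i" for i using u(1) w(2) by (cases "i < n") (auto simp: D_def covector_def)
    then show False using \<open>S \<noteq> T\<close> by auto
  qed
  have "finite D" by (simp add: D_def)
  define t where "t = Min (r ` D)"
  have "t \<in> r ` D" unfolding t_def using \<open>finite D\<close> \<open>D \<noteq> {}\<close> by (intro Min_in) auto
  then obtain k where k: "k \<in> D" "t = r k" by blast
  have t01: "0 < t" "t < 1" using opp[OF k(1)] by (auto simp: k(2) r_def field_simps)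
  define x where "x = (1 - t) *\<^sub>R u + t *\<^sub>R w"
  have x_inner: "v i \<bullet> x = (1 - t) * (v i \<bullet> u) + t * (v i \<bullet> w)" for i
    by (simp add: x_def inner_add_right)
  have kx: "v k \<bullet> x = 0" using opp[OF k(1)] by (auto simp: x_inner k(2) r_def field_simps)
  have "x \<noteq> 0"
  proof
    assume "x = 0"
    then have "w = (- (1 - t) / t) *\<^sub>R u"
      using t01 by (simp add: x_def vec_eq_iff field_simps add_eq_0_iff)
    then show False using w(1) by (metis span_base span_scale singletonI)
  qed
  have x_sgn: "sgn (v i \<bullet> x) = S i \<or> (v i \<bullet> x = 0 \<and> i \<in> D)" if i: "i < n" for i
  proof (cases "i \<in> D")
    case True
    have "t \<le> r i" unfolding t_def using \<open>finite D\<close> True by (intro Min_le) auto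
    from opp[OF True] show ?thesis
    proof
      assume *: "v i \<bullet> u > 0 \<and> v i \<bullet> w < 0"
      then have "t * (v i \<bullet> u - v i \<bullet> w) \<le> v i \<bullet> u" using \<open>t \<le> r i\<close> by (simp add: r_def pos_le_divide_eq)
      then have "v i \<bullet> x \<ge> 0" by (simp add: x_inner algebra_simps)
      then show ?thesis using * True i u(1) by (auto simp: covector_def sgn_if)
    next
      assume *: "v i \<bullet> u < 0 \<and> v i \<bullet> w > 0"
      then have "t * (v i \<bullet> u - v i \<bullet> w) \<ge> v i \<bullet> u" using \<open>t \<le> r i\<close> by (simp add: r_def neg_le_divide_eq)
      then have "v i \<bullet> x \<le> 0" by (simp add: x_inner algebra_simps)
      then show ?thesis using * True i u(1) by (auto simp: covector_def sgn_if)
    qed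
  next
    case False
    from same[OF i False] show ?thesis
    proof
      assume *: "v i \<bullet> u > 0 \<and> v i \<bullet> w > 0"
      then have "v i \<bullet> x > 0" unfolding x_inner using t01 by (intro add_pos_pos mult_pos_pos) auto
      then show ?thesis using * i u(1) by (auto simp: covector_def sgn_if)
    next
      assume *: "v i \<bullet> u < 0 \<and> v i \<bullet> w < 0"
      then have "v i \<bullet> x < 0" unfolding x_inner using t01 by (intro add_neg_neg mult_pos_neg) auto
      then show ?thesis using * i u(1) by (auto simp: covector_def sgn_if)
    qed
  qed
  obtain y where y: "\<forall>i<n. sgn (v i \<bullet> y) = (if v i \<bullet> x \<noteq> 0 then sgn (v i \<bullet> x) else sgn (if i = k then - S i else S i))"
    using uniform_fill[OF unif n \<open>x \<noteq> 0\<close>, of "\<lambda>i. if i = k then - S i else S i"] by blast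
  have kn: "k < n" using k(1) by (simp add: D_def)
  have "flip k S \<in> topes v n"
  proof (rule topes_memI[of _ _ y])
    fix i assume i: "i < n"
    have Si: "sgn (S i) = S i" "S i \<noteq> 0" using i u by (auto simp: covector_def sgn_zero_iff)
    show "flip k S i \<noteq> 0" using Si by (cases "i = k") (auto simp: flip_def)
    show "sgn (v i \<bullet> y) = flip k S i"
      using y i kx x_sgn[OF i] Si by (auto simp: flip_def sgn_minus)
  qed (use u(1) in \<open>auto simp: flip_def covector_def\<close>)
  then show ?thesis using k(1) kn by (auto simp: D_def)
qed

end

section \<open>Vertices and edges recovered from the face lattice\<close>

definition is_vertex :: "'a::real_vector set \<Rightarrow> 'a set \<Rightarrow> bool" where
  "is_vertex P F \<longleftrightarrow> F face_of P \<and> F \<noteq> {} \<and> (\<forall>G. G face_of P \<longrightarrow> G \<noteq> {} \<longrightarrow> G \<subseteq> F \<longrightarrow> G = F)"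

text \<open>An edge is described by the order alone, as a face whose proper nonempty faces are all
  vertices; hence lattice isomorphisms preserve adjacency.\<close>

definition adjacent_vertices :: "'a::real_vector set \<Rightarrow> 'a set \<Rightarrow> 'a set \<Rightarrow> bool" where
  "adjacent_vertices P F G \<longleftrightarrow> F \<noteq> G \<and> (\<exists>E. E face_of P \<and> F \<subseteq> E \<and> G \<subseteq> E \<and>
     (\<forall>H. H face_of P \<longrightarrow> H \<noteq> {} \<longrightarrow> H \<subset> E \<longrightarrow> is_vertex P H))"

lemma face_lattice_iso_vertices:
  assumes f: "bij_betw f {F. F face_of P} {F. F face_of Q}"
    and sub: "\<forall>F F'. F face_of P \<longrightarrow> F' face_of P \<longrightarrow> (F \<subseteq> F' \<longleftrightarrow> f F \<subseteq> f F')"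
  shows "F face_of P \<Longrightarrow> is_vertex Q (f F) \<longleftrightarrow> is_vertex P F"
    and "F face_of P \<Longrightarrow> G face_of P \<Longrightarrow> adjacent_vertices Q (f F) (f G) \<longleftrightarrow> adjacent_vertices P F G"
proof -
  have ff: "f F face_of Q" if "F face_of P" for F using bij_betwE[OF f] that by simp
  have surj: "\<exists>F. F face_of P \<and> G = f F" if "G face_of Q" for G
    using bij_betw_imp_surj_on[OF f] that by (metis (mono_tags, lifting) imageE mem_Collect_eq)
  have inj: "f F = f G \<longleftrightarrow> F = G" if "F face_of P" "G face_of P" for F G
    using bij_betw_imp_inj_on[OF f] that by (auto dest: inj_onD)
  have empty: "f F = {} \<longleftrightarrow> F = {}" if "F face_of P" for F
  proof -
    have "f {} = {}"
    proof -
      obtain E where E: "E face_of P" "{} = f E" using surj[of "{}"] by auto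
      have "f {} \<subseteq> f E" using sub[rule_format, of "{}" E] E by simp
      then show ?thesis using E by simp
    qed
    then show ?thesis using inj[OF that, of "{}"] by simp
  qed
  have sub': "f F \<subseteq> f G \<longleftrightarrow> F \<subseteq> G" if "F face_of P" "G face_of P" for F G
    using sub that by simp
  have all: "(\<forall>G. G face_of Q \<longrightarrow> R G) \<longleftrightarrow> (\<forall>G. G face_of P \<longrightarrow> R (f G))" for R
    using ff surj by metis
  have ex: "(\<exists>G. G face_of Q \<and> R G) \<longleftrightarrow> (\<exists>G. G face_of P \<and> R (f G))" for R
    using ff surj by metis
  have vert: "is_vertex Q (f F) \<longleftrightarrow> is_vertex P F" if F: "F face_of P" for F
    unfolding is_vertex_def using F ff[OF F]
    by (simp add: all empty sub' inj cong: imp_cong conj_cong)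
  show "F face_of P \<Longrightarrow> is_vertex Q (f F) \<longleftrightarrow> is_vertex P F" by (rule vert)
  show "adjacent_vertices Q (f F) (f G) \<longleftrightarrow> adjacent_vertices P F G" if F: "F face_of P" and G: "G face_of P"
    unfolding adjacent_vertices_def using F G
    by (simp add: ex all empty sub' inj vert psubset_eq cong: imp_cong conj_cong)
qed

context
  fixes v :: "nat \<Rightarrow> real^'d::finite" and n :: nat
  assumes unif: "uniform v n" and n: "CARD('d) \<le> n" and d2: "2 \<le> CARD('d)"
begin

lemma conforming_refinement:
  assumes "Z \<subseteq> {..<n}" "card Z \<le> CARD('d)" "\<And>i. i \<in> Z \<Longrightarrow> v i \<bullet> u = 0"
  shows "\<exists>x. conforms (covector v n u) (covector v n x) \<and> (\<forall>i\<in>Z. sgn (v i \<bullet> x) = sgn (y i))"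
proof -
  obtain w where w: "\<forall>i\<in>Z. v i \<bullet> w = y i" using uniform_solvable[OF unif n assms(1,2)] by blast
  obtain \<delta> where \<delta>: "\<forall>i<n. sgn (v i \<bullet> (u + \<delta> *\<^sub>R w)) = (if v i \<bullet> u \<noteq> 0 then sgn (v i \<bullet> u) else sgn (v i \<bullet> w))"
    using small_perturbation[of n v u w] by blast
  have "conforms (covector v n u) (covector v n (u + \<delta> *\<^sub>R w))"
    using \<delta> by (auto simp: conforms_def covector_def)
  moreover have "\<forall>i\<in>Z. sgn (v i \<bullet> (u + \<delta> *\<^sub>R w)) = sgn (y i)"
    using \<delta> w assms by (auto simp: subset_iff)
  ultimately show ?thesis by blast
qed

lemma is_vertex_zon_face: "is_vertex (zon v n) (zon_face v n u) \<longleftrightarrow> (\<forall>i<n. v i \<bullet> u \<noteq> 0)"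
proof
  assume vert: "is_vertex (zon v n) (zon_face v n u)"
  show "\<forall>i<n. v i \<bullet> u \<noteq> 0"
  proof (intro allI impI notI)
    fix i assume i: "i < n" "v i \<bullet> u = 0"
    obtain x where x: "conforms (covector v n u) (covector v n x)" "sgn (v i \<bullet> x) = 1"
      using conforming_refinement[of "{i}" u "\<lambda>_. 1"] i d2 by auto
    have "zon_face v n x face_of zon v n" by (auto simp: face_of_zon_iff)
    moreover have "zon_face v n x \<subseteq> zon_face v n u" using x(1) by (simp add: zon_face_subset_iff)
    ultimately have "zon_face v n x = zon_face v n u"
      using vert zon_face_nonempty[of v n x] by (simp add: is_vertex_def)
    then have "covector v n x i = covector v n u i" by (simp add: zon_face_eq_iff)
    then show False using i x(2) by (simp add: covector_def)
  qed
next
  assume nz: "\<forall>i<n. v i \<bullet> u \<noteq> 0"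
  have "G = zon_face v n u" if G: "G face_of zon v n" "G \<noteq> {}" "G \<subseteq> zon_face v n u" for G
  proof -
    obtain x where x: "G = zon_face v n x" using G(1,2) by (auto simp: face_of_zon_iff)
    then have c: "conforms (covector v n u) (covector v n x)" using G(3) by (simp add: zon_face_subset_iff)
    have "covector v n x i = covector v n u i" for i
      using c[unfolded conforms_def, rule_format, of i] nz
      by (cases "i < n") (simp_all add: covector_def sgn_zero_iff)
    then have "covector v n x = covector v n u" by blast
    then show ?thesis by (simp add: x zon_face_eq_iff)
  qed
  moreover have "zon_face v n u face_of zon v n" by (auto simp: face_of_zon_iff)
  ultimately show "is_vertex (zon v n) (zon_face v n u)"
    using zon_face_nonempty[of v n u] by (simp add: is_vertex_def)
qed

lemma adjacent_zon_face:
  assumes u: "\<forall>i<n. v i \<bullet> u \<noteq> 0" and w: "\<forall>i<n. v i \<bullet> w \<noteq> 0"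
  shows "adjacent_vertices (zon v n) (zon_face v n u) (zon_face v n w) \<longleftrightarrow>
    sign_dist n (covector v n u) (covector v n w) = 1"
proof
  assume "adjacent_vertices (zon v n) (zon_face v n u) (zon_face v n w)"
  then obtain E where E: "E face_of zon v n" "zon_face v n u \<subseteq> E" "zon_face v n w \<subseteq> E"
      "\<forall>H. H face_of zon v n \<longrightarrow> H \<noteq> {} \<longrightarrow> H \<subset> E \<longrightarrow> is_vertex (zon v n) H"
    and ne: "zon_face v n u \<noteq> zon_face v n w"
    unfolding adjacent_vertices_def by blast
  have "E \<noteq> {}" using E(2) zon_face_nonempty[of v n u] by blast
  then obtain x where x: "E = zon_face v n x" using E(1) by (auto simp: face_of_zon_iff)
  have cu: "conforms (covector v n x) (covector v n u)" and cw: "conforms (covector v n x) (covector v n w)"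
    using E(2,3) by (simp_all add: x zon_face_subset_iff)
  \<comment> \<open>If x had two zeros, one could be given a sign while the other is kept, which
    yields a proper face of E that is no vertex.\<close>
  have uniq: "i = j" if ij: "i < n" "j < n" "v i \<bullet> x = 0" "v j \<bullet> x = 0" for i j
  proof (rule ccontr)
    assume "i \<noteq> j"
    then obtain y where y: "conforms (covector v n x) (covector v n y)" "sgn (v i \<bullet> y) = 1" "sgn (v j \<bullet> y) = 0"
      using conforming_refinement[of "{i, j}" x "\<lambda>k. if k = i then 1 else 0"] ij d2 by auto
    have "zon_face v n y \<subseteq> E" using y(1) by (simp add: x zon_face_subset_iff)
    moreover have "zon_face v n y \<noteq> E"
    proof
      assume "zon_face v n y = E"
      then have "covector v n y i = covector v n x i" by (simp add: x zon_face_eq_iff)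
      then show False using y(2) ij by (simp add: covector_def)
    qed
    ultimately have "is_vertex (zon v n) (zon_face v n y)"
      using E(4)[rule_format, of "zon_face v n y"] zon_face_nonempty[of v n y] by (auto simp: face_of_zon_iff)
    then show False using y(3) ij(2) by (auto simp: is_vertex_zon_face sgn_zero_iff)
  qed
  let ?D = "{i. i < n \<and> covector v n u i \<noteq> covector v n w i}"
  have "?D \<noteq> {}"
  proof
    assume "?D = {}"
    then have "covector v n u i = covector v n w i" for i by (cases "i < n") (auto simp: covector_def)
    then show False using ne by (simp add: zon_face_eq_iff fun_eq_iff)
  qed
  then obtain k where k: "k \<in> ?D" by blast
  have Dx: "v i \<bullet> x = 0" if "i \<in> ?D" for i
  proof (rule ccontr)
    assume "v i \<bullet> x \<noteq> 0"
    then have "covector v n x i \<noteq> 0" using that by (simp add: covector_def sgn_zero_iff)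
    then have "covector v n u i = covector v n x i" "covector v n w i = covector v n x i"
      using cu cw by (simp_all add: conforms_def)
    then show False using that by simp
  qed
  have "?D = {k}"
  proof (intro equalityI subsetI)
    fix i assume i: "i \<in> ?D"
    then have "i < n" "k < n" using k by simp_all
    then have "i = k" using uniq Dx[OF i] Dx[OF k] by simp
    then show "i \<in> {k}" by simp
  qed (use k in simp)
  then show "sign_dist n (covector v n u) (covector v n w) = 1" by (simp add: sign_dist_def)
next
  assume dist: "sign_dist n (covector v n u) (covector v n w) = 1"
  then obtain k where D: "{i. i < n \<and> covector v n u i \<noteq> covector v n w i} = {k}"
    by (auto simp: sign_dist_def card_1_singleton_iff)
  have "k \<in> {i. i < n \<and> covector v n u i \<noteq> covector v n w i}" unfolding D by simp
  then have k: "k < n" "covector v n u k \<noteq> covector v n w k" by simp_all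
  have same: "sgn (v i \<bullet> u) = sgn (v i \<bullet> w)" if "i < n" "i \<noteq> k" for i
  proof -
    have "i \<notin> {i. i < n \<and> covector v n u i \<noteq> covector v n w i}" unfolding D using that by simp
    then show ?thesis using that by (simp add: covector_def)
  qed
  have kuw: "v k \<bullet> u \<noteq> 0" "v k \<bullet> w \<noteq> 0" "sgn (v k \<bullet> u) \<noteq> sgn (v k \<bullet> w)"
    using k u w by (simp_all add: covector_def)
  \<comment> \<open>The weights cancel at k, where u and w have opposite signs; elsewhere the signs
    agree and persist.\<close>
  define x where "x = \<bar>v k \<bullet> w\<bar> *\<^sub>R u + \<bar>v k \<bullet> u\<bar> *\<^sub>R w"
  have x_inner: "v i \<bullet> x = \<bar>v k \<bullet> w\<bar> * (v i \<bullet> u) + \<bar>v k \<bullet> u\<bar> * (v i \<bullet> w)" for i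
    by (simp add: x_def inner_add_right)
  have kx: "v k \<bullet> x = 0"
  proof (cases "v k \<bullet> u > 0")
    case True
    then have "v k \<bullet> w < 0" using kuw by (metis linorder_neqE sgn_pos)
    with True show ?thesis by (simp add: x_inner)
  next
    case False
    then have "v k \<bullet> u < 0" using kuw(1) by linarith
    moreover from this have "v k \<bullet> w > 0" using kuw by (metis linorder_neqE sgn_neg)
    ultimately show ?thesis by (simp add: x_inner)
  qed
  have xi: "sgn (v i \<bullet> x) = sgn (v i \<bullet> u)" if "i < n" "i \<noteq> k" for i
  proof (cases "v i \<bullet> u > 0")
    case True
    then have "v i \<bullet> w > 0" using same[OF that] by (auto simp: sgn_if split: if_splits)
    then have "v i \<bullet> x > 0" unfolding x_inner using True kuw by (intro add_pos_pos mult_pos_pos) auto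
    then show ?thesis using True by simp
  next
    case False
    then have neg: "v i \<bullet> u < 0" using u that(1) by (metis linorder_neqE)
    then have "v i \<bullet> w < 0" using same[OF that] by (auto simp: sgn_if split: if_splits)
    then have "v i \<bullet> x < 0" unfolding x_inner using neg kuw by (intro add_neg_neg mult_pos_neg) auto
    then show ?thesis using neg by simp
  qed
  have cx: "covector v n u i = covector v n x i" "covector v n w i = covector v n x i" if "i \<noteq> k" for i
    using xi[of i] same[of i] that by (simp_all add: covector_def)
  have cxk: "covector v n x k = 0" using kx by (simp add: covector_def)
  have "conforms (covector v n x) (covector v n u)" "conforms (covector v n x) (covector v n w)"
    unfolding conforms_def using cx cxk by metis+
  moreover have "is_vertex (zon v n) H" if H: "H face_of zon v n" "H \<noteq> {}" "H \<subset> zon_face v n x" for H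
  proof -
    obtain y where y: "H = zon_face v n y" using H(1,2) by (auto simp: face_of_zon_iff)
    then have c: "conforms (covector v n x) (covector v n y)" "covector v n x \<noteq> covector v n y"
      using H(3) by (auto simp: zon_face_subset_iff psubset_eq zon_face_eq_iff)
    have other: "covector v n y i = covector v n x i" if "i \<noteq> k" for i
    proof (cases "i < n")
      case True
      then have "covector v n x i \<noteq> 0" using u by (simp flip: cx(1)[OF that]) (simp add: covector_def sgn_zero_iff)
      then show ?thesis using c(1) by (simp add: conforms_def)
    qed (simp add: covector_def)
    have "v i \<bullet> y \<noteq> 0" if i: "i < n" for i
    proof (cases "i = k")
      case True
      have "covector v n y k \<noteq> covector v n x k"
      proof
        assume "covector v n y k = covector v n x k"
        then have "covector v n y i = covector v n x i" for i using other[of i] by (cases "i = k") auto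
        then show False using c(2) by (auto simp: fun_eq_iff)
      qed
      then show ?thesis using True i kx by (auto simp: covector_def)
    next
      case False
      then show ?thesis using other[OF False] xi[OF i False] u i by (auto simp: covector_def sgn_zero_iff)
    qed
    then show ?thesis unfolding y is_vertex_zon_face by blast
  qed
  moreover have "zon_face v n u \<noteq> zon_face v n w" using k by (auto simp: zon_face_eq_iff)
  ultimately show "adjacent_vertices (zon v n) (zon_face v n u) (zon_face v n w)"
    unfolding adjacent_vertices_def zon_face_subset_iff[symmetric]
    by (intro conjI exI[of _ "zon_face v n x"]) (auto simp: face_of_zon_iff)
qed

end

definition tope_face :: "(nat \<Rightarrow> 'a::euclidean_space) \<Rightarrow> nat \<Rightarrow> (nat \<Rightarrow> real) \<Rightarrow> 'a set" where
  "tope_face v n T = zon_face v n (SOME u. T = covector v n u)"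

lemma tope_face_covector: "tope_face v n (covector v n u) = zon_face v n u"
proof -
  have "covector v n u = covector v n (SOME w. covector v n u = covector v n w)"
    by (rule someI[of _ u]) simp
  then show ?thesis by (simp add: tope_face_def zon_face_eq_iff)
qed

lemma tope_face_bij:
  fixes v :: "nat \<Rightarrow> real^'d::finite"
  assumes "uniform v n" "CARD('d) \<le> n" "2 \<le> CARD('d)"
  shows "bij_betw (tope_face v n) (topes v n) {F. is_vertex (zon v n) F}"
  unfolding bij_betw_def
proof
  show "inj_on (tope_face v n) (topes v n)"
    by (rule inj_onI) (auto simp: topes_def tope_face_covector zon_face_eq_iff)
  show "tope_face v n ` topes v n = {F. is_vertex (zon v n) F}"
  proof (intro equalityI subsetI)
    fix F assume "F \<in> tope_face v n ` topes v n"
    then show "F \<in> {F. is_vertex (zon v n) F}"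
      using is_vertex_zon_face[OF assms] by (auto simp: topes_def tope_face_covector)
  next
    fix F assume "F \<in> {F. is_vertex (zon v n) F}"
    then have F: "is_vertex (zon v n) F" by simp
    then obtain u where u: "F = zon_face v n u" by (auto simp: is_vertex_def face_of_zon_iff)
    have "\<forall>i<n. v i \<bullet> u \<noteq> 0" using F unfolding u is_vertex_zon_face[OF assms] .
    then have "covector v n u \<in> topes v n" unfolding topes_def by blast
    then show "F \<in> tope_face v n ` topes v n" by (metis u tope_face_covector imageI)
  qed
qed

lemma adjacent_tope_face:
  fixes v :: "nat \<Rightarrow> real^'d::finite"
  assumes "uniform v n" "CARD('d) \<le> n" "2 \<le> CARD('d)" "S \<in> topes v n" "T \<in> topes v n"
  shows "adjacent_vertices (zon v n) (tope_face v n S) (tope_face v n T) \<longleftrightarrow> sign_dist n S T = 1"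
  using assms(4,5) adjacent_zon_face[OF assms(1-3)] by (auto simp: topes_def tope_face_covector)

text \<open>A lattice isomorphism carries vertices to vertices and edges to edges. Read on topes, it
  is a bijection that preserves Hamming distance 1 in both directions.\<close>

lemma same_comb_type_signed_permute:
  fixes v w :: "nat \<Rightarrow> real^'d::finite"
  assumes v: "uniform v n" and w: "uniform w n" and n: "CARD('d) \<le> n" "2 \<le> CARD('d)"
    and same: "same_comb_type (zon v n) (zon w n)"
  shows "\<exists>\<rho> s. \<rho> \<in> PiE {..<n} (\<lambda>_. {..<n}) \<and> s \<in> PiE {..<n} (\<lambda>_. {1, -1}) \<and>
    topes w n = signed_permute n \<rho> s ` topes v n"
proof -
  obtain f where f: "bij_betw f {F. F face_of zon v n} {F. F face_of zon w n}"
    "\<forall>F F'. F face_of zon v n \<longrightarrow> F' face_of zon v n \<longrightarrow> (F \<subseteq> F' \<longleftrightarrow> f F \<subseteq> f F')"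
    using same by (rule same_comb_typeE)
  note iso = face_lattice_iso_vertices[OF f]
  let ?V = "{F. is_vertex (zon v n) F}" and ?W = "{F. is_vertex (zon w n) F}"
  have fV: "bij_betw f ?V ?W"
    unfolding bij_betw_def
  proof
    show "inj_on f ?V"
      by (rule inj_on_subset[OF bij_betw_imp_inj_on[OF f(1)]]) (auto simp: is_vertex_def)
    show "f ` ?V = ?W"
    proof (intro equalityI subsetI)
      fix G assume "G \<in> f ` ?V"
      then show "G \<in> ?W" using iso(1) by (auto simp: is_vertex_def[of "zon v n"])
    next
      fix G assume G: "G \<in> ?W"
      then have "G \<in> f ` {F. F face_of zon v n}"
        using bij_betw_imp_surj_on[OF f(1)] by (simp add: is_vertex_def)
      then obtain F where F: "F face_of zon v n" "G = f F" by blast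
      then have "is_vertex (zon v n) F" using iso(1)[OF F(1)] G by simp
      then show "G \<in> f ` ?V" using F(2) by blast
    qed
  qed
  let ?tv = "tope_face v n" and ?tw = "tope_face w n"
  have tv: "bij_betw ?tv (topes v n) ?V" by (rule tope_face_bij[OF v n])
  have tw: "bij_betw ?tw (topes w n) ?W" by (rule tope_face_bij[OF w n])
  define \<phi> where "\<phi> = inv_into (topes w n) ?tw \<circ> (f \<circ> ?tv)"
  have \<phi>: "bij_betw \<phi> (topes v n) (topes w n)"
    unfolding \<phi>_def by (intro bij_betw_trans[OF bij_betw_trans[OF tv fV] bij_betw_inv_into[OF tw]])
  have face: "?tv T face_of zon v n" if "T \<in> topes v n" for T
    using bij_betwE[OF tv] that by (auto simp: is_vertex_def)
  have tw\<phi>: "?tw (\<phi> T) = f (?tv T)" if "T \<in> topes v n" for T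
  proof -
    have "f (?tv T) \<in> ?W" using bij_betwE[OF fV] bij_betwE[OF tv] that by blast
    then show ?thesis unfolding \<phi>_def using bij_betw_inv_into_right[OF tw] by simp
  qed
  have adj: "sign_dist n S T = 1 \<longleftrightarrow> sign_dist n (\<phi> S) (\<phi> T) = 1"
    if S: "S \<in> topes v n" and T: "T \<in> topes v n" for S T
  proof -
    have "\<phi> S \<in> topes w n" "\<phi> T \<in> topes w n" using bij_betwE[OF \<phi>] S T by auto
    from adjacent_tope_face[OF w n this]
    show ?thesis using adjacent_tope_face[OF v n S T] iso(2)[OF face[OF S] face[OF T]]
      by (simp add: tw\<phi> S T)
  qed
  show ?thesis
    by (rule adjacency_bijection_signed_permute[OF topes_subset_sign_vectors topes_subset_sign_vectors \<phi>
      topes_gated[OF v n] topes_gated[OF w n] adj topes_walls[OF v n]])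
qed

section \<open>Labelled tope systems against combinatorial types\<close>

definition tope_systems :: "'d::finite itself \<Rightarrow> nat \<Rightarrow> (nat \<Rightarrow> real) set set" where
  "tope_systems _ n = {topes v n | v :: nat \<Rightarrow> real^'d. uniform v n}"

lemma finite_sign_vectors: "finite (sign_vectors n)"
proof (rule finite_subset)
  show "sign_vectors n \<subseteq> (\<lambda>f i. if i < n then f i else 0) ` PiE {..<n} (\<lambda>_. {1, -1 :: real})"
  proof
    fix T assume T: "T \<in> sign_vectors n"
    then have "T = (\<lambda>i. if i < n then restrict T {..<n} i else 0)"
      by (auto simp: sign_vectors_def fun_eq_iff)
    moreover have "restrict T {..<n} \<in> PiE {..<n} (\<lambda>_. {1, -1})" using T by (auto simp: sign_vectors_def)
    ultimately show "T \<in> (\<lambda>f i. if i < n then f i else 0) ` PiE {..<n} (\<lambda>_. {1, -1})" by blast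
  qed
qed (intro finite_imageI finite_PiE, auto)

lemma finite_tope_systems: "finite (tope_systems D n)"
  by (rule finite_subset[of _ "Pow (sign_vectors n)"])
    (use topes_subset_sign_vectors finite_sign_vectors in \<open>auto simp: tope_systems_def\<close>)

text \<open>Within one class every tope system is a signed relabelling of that of a fixed
  representative. Counting all maps \<rho> instead of permutations gives n ^ n, which exceeds n! by
  at most a factor exp n.\<close>

lemma tope_systems_le_zcount:
  assumes "2 \<le> CARD('d::finite)" "CARD('d) \<le> n"
  shows "card (tope_systems TYPE('d) n) \<le> zcount TYPE('d) n * (n ^ n * 2 ^ n)"
proof -
  let ?Z = "zonotopes_dim TYPE('d) n" and ?R = "comb_type_rel TYPE('d) n"
  define \<P> where "\<P> = PiE {..<n} (\<lambda>_. {..<n}) \<times> PiE {..<n} (\<lambda>_. {1, -1 :: real})"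
  have finP: "finite \<P>" by (auto simp: \<P>_def intro!: finite_PiE)
  have cardP: "card \<P> = n ^ n * 2 ^ n" by (simp add: \<P>_def card_cartesian_product card_PiE numeral_2_eq_2)
  define base where "base C = (SOME v :: nat \<Rightarrow> real^'d. uniform v n \<and> C = ?R `` {zon v n})" for C
  have zon_in: "zon v n \<in> ?Z" if "uniform v n" for v :: "nat \<Rightarrow> real^'d"
    using uniform_in_zonotopes_dim[OF that assms(2,1)] assms by simp
  have "tope_systems TYPE('d) n \<subseteq> (\<lambda>(C, \<rho>, s). signed_permute n \<rho> s ` topes (base C) n) ` ((?Z // ?R) \<times> \<P>)"
  proof
    fix \<tau> assume "\<tau> \<in> tope_systems TYPE('d) n"
    then obtain v :: "nat \<Rightarrow> real^'d" where v: "uniform v n" "\<tau> = topes v n" by (auto simp: tope_systems_def)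
    define C where "C = ?R `` {zon v n}"
    have C: "C \<in> ?Z // ?R" unfolding C_def by (rule quotientI[OF zon_in[OF v(1)]])
    have base: "uniform (base C) n \<and> C = ?R `` {zon (base C) n}"
      unfolding base_def by (rule someI[of _ v]) (simp add: v C_def)
    then have "same_comb_type (zon (base C) n) (zon v n)"
      using comb_type_class_eq_iff[OF zon_in zon_in, of "base C" v] v(1) C_def by simp
    from same_comb_type_signed_permute[OF conjunct1[OF base] v(1) assms(2,1) this]
    obtain \<rho> s where \<rho>s: "(\<rho>, s) \<in> \<P>" "\<tau> = signed_permute n \<rho> s ` topes (base C) n"
      unfolding v(2) \<P>_def by blast
    then show "\<tau> \<in> (\<lambda>(C, \<rho>, s). signed_permute n \<rho> s ` topes (base C) n) ` ((?Z // ?R) \<times> \<P>)"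
      using C by (intro image_eqI[of _ _ "(C, \<rho>, s)"]) auto
  qed
  then have "card (tope_systems TYPE('d) n) \<le> card ((?Z // ?R) \<times> \<P>)"
    by (rule surj_card_le[OF finite_cartesian_product[OF zcount_upper_bound(1)[OF assms(1)] finP]])
  also have "\<dots> = zcount TYPE('d) n * (n ^ n * 2 ^ n)"
    by (simp add: card_cartesian_product zcount_eq cardP)
  finally show ?thesis .
qed

section \<open>Extensions of generic configurations\<close>

definition line_poly :: "((nat \<Rightarrow> 'a::real_vector) \<Rightarrow> real) \<Rightarrow> bool" where
  "line_poly P \<longleftrightarrow> (\<forall>v w. \<exists>q. \<forall>t. P (\<lambda>i. v i + t *\<^sub>R w i) = poly q t)"

lemma line_poly_const: "line_poly (\<lambda>v. c)"
  unfolding line_poly_def by (intro allI exI[of _ "[:c:]"]) simp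

lemma line_poly_coord: "line_poly (\<lambda>v :: nat \<Rightarrow> real^'d. v i $ b)"
  unfolding line_poly_def
proof (intro allI)
  fix v w :: "nat \<Rightarrow> real^'d"
  show "\<exists>q. \<forall>t. (v i + t *\<^sub>R w i) $ b = poly q t"
    by (rule exI[of _ "[:v i $ b, w i $ b:]"]) simp
qed

lemma line_poly_add:
  assumes "line_poly P" "line_poly Q"
  shows "line_poly (\<lambda>v. P v + Q v)"
  unfolding line_poly_def
proof (intro allI)
  fix v w
  from assms obtain p q where "\<forall>t. P (\<lambda>i. v i + t *\<^sub>R w i) = poly p t" "\<forall>t. Q (\<lambda>i. v i + t *\<^sub>R w i) = poly q t"
    unfolding line_poly_def by metis
  then show "\<exists>q. \<forall>t. P (\<lambda>i. v i + t *\<^sub>R w i) + Q (\<lambda>i. v i + t *\<^sub>R w i) = poly q t"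
    by (intro exI[of _ "p + q"]) simp
qed

lemma line_poly_mult:
  assumes "line_poly P" "line_poly Q"
  shows "line_poly (\<lambda>v. P v * Q v)"
  unfolding line_poly_def
proof (intro allI)
  fix v w
  from assms obtain p q where "\<forall>t. P (\<lambda>i. v i + t *\<^sub>R w i) = poly p t" "\<forall>t. Q (\<lambda>i. v i + t *\<^sub>R w i) = poly q t"
    unfolding line_poly_def by metis
  then show "\<exists>q. \<forall>t. P (\<lambda>i. v i + t *\<^sub>R w i) * Q (\<lambda>i. v i + t *\<^sub>R w i) = poly q t"
    by (intro exI[of _ "p * q"]) simp
qed

lemma line_poly_sum: "(\<And>i. i \<in> A \<Longrightarrow> line_poly (P i)) \<Longrightarrow> line_poly (\<lambda>v. \<Sum>i\<in>A. P i v)"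
  by (induction A rule: infinite_finite_induct) (auto intro: line_poly_const line_poly_add)

lemma line_poly_prod: "(\<And>i. i \<in> A \<Longrightarrow> line_poly (P i)) \<Longrightarrow> line_poly (\<lambda>v. \<Prod>i\<in>A. P i v)"
  by (induction A rule: infinite_finite_induct) (auto intro: line_poly_const line_poly_mult)

lemma line_poly_det:
  assumes "\<And>a b. line_poly (\<lambda>v. A v $ a $ b)"
  shows "line_poly (\<lambda>v. det (A v :: real^'d^'d::finite))"
  unfolding det_def
  by (intro line_poly_sum line_poly_mult line_poly_const line_poly_prod assms)

lemma poly_eventually_nonzero_at_right:
  fixes q :: "real poly"
  assumes "q \<noteq> 0"
  shows "\<forall>\<^sub>F t in at_right 0. poly q t \<noteq> 0"
proof -
  have "finite {t. poly q t = 0}" by (rule poly_roots_finite[OF assms])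
  from finite_set_avoid[OF this, of 0] obtain d where d: "d > 0" "\<And>t. poly q t = 0 \<Longrightarrow> t \<noteq> 0 \<Longrightarrow> d \<le> dist 0 t"
    by auto
  show ?thesis
    unfolding eventually_at_right_field
  proof (intro exI[of _ d] conjI allI impI notI)
    show False if "0 < t" "t < d" "poly q t = 0" for t using d(2)[of t] that by (simp add: dist_real_def)
  qed (rule d(1))
qed

lemma poly_eventually_same_sgn:
  fixes q :: "real poly"
  assumes "poly q 0 \<noteq> 0"
  shows "\<forall>\<^sub>F t in at_right 0. sgn (poly q t) = sgn (poly q 0)"
proof (rule tendsto_eventually_same_sgn[OF _ assms])
  show "(poly q \<longlongrightarrow> poly q 0) (at_right 0)"
    by (rule tendsto_mono[OF _ isContD[OF poly_isCont]]) (simp add: at_le)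
qed

text \<open>A small move towards a point where one of the vanishing functions is nonzero removes
  this zero and keeps all nonzero signs; then repeat. A polynomial that is nonzero somewhere on the
  line is nonzero at all small positive parameters.\<close>

lemma generic_perturbation:
  fixes \<P> :: "((nat \<Rightarrow> 'a::real_vector) \<Rightarrow> real) set"
  assumes fin: "finite \<P>" and lp: "\<And>P. P \<in> \<P> \<Longrightarrow> line_poly P" and nz: "\<And>P. P \<in> \<P> \<Longrightarrow> \<exists>w. P w \<noteq> 0"
  shows "\<exists>v'. \<forall>P\<in>\<P>. P v' \<noteq> 0 \<and> (P v \<noteq> 0 \<longrightarrow> sgn (P v') = sgn (P v))"
proof (induction "card {P\<in>\<P>. P v = 0}" arbitrary: v rule: less_induct)
  case less
  show ?case
  proof (cases "{P\<in>\<P>. P v = 0} = {}")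
    case True
    then show ?thesis by (intro exI[of _ v]) auto
  next
    case False
    then obtain P0 where P0: "P0 \<in> \<P>" "P0 v = 0" by blast
    obtain w where w: "P0 w \<noteq> 0" using nz[OF P0(1)] by blast
    define l where "l t i = v i + t *\<^sub>R (w i - v i)" for t i
    have l0: "l 0 = v" and l1: "l 1 = w" by (auto simp: l_def)
    have "\<forall>P\<in>\<P>. \<exists>q. \<forall>t. P (l t) = poly q t"
    proof
      fix P assume "P \<in> \<P>"
      from lp[OF this, unfolded line_poly_def, rule_format, of v "\<lambda>i. w i - v i"]
      show "\<exists>q. \<forall>t. P (l t) = poly q t" unfolding l_def[abs_def] .
    qed
    from bchoice[OF this] obtain q where "\<forall>P\<in>\<P>. \<forall>t. P (l t) = poly (q P) t" ..
    then have q: "P (l t) = poly (q P) t" if "P \<in> \<P>" for P t using that by simp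
    have "q P0 \<noteq> 0" using q[OF P0(1), of 1] w l1 by auto
    then have "\<forall>\<^sub>F t in at_right 0. P0 (l t) \<noteq> 0"
      using poly_eventually_nonzero_at_right q[OF P0(1)] by simp
    moreover have "\<forall>\<^sub>F t in at_right 0. \<forall>P\<in>\<P>. P v \<noteq> 0 \<longrightarrow> sgn (P (l t)) = sgn (P v)"
    proof (rule eventually_ball_finite[OF fin], rule ballI)
      fix P assume P: "P \<in> \<P>"
      show "\<forall>\<^sub>F t in at_right 0. P v \<noteq> 0 \<longrightarrow> sgn (P (l t)) = sgn (P v)"
        using poly_eventually_same_sgn[of "q P"] q[OF P] q[OF P, of 0] l0 by (cases "P v = 0") simp_all
    qed
    ultimately have "\<forall>\<^sub>F t in at_right 0. P0 (l t) \<noteq> 0 \<and> (\<forall>P\<in>\<P>. P v \<noteq> 0 \<longrightarrow> sgn (P (l t)) = sgn (P v))"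
      by (rule eventually_conj)
    then obtain t where t: "P0 (l t) \<noteq> 0" "\<forall>P\<in>\<P>. P v \<noteq> 0 \<longrightarrow> sgn (P (l t)) = sgn (P v)"
      using eventually_happens[of _ "at_right (0::real)"] by (auto simp: trivial_limit_at_right_real)
    have keep: "P v \<noteq> 0 \<longrightarrow> P (l t) \<noteq> 0" if "P \<in> \<P>" for P
      using t(2) that by (metis sgn_zero_iff)
    have "{P\<in>\<P>. P (l t) = 0} \<subset> {P\<in>\<P>. P v = 0}"
    proof
      show "{P\<in>\<P>. P (l t) = 0} \<subseteq> {P\<in>\<P>. P v = 0}" using keep by blast
      have "P0 \<in> {P\<in>\<P>. P v = 0}" "P0 \<notin> {P\<in>\<P>. P (l t) = 0}" using P0 t(1) by auto
      then show "{P\<in>\<P>. P (l t) = 0} \<noteq> {P\<in>\<P>. P v = 0}" by blast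
    qed
    then have "card {P\<in>\<P>. P (l t) = 0} < card {P\<in>\<P>. P v = 0}"
      by (intro psubset_card_mono) (use fin in auto)
    from less[OF this] obtain v' where v': "\<forall>P\<in>\<P>. P v' \<noteq> 0 \<and> (P (l t) \<noteq> 0 \<longrightarrow> sgn (P v') = sgn (P (l t)))" ..
    show ?thesis
    proof (intro exI[of _ v'] ballI conjI impI)
      fix P assume P: "P \<in> \<P>"
      show "P v' \<noteq> 0" using v' P by simp
      assume "P v \<noteq> 0"
      then show "sgn (P v') = sgn (P v)" using v' t(2) keep[OF P] P by simp
    qed
  qed
qed

lemma det_rows_dual_basis:
  fixes R :: "'d::finite \<Rightarrow> real^'d"
  assumes "det (\<chi> a. R a) \<noteq> 0"
  shows "\<exists>w. (\<forall>a b. R a \<bullet> w b = (if a = b then 1 else 0)) \<and> (\<forall>y. y = (\<Sum>b\<in>UNIV. (R b \<bullet> y) *\<^sub>R w b))"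
proof -
  have "\<forall>b. \<exists>w. \<forall>a. R a \<bullet> w = (if a = b then 1 else 0)"
    by (intro allI det_rows_solvable assms)
  from choice[OF this] obtain w where w: "\<forall>b a. R a \<bullet> w b = (if a = b then 1 else 0)" ..
  have "y = (\<Sum>b\<in>UNIV. (R b \<bullet> y) *\<^sub>R w b)" for y
  proof -
    let ?z = "y - (\<Sum>b\<in>UNIV. (R b \<bullet> y) *\<^sub>R w b)"
    have "R a \<bullet> ?z = 0" for a
      by (simp add: inner_diff_right inner_sum_right w if_distrib[of "(*) _"] cong: if_cong)
    then have "?z = 0" using assms det_rows_eq_0_iff[of R] by blast
    then show ?thesis by simp
  qed
  then show ?thesis using w by blast
qed

lemma small_perturbation_set:
  fixes S :: "'a::real_inner set"
  assumes "finite S"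
  shows "\<exists>\<delta>>0. \<forall>s\<in>S. sgn (s \<bullet> (u + \<delta> *\<^sub>R w)) = (if s \<bullet> u \<noteq> 0 then sgn (s \<bullet> u) else sgn (s \<bullet> w))"
proof -
  obtain n and v :: "nat \<Rightarrow> 'a" where S: "S = v ` {i. i < n}"
    using finite_imp_nat_seg_image_inj_on[OF assms] by blast
  obtain \<delta> where "\<delta> > 0" "\<forall>i<n. sgn (v i \<bullet> (u + \<delta> *\<^sub>R w)) = (if v i \<bullet> u \<noteq> 0 then sgn (v i \<bullet> u) else sgn (v i \<bullet> w))"
    using small_perturbation[of n v u w] by blast
  then show ?thesis unfolding S by (intro exI[of _ \<delta>]) simp
qed

text \<open>Deletion of the last generator. To extend a tope, tilt its vector towards x, which makes
  the last sign nonzero. Thus the topes of any extension remember those of the configuration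
  extended.\<close>

lemma topes_restrict:
  fixes v :: "nat \<Rightarrow> 'a::euclidean_space"
  assumes "x \<noteq> 0"
  shows "(\<lambda>T. T(k := 0)) ` topes (v(k := x)) (Suc k) = topes v k"
proof (intro equalityI subsetI)
  fix T assume "T \<in> (\<lambda>T. T(k := 0)) ` topes (v(k := x)) (Suc k)"
  then obtain u where u: "T = (covector (v(k := x)) (Suc k) u)(k := 0)" "\<forall>i<Suc k. (v(k := x)) i \<bullet> u \<noteq> 0"
    by (auto simp: topes_def)
  have "T = covector v k u" by (auto simp: u(1) covector_def fun_eq_iff)
  moreover have "\<forall>i<k. v i \<bullet> u \<noteq> 0" using u(2) by (auto simp: less_Suc_eq split: if_splits)
  ultimately show "T \<in> topes v k" unfolding topes_def by blast
next
  fix T assume "T \<in> topes v k"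
  then obtain u where u: "T = covector v k u" "\<forall>i<k. v i \<bullet> u \<noteq> 0" by (auto simp: topes_def)
  obtain \<delta> where \<delta>: "\<forall>i<Suc k. sgn ((v(k := x)) i \<bullet> (u + \<delta> *\<^sub>R x)) =
      (if (v(k := x)) i \<bullet> u \<noteq> 0 then sgn ((v(k := x)) i \<bullet> u) else sgn ((v(k := x)) i \<bullet> x))"
    using small_perturbation[of "Suc k" "v(k := x)" u x] by blast
  let ?u = "u + \<delta> *\<^sub>R x"
  have k: "sgn (x \<bullet> ?u) \<noteq> 0" using \<delta>[rule_format, of k] assms by (simp add: sgn_zero_iff)
  have i: "sgn (v i \<bullet> ?u) = sgn (v i \<bullet> u)" if "i < k" for i
    using \<delta>[rule_format, of i] u(2) that by simp
  have "(v(k := x)) j \<bullet> ?u \<noteq> 0" if "j < Suc k" for j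
  proof (cases "j = k")
    case True
    then show ?thesis using k by (metis fun_upd_same sgn_zero)
  next
    case False
    then have "j < k" using that by simp
    then show ?thesis using i[of j] u(2) False by (metis fun_upd_other sgn_zero_iff)
  qed
  then have "covector (v(k := x)) (Suc k) ?u \<in> topes (v(k := x)) (Suc k)" unfolding topes_def by blast
  moreover have "T = (covector (v(k := x)) (Suc k) ?u)(k := 0)"
    using i by (auto simp: u(1) covector_def fun_eq_iff)
  ultimately show "T \<in> (\<lambda>T. T(k := 0)) ` topes (v(k := x)) (Suc k)" by blast
qed

text \<open>Let \<open>N\<close> be normal to the hyperplane \<open>H\<close> spanned by the \<open>v (J b)\<close>, \<open>b \<noteq> a\<close>. Tilting \<open>N\<close> against the
  coordinates of \<open>x'\<close> along \<open>H\<close> gives a tope that contains the sign of \<open>N\<close> at the last generator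
  and that no functional negative at \<open>x'\<close> can have.\<close>

lemma topes_extension_differ_aux:
  fixes v :: "nat \<Rightarrow> real^'d::finite" and J :: "'d \<Rightarrow> nat"
  assumes unif: "uniform v k" and k: "CARD('d) \<le> k"
    and J: "inj_on J (UNIV - {a})" "\<And>b. b \<noteq> a \<Longrightarrow> J b < k"
    and orth: "\<And>b. b \<noteq> a \<Longrightarrow> v (J b) \<bullet> N = 0"
    and x: "x \<bullet> N > 0" "x' \<bullet> N < 0"
  shows "topes (v(k := x)) (Suc k) \<noteq> topes (v(k := x')) (Suc k)"
proof
  assume eq: "topes (v(k := x)) (Suc k) = topes (v(k := x')) (Suc k)"
  have N0: "N \<noteq> 0" using x by auto
  let ?H = "J ` (UNIV - {a})"
  have cardH: "card ?H = CARD('d) - 1" using J(1) by (simp add: card_image)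
  have zero_set: "{i. i < k \<and> v i \<bullet> N = 0} = ?H"
  proof (rule sym, rule card_subset_eq)
    show "?H \<subseteq> {i. i < k \<and> v i \<bullet> N = 0}" using J(2) orth by auto
    then have "card ?H \<le> card {i. i < k \<and> v i \<bullet> N = 0}" by (intro card_mono) auto
    then show "card ?H = card {i. i < k \<and> v i \<bullet> N = 0}"
      using uniform_zero_set_card[OF unif k N0] cardH by linarith
  qed simp
  have "?H \<subset> {..<k}"
  proof
    show "?H \<subseteq> {..<k}" using J(2) by auto
    have "card ?H < k" using cardH k zero_less_card_finite[where 'a = 'd] by linarith
    then show "?H \<noteq> {..<k}" by auto
  qed
  \<comment> \<open>One further generator completes those spanning the hyperplane to a
    basis.\<close>
  then obtain j0 where j0: "j0 < k" "j0 \<notin> ?H" by auto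
  define J' where "J' = J(a := j0)"
  have J': "inj J'" "\<forall>b. J' b < k"
    using inj_fun_updI[OF J(1) j0(2)] J(2) j0(1) by (simp_all add: J'_def)
  then have det: "det (\<chi> b. v (J' b)) \<noteq> 0" using unif by (simp add: uniform_def)
  obtain w where w: "\<forall>y. y = (\<Sum>b\<in>UNIV. (v (J' b) \<bullet> y) *\<^sub>R w b)"
    using det_rows_dual_basis[OF det] by blast
  define \<gamma> where "\<gamma> b = x' \<bullet> w b" for b
  have x'_expand: "x' \<bullet> y = (\<Sum>b\<in>UNIV. (v (J' b) \<bullet> y) * \<gamma> b)" for y
  proof -
    have "x' \<bullet> y = x' \<bullet> (\<Sum>b\<in>UNIV. (v (J' b) \<bullet> y) *\<^sub>R w b)" using w by metis
    then show ?thesis by (simp add: inner_sum_right \<gamma>_def)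
  qed
  have x'_split: "x' \<bullet> y = (v j0 \<bullet> y) * \<gamma> a + (\<Sum>b\<in>UNIV - {a}. (v (J b) \<bullet> y) * \<gamma> b)" for y
    unfolding x'_expand by (subst sum.remove[of UNIV a]) (simp_all add: J'_def)
  \<comment> \<open>N is orthogonal to all basis vectors except v j0, so this one term carries the
    sign of x' on N.\<close>
  have last: "(v j0 \<bullet> N) * \<gamma> a < 0"
    using x(2) unfolding x'_split by (simp add: orth)
  \<comment> \<open>Along the hyperplane the signs oppose those of \<gamma>; the value 1 merely
    avoids a zero where \<gamma> b = 0.\<close>
  obtain q where q: "\<forall>b. v (J' b) \<bullet> q = (if \<gamma> b = 0 then 1 else - \<gamma> b)"
    using det_rows_solvable[OF det, of "\<lambda>b. if \<gamma> b = 0 then 1 else - \<gamma> b"] by blast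
  obtain \<delta> where \<delta>: "\<forall>i<Suc k. sgn ((v(k := x)) i \<bullet> (N + \<delta> *\<^sub>R q)) =
      (if (v(k := x)) i \<bullet> N \<noteq> 0 then sgn ((v(k := x)) i \<bullet> N) else sgn ((v(k := x)) i \<bullet> q))"
    using small_perturbation[of "Suc k" "v(k := x)" N q] by blast
  define u where "u = N + \<delta> *\<^sub>R q"
  have ux: "sgn (x \<bullet> u) = 1" using \<delta>[rule_format, of k] x(1) by (simp add: u_def)
  have uJ: "sgn (v (J b) \<bullet> u) = (if \<gamma> b = 0 then 1 else - sgn (\<gamma> b))" if b: "b \<noteq> a" for b
  proof -
    have "v (J b) \<bullet> q = (if \<gamma> b = 0 then 1 else - \<gamma> b)" using q[rule_format, of b] b by (simp add: J'_def)
    then show ?thesis using \<delta>[rule_format, of "J b"] J(2)[OF b] orth[OF b] by (simp add: u_def sgn_minus)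
  qed
  have uo: "sgn (v i \<bullet> u) = sgn (v i \<bullet> N) \<and> v i \<bullet> N \<noteq> 0" if i: "i < k" "i \<notin> ?H" for i
  proof -
    have "i \<notin> {i. i < k \<and> v i \<bullet> N = 0}" unfolding zero_set by (rule i(2))
    then show ?thesis using \<delta>[rule_format, of i] i(1) by (simp add: u_def)
  qed
  have "(v(k := x)) i \<bullet> u \<noteq> 0" if "i < Suc k" for i
  proof -
    consider "i = k" | "i < k" "i \<in> ?H" | "i < k" "i \<notin> ?H" using \<open>i < Suc k\<close> by linarith
    then have "sgn ((v(k := x)) i \<bullet> u) \<noteq> 0"
    proof cases
      case 1
      then show ?thesis using ux by simp
    next
      case 2
      then obtain b where "b \<noteq> a" "i = J b" by blast
      then show ?thesis using uJ[of b] 2 by (simp add: sgn_zero_iff)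
    next
      case 3
      then show ?thesis using uo[of i] by (simp add: sgn_zero_iff)
    qed
    then show ?thesis by (simp add: sgn_zero_iff)
  qed
  then have "covector (v(k := x)) (Suc k) u \<in> topes (v(k := x)) (Suc k)" unfolding topes_def by blast
  then obtain u' where u': "covector (v(k := x)) (Suc k) u = covector (v(k := x')) (Suc k) u'"
    unfolding eq by (auto simp: topes_def)
  have "sgn (x' \<bullet> u') = 1" using fun_cong[OF u', of k] ux by (simp add: covector_def)
  then have pos: "x' \<bullet> u' > 0" by (simp add: sgn_1_pos)
  have same: "sgn (v i \<bullet> u') = sgn (v i \<bullet> u)" if "i < k" for i
    using fun_cong[OF u', of i] that by (simp add: covector_def)
  \<comment> \<open>These terms of the expansion of the inner product of x' and u' are nonpositive
    and the remaining one is negative, although the product is positive.\<close>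
  have "(v (J b) \<bullet> u') * \<gamma> b \<le> 0" if b: "b \<noteq> a" for b
  proof (cases "\<gamma> b = 0")
    case False
    then have "sgn ((v (J b) \<bullet> u') * \<gamma> b) = - (sgn (\<gamma> b) * sgn (\<gamma> b))"
      using same[OF J(2)[OF b]] uJ[OF b] by (simp add: sgn_mult)
    then have "sgn ((v (J b) \<bullet> u') * \<gamma> b) = -1" using False by (simp add: sgn_if)
    then show ?thesis by (simp add: sgn_1_neg)
  qed simp
  then have "(\<Sum>b\<in>UNIV - {a}. (v (J b) \<bullet> u') * \<gamma> b) \<le> 0" by (intro sum_nonpos) auto
  moreover have "(v j0 \<bullet> u') * \<gamma> a < 0"
  proof -
    have "sgn ((v j0 \<bullet> u') * \<gamma> a) = sgn ((v j0 \<bullet> N) * \<gamma> a)"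
      using same[OF j0(1)] uo[OF j0] by (simp add: sgn_mult)
    then show ?thesis using last by (metis sgn_1_neg sgn_neg)
  qed
  ultimately show False using pos unfolding x'_split by linarith
qed

lemma topes_extension_differ:
  fixes v :: "nat \<Rightarrow> real^'d::finite" and J :: "'d \<Rightarrow> nat"
  assumes "uniform v k" "CARD('d) \<le> k"
    and "inj_on J (UNIV - {a})" "\<And>b. b \<noteq> a \<Longrightarrow> J b < k"
    and "\<And>b. b \<noteq> a \<Longrightarrow> v (J b) \<bullet> N = 0"
    and x: "x \<bullet> N \<noteq> 0" "x' \<bullet> N \<noteq> 0" "sgn (x \<bullet> N) \<noteq> sgn (x' \<bullet> N)"
  shows "topes (v(k := x)) (Suc k) \<noteq> topes (v(k := x')) (Suc k)"
proof (cases "x \<bullet> N > 0")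
  case True
  then have "x' \<bullet> N < 0" using x by (auto simp: sgn_if split: if_splits)
  from topes_extension_differ_aux[OF assms(1-5) True this] show ?thesis .
next
  case False
  then have "x' \<bullet> N > 0" "x \<bullet> N < 0" using x by (auto simp: sgn_if split: if_splits)
  from topes_extension_differ_aux[OF assms(1-5) this] show ?thesis by simp
qed

section \<open>Vertices of the arrangement, indexed by choices of generators\<close>

lemma row_normal_axis:
  fixes V :: "'d::finite \<Rightarrow> real^'d"
  assumes "\<And>b. b \<noteq> a \<Longrightarrow> \<exists>j. j \<noteq> q \<and> V b = axis j 1"
    and "\<And>j. j \<noteq> q \<Longrightarrow> \<exists>b. b \<noteq> a \<and> V b = axis j 1"
  shows "\<exists>\<kappa>. \<kappa> \<noteq> 0 \<and> row_normal V a = \<kappa> *\<^sub>R axis q 1"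
proof -
  have "\<exists>c. c \<noteq> 0 \<and> (\<forall>x. row_functional V a x = c * (axis q 1 \<bullet> x))"
  proof (rule row_functional_proportional)
    show "V b \<bullet> axis q 1 = 0" if "b \<noteq> a" for b using assms(1)[OF that] by (auto simp: inner_axis) (simp add: axis_def)
    show "w \<in> span {axis q 1}" if w: "\<And>b. b \<noteq> a \<Longrightarrow> V b \<bullet> w = 0" for w
    proof -
      have "w $ j = 0" if "j \<noteq> q" for j
        using assms(2)[OF that] w by (metis cart_eq_inner_axis inner_commute)
      then have "w = (w $ q) *\<^sub>R axis q 1" by (auto simp: vec_eq_iff axis_def)
      then show ?thesis by (metis span_base span_scale singletonI)
    qed
  qed (simp add: axis_eq_0_iff)
  then obtain c where c: "c \<noteq> 0" "\<And>x. row_functional V a x = c * (axis q 1 \<bullet> x)" by blast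
  have "row_normal V a \<bullet> x = (c *\<^sub>R axis q 1) \<bullet> x" for x by (simp add: inner_row_normal c(2))
  from this[of "row_normal V a - c *\<^sub>R axis q 1"]
  have "(row_normal V a - c *\<^sub>R axis q 1) \<bullet> (row_normal V a - c *\<^sub>R axis q 1) = 0"
    unfolding inner_diff_left by linarith
  then have "row_normal V a = c *\<^sub>R axis q 1" by simp
  with c(1) show ?thesis by blast
qed

lemma topes_eq_of_chirotope:
  fixes v w :: "nat \<Rightarrow> real^'d::finite"
  assumes "uniform v n" "uniform w n" "CARD('d) \<le> n"
    and chi: "\<And>J. inj J \<Longrightarrow> (\<And>a. J a < n) \<Longrightarrow> chirotope v J = chirotope w J"
  shows "topes v n = topes w n"
proof -
  have "chirotope x J = 0" if "\<not> inj J" for x :: "nat \<Rightarrow> real^'d" and J :: "'d \<Rightarrow> nat"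
  proof -
    have "\<exists>a b. a \<noteq> b \<and> J a = J b"
    proof (rule ccontr)
      assume "\<nexists>a b. a \<noteq> b \<and> J a = J b"
      then have "inj J" by (intro injI) blast
      with that show False by contradiction
    qed
    then obtain a b where "a \<noteq> b" "J a = J b" by blast
    then have "det (\<chi> a. x (J a)) = 0" by (intro det_identical_rows[of a b]) (auto simp: row_def vec_eq_iff)
    then show ?thesis by (simp add: chirotope_def)
  qed
  then have "chirotope v J = chirotope w J" if "\<And>a. J a < n" for J
    using chi[of J] that by (cases "inj J") simp_all
  then have eq: "range (covector v n) = range (covector w n)"
    by (rule chirotope_determines_covectors[OF uniform_span[OF assms(1,3)] uniform_span[OF assms(2,3)]])
  have "topes x n = {\<sigma> \<in> range (covector x n). \<forall>i<n. \<sigma> i \<noteq> 0}" for x :: "nat \<Rightarrow> real^'d"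
    by (auto simp: topes_def covector_def sgn_zero_iff)
  then show ?thesis using eq by simp
qed

text \<open>The pair (a, b) is slot b of hyperplane a: there are d - 1 hyperplanes with d - 1 slots
  each. The coordinate z is the one normalised to 1 when vertices are viewed as affine
  points.\<close>

definition cross_pairs :: "'d \<Rightarrow> ('d \<times> 'd) set" where
  "cross_pairs z = {(a, b). a \<noteq> z \<and> b \<noteq> a}"

text \<open>Injectivity of \<open>idx\<close> gives every slot its own block of m generators.
  Disjoint blocks make the choices independent and allow witnesses to be prescribed block by
  block.\<close>

locale hyperplane_grid =
  fixes z :: "'d::finite" and idx :: "('d \<times> 'd) \<times> nat \<Rightarrow> nat" and m k :: nat
  assumes inj_idx: "inj_on idx (cross_pairs z \<times> {..<m})"
    and idx_less: "\<And>p. p \<in> cross_pairs z \<times> {..<m} \<Longrightarrow> idx p < k"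
    and d_le_k: "CARD('d) \<le> k"
begin

definition choices :: "('d \<times> 'd \<Rightarrow> nat) set" where
  "choices = PiE (cross_pairs z) (\<lambda>_. {..<m})"

definition grid_normal :: "(nat \<Rightarrow> real^'d) \<Rightarrow> ('d \<times> 'd \<Rightarrow> nat) \<Rightarrow> 'd \<Rightarrow> real^'d" where
  "grid_normal v c a = row_normal (\<lambda>b. v (idx ((a, b), c (a, b)))) a"

text \<open>Row z cuts the line common to the d - 1 hyperplanes with the affine chart; the vertex of
  c is the dual basis vector of this row.\<close>

definition grid_rows :: "(nat \<Rightarrow> real^'d) \<Rightarrow> ('d \<times> 'd \<Rightarrow> nat) \<Rightarrow> 'd \<Rightarrow> real^'d" where
  "grid_rows v c a = (if a = z then axis z 1 else grid_normal v c a)"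

text \<open>If \<open>det_A\<close> is nonzero, the hyperplanes of c meet in exactly one point of
  the chart. If \<open>det_B\<close> is, the sum of the coordinates is not constant on the line
  through that vertex that leaves only hyperplane i. If \<open>det_C\<close> is, hyperplane i of c
  misses the vertex of c'.\<close>

definition det_A where "det_A c v = det (\<chi> a. grid_rows v c a)"
definition det_B where "det_B c i v = det (\<chi> a. if a = i then (\<chi> _. 1) else grid_rows v c a)"
definition det_C where "det_C c c' i v = det (\<chi> a. if a = z then grid_normal v c i else grid_normal v c' a)"

definition generic :: "(nat \<Rightarrow> real^'d) \<Rightarrow> bool" where
  "generic v \<longleftrightarrow> uniform v k \<and> (\<forall>c\<in>choices. det_A c v \<noteq> 0) \<and>
     (\<forall>c\<in>choices. \<forall>i. i \<noteq> z \<longrightarrow> det_B c i v \<noteq> 0) \<and>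
     (\<forall>c\<in>choices. \<forall>c'\<in>choices. \<forall>i b. (i, b) \<in> cross_pairs z \<longrightarrow> c (i, b) \<noteq> c' (i, b) \<longrightarrow> det_C c c' i v \<noteq> 0)"

lemma finite_choices: "finite choices"
  and card_choices: "card choices = m ^ ((CARD('d) - 1) * (CARD('d) - 1))"
proof -
  show "finite choices" unfolding choices_def by (intro finite_PiE) auto
  have "cross_pairs z = Sigma (UNIV - {z}) (\<lambda>a. UNIV - {a})" by (auto simp: cross_pairs_def)
  then have "card (cross_pairs z) = (CARD('d) - 1) * (CARD('d) - 1)"
    by (simp add: card_SigmaI)
  then show "card choices = m ^ ((CARD('d) - 1) * (CARD('d) - 1))"
    unfolding choices_def by (simp add: card_PiE)
qed

lemma choice_less: "c \<in> choices \<Longrightarrow> (a, b) \<in> cross_pairs z \<Longrightarrow> c (a, b) < m"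
  by (auto simp: choices_def)

lemma configuration_on_grid:
  obtains v :: "nat \<Rightarrow> real^'d" where
    "\<forall>p. p \<in> cross_pairs z \<times> {..<m} \<longrightarrow> v (idx p) = h p"
proof -
  have "\<forall>p. p \<in> cross_pairs z \<times> {..<m} \<longrightarrow> h (inv_into (cross_pairs z \<times> {..<m}) idx (idx p)) = h p"
    by (simp add: inv_into_f_f[OF inj_idx])
  then show thesis by (rule that)
qed

lemma line_poly_grid_normal: "line_poly (\<lambda>v. grid_normal v c a $ i)"
proof -
  have "line_poly (\<lambda>v :: nat \<Rightarrow> real^'d. det (\<chi> b. if b = a then axis i 1 else v (idx ((a, b), c (a, b)))))"
  proof (rule line_poly_det)
    fix b j
    show "line_poly (\<lambda>v :: nat \<Rightarrow> real^'d. (\<chi> b. if b = a then axis i 1 else v (idx ((a, b), c (a, b)))) $ b $ j)"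
      by (cases "b = a") (simp_all add: line_poly_const line_poly_coord)
  qed
  then show ?thesis by (simp add: grid_normal_def row_normal_def row_functional_def)
qed

lemma line_poly_grid_rows: "line_poly (\<lambda>v. grid_rows v c a $ i)"
  by (cases "a = z") (simp_all add: grid_rows_def line_poly_const line_poly_grid_normal)

lemma line_poly_det_ABC: "line_poly (det_A c)" "line_poly (det_B c i)" "line_poly (det_C c c' i)"
proof -
  show "line_poly (det_A c)" unfolding det_A_def
    by (rule line_poly_det) (simp add: line_poly_grid_rows)
  show "line_poly (det_B c i)" unfolding det_B_def
  proof (rule line_poly_det)
    fix a b
    show "line_poly (\<lambda>v. (\<chi> a. if a = i then (\<chi> _. 1) else grid_rows v c a) $ a $ b)"
      by (cases "a = i") (simp_all add: line_poly_const line_poly_grid_rows)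
  qed
  show "line_poly (det_C c c' i)" unfolding det_C_def
  proof (rule line_poly_det)
    fix a b
    show "line_poly (\<lambda>v. (\<chi> a. if a = z then grid_normal v c i else grid_normal v c' a) $ a $ b)"
      by (cases "a = z") (simp_all add: line_poly_grid_normal)
  qed
qed

lemma inner_axis_1: "axis j 1 \<bullet> x = x $ j" for x :: "real^'d"
  by (simp add: inner_axis inner_commute)

text \<open>If every slot b holds the axis b, hyperplane a is the coordinate hyperplane orthogonal
  to the axis a, for all choices at once.\<close>

lemma standard_witness:
  "\<exists>v. \<forall>c\<in>choices. \<forall>a. a \<noteq> z \<longrightarrow> (\<exists>\<kappa>. \<kappa> \<noteq> 0 \<and> grid_normal v c a = \<kappa> *\<^sub>R axis a 1)"
proof -
  obtain v :: "nat \<Rightarrow> real^'d" where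
    v: "\<forall>p. p \<in> cross_pairs z \<times> {..<m} \<longrightarrow> v (idx p) = axis (snd (fst p)) 1"
    by (rule configuration_on_grid)
  have "\<exists>\<kappa>. \<kappa> \<noteq> 0 \<and> grid_normal v c a = \<kappa> *\<^sub>R axis a 1" if c: "c \<in> choices" and a: "a \<noteq> z" for c a
    unfolding grid_normal_def
  proof (rule row_normal_axis)
    have *: "v (idx ((a, b), c (a, b))) = axis b 1" if "b \<noteq> a" for b
    proof -
      have p: "(a, b) \<in> cross_pairs z" using a that by (simp add: cross_pairs_def)
      then show ?thesis using v[rule_format, of "((a, b), c (a, b))"] choice_less[OF c p] by simp
    qed
    show "\<exists>j. j \<noteq> a \<and> v (idx ((a, b), c (a, b))) = axis j 1" if "b \<noteq> a" for b using * that by blast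
    show "\<exists>b. b \<noteq> a \<and> v (idx ((a, b), c (a, b))) = axis j 1" if "j \<noteq> a" for j using * that by blast
  qed
  then show ?thesis by blast
qed

lemma det_A_witness: "c \<in> choices \<Longrightarrow> \<exists>v. det_A c v \<noteq> 0"
  and det_B_witness: "c \<in> choices \<Longrightarrow> i \<noteq> z \<Longrightarrow> \<exists>v. det_B c i v \<noteq> 0"
proof -
  obtain v where v: "\<forall>c\<in>choices. \<forall>a. a \<noteq> z \<longrightarrow> (\<exists>\<kappa>. \<kappa> \<noteq> 0 \<and> grid_normal v c a = \<kappa> *\<^sub>R axis a 1)"
    using standard_witness ..
  have coord: "x $ a = 0" if c: "c \<in> choices" and 0: "grid_rows v c a \<bullet> x = 0" for c a x
  proof (cases "a = z")
    case True
    then show ?thesis using 0 by (simp add: grid_rows_def inner_axis_1)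
  next
    case False
    then obtain \<kappa> where "\<kappa> \<noteq> 0" "grid_normal v c a = \<kappa> *\<^sub>R axis a 1" using v c by blast
    then show ?thesis using 0 False by (simp add: grid_rows_def inner_axis_1)
  qed
  show "\<exists>v. det_A c v \<noteq> 0" if "c \<in> choices"
  proof
    show "det_A c v \<noteq> 0" unfolding det_A_def det_rows_eq_0_iff
      using coord[OF that] by (auto simp: vec_eq_iff)
  qed
  show "\<exists>v. det_B c i v \<noteq> 0" if c: "c \<in> choices" and "i \<noteq> z"
  proof
    show "det_B c i v \<noteq> 0" unfolding det_B_def det_rows_eq_0_iff
    proof (intro notI, elim exE conjE)
      fix x assume x0: "x \<noteq> 0" and x: "\<forall>a. (if a = i then (\<chi> _. 1) else grid_rows v c a) \<bullet> x = 0"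
      have other: "x $ a = 0" if "a \<noteq> i" for a
        using coord[OF c, of a x] x[rule_format, of a] that by simp
      have "(\<chi> _. 1) \<bullet> x = 0" using x[rule_format, of i] by simp
      then have "(\<Sum>a\<in>UNIV. x $ a) = 0" by (simp add: inner_vec_def)
      moreover have "(\<Sum>a\<in>UNIV. x $ a) = x $ i"
        by (subst sum.remove[of UNIV i]) (auto intro: sum.neutral other)
      ultimately have "x $ a = 0" for a using other by (cases "a = i") auto
      then show False using x0 by (simp add: vec_eq_iff)
    qed
  qed
qed

text \<open>As the choices differ in slot b0 of hyperplane i, this slot can hold different vectors
  for c and c'. Hyperplane i is made orthogonal to axis i for c' but to axis z for c, so the rows of
  the determinant become multiples of all the axes.\<close>

lemma det_C_witness:
  assumes c: "c \<in> choices" and c': "c' \<in> choices" and ib: "(i, b0) \<in> cross_pairs z" and ne: "c (i, b0) \<noteq> c' (i, b0)"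
  shows "\<exists>v. det_C c c' i v \<noteq> 0"
proof -
  have i: "i \<noteq> z" "b0 \<noteq> i" using ib by (auto simp: cross_pairs_def)
  \<comment> \<open>Swapping z and b0 in row i puts axis z into slot b0; replacing it there by axis
    i, for c only, leaves axis z as the missing one.\<close>
  define \<tau> where "\<tau> b = (if b = b0 then z else if b = z then b0 else b)" for b
  have \<tau>\<tau>: "\<tau> (\<tau> b) = b" for b by (simp add: \<tau>_def)
  have \<tau>i: "\<tau> b = i \<longleftrightarrow> b = i" for b using i by (auto simp: \<tau>_def)
  define h :: "('d \<times> 'd) \<times> nat \<Rightarrow> real^'d" where
    "h = (\<lambda>((a, b), l). if a = i then if b = b0 \<and> l = c (i, b0) then axis i 1 else axis (\<tau> b) 1 else axis b 1)"
  obtain v :: "nat \<Rightarrow> real^'d" where v: "\<forall>p. p \<in> cross_pairs z \<times> {..<m} \<longrightarrow> v (idx p) = h p"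
    by (rule configuration_on_grid)
  have val: "v (idx ((a, b), e (a, b))) = h ((a, b), e (a, b))" if "e \<in> choices" "a \<noteq> z" "b \<noteq> a" for e a b
  proof -
    have p: "(a, b) \<in> cross_pairs z" using that by (simp add: cross_pairs_def)
    then show ?thesis using v[rule_format, of "((a, b), e (a, b))"] choice_less[OF that(1) p] by simp
  qed
  have other: "\<exists>\<kappa>. \<kappa> \<noteq> 0 \<and> grid_normal v c' a = \<kappa> *\<^sub>R axis a 1" if a: "a \<noteq> z" for a
    unfolding grid_normal_def
  proof (rule row_normal_axis)
    have *: "v (idx ((a, b), c' (a, b))) = axis (if a = i then \<tau> b else b) 1" if "b \<noteq> a" for b
      using val[OF c' a that] ne by (auto simp: h_def)
    show "\<exists>j. j \<noteq> a \<and> v (idx ((a, b), c' (a, b))) = axis j 1" if "b \<noteq> a" for b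
      using *[OF that] \<tau>i[of b] that by (cases "a = i") auto
    show "\<exists>b. b \<noteq> a \<and> v (idx ((a, b), c' (a, b))) = axis j 1" if "j \<noteq> a" for j
    proof (cases "a = i")
      case True
      then show ?thesis using *[of "\<tau> j"] \<tau>i[of j] that by (intro exI[of _ "\<tau> j"]) (simp add: \<tau>\<tau>)
    next
      case False
      then show ?thesis using *[of j] that by (intro exI[of _ j]) simp
    qed
  qed
  have "\<exists>\<kappa>. \<kappa> \<noteq> 0 \<and> grid_normal v c i = \<kappa> *\<^sub>R axis z 1"
    unfolding grid_normal_def
  proof (rule row_normal_axis)
    have *: "v (idx ((i, b), c (i, b))) = axis (if b = b0 then i else \<tau> b) 1" if "b \<noteq> i" for b
      using val[OF c i(1) that] by (auto simp: h_def)
    have \<tau>z: "\<tau> b = z \<longleftrightarrow> b = b0" for b by (auto simp: \<tau>_def)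
    show "\<exists>j. j \<noteq> z \<and> v (idx ((i, b), c (i, b))) = axis j 1" if "b \<noteq> i" for b
      using *[OF that] \<tau>z[of b] i(1) by (cases "b = b0") auto
    show "\<exists>b. b \<noteq> i \<and> v (idx ((i, b), c (i, b))) = axis j 1" if "j \<noteq> z" for j
    proof (cases "j = i")
      case True
      then show ?thesis using *[of b0] i by (intro exI[of _ b0]) simp
    next
      case False
      moreover have "\<tau> j \<noteq> b0" using that \<tau>z[of "\<tau> j"] by (simp add: \<tau>\<tau>)
      ultimately show ?thesis using *[of "\<tau> j"] \<tau>i[of j] by (intro exI[of _ "\<tau> j"]) (simp add: \<tau>\<tau>)
    qed
  qed
  then obtain \<kappa>' where \<kappa>': "\<kappa>' \<noteq> 0" "grid_normal v c i = \<kappa>' *\<^sub>R axis z 1" by blast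
  have "det_C c c' i v \<noteq> 0" unfolding det_C_def det_rows_eq_0_iff
  proof (intro notI, elim exE conjE)
    fix x assume x0: "x \<noteq> 0" and x: "\<forall>a. (if a = z then grid_normal v c i else grid_normal v c' a) \<bullet> x = 0"
    have "x $ a = 0" for a
    proof (cases "a = z")
      case True
      then show ?thesis using x[rule_format, of z] \<kappa>' by (simp add: inner_axis_1)
    next
      case False
      then obtain \<kappa> where "\<kappa> \<noteq> 0" "grid_normal v c' a = \<kappa> *\<^sub>R axis a 1" using other by blast
      then show ?thesis using x[rule_format, of a] False by (simp add: inner_axis_1)
    qed
    then show False using x0 by (simp add: vec_eq_iff)
  qed
  then show ?thesis by (intro exI[of _ v])
qed

lemma uniform_witness:
  fixes J :: "'d \<Rightarrow> nat"
  assumes "inj J"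
  shows "\<exists>v :: nat \<Rightarrow> real^'d. det (\<chi> a. v (J a)) \<noteq> 0"
proof
  show "det (\<chi> a. (\<lambda>j. axis (inv J j) 1 :: real^'d) (J a)) \<noteq> 0"
    unfolding det_rows_eq_0_iff using assms by (auto simp: inner_axis_1 vec_eq_iff)
qed

text \<open>Genericity consists of finitely many polynomial inequations, each of them satisfiable.
  The perturbation keeps the signs of the nonzero determinants of v, hence its chirotope and its
  topes.\<close>

lemma generic_exists:
  fixes v :: "nat \<Rightarrow> real^'d"
  assumes "uniform v k"
  shows "\<exists>v'. generic v' \<and> topes v' k = topes v k"
proof -
  let ?U = "(\<lambda>J v. det (\<chi> a. v (J a))) ` {J \<in> index_tuples k. inj J}"
  let ?A = "det_A ` choices"
  let ?B = "(\<lambda>(c, i). det_B c i) ` (choices \<times> (UNIV - {z}))"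
  let ?T = "{(c, c', i). c \<in> choices \<and> c' \<in> choices \<and> (\<exists>b. (i, b) \<in> cross_pairs z \<and> c (i, b) \<noteq> c' (i, b))}"
  let ?C = "(\<lambda>(c, c', i). det_C c c' i) ` ?T"
  let ?P = "?U \<union> ?A \<union> ?B \<union> ?C"
  have "?T \<subseteq> choices \<times> choices \<times> UNIV" by blast
  then have "finite ?T" by (rule finite_subset) (simp add: finite_choices)
  then have fin: "finite ?P" by (simp add: finite_choices finite_index_tuples)
  have lp: "line_poly P" if "P \<in> ?P" for P
    using that line_poly_det_ABC by (auto intro!: line_poly_det simp: line_poly_coord)
  have nz: "\<exists>w. P w \<noteq> 0" if "P \<in> ?P" for P
    using that det_A_witness det_B_witness det_C_witness uniform_witness by fastforce
  obtain v' where v': "\<forall>P\<in>?P. P v' \<noteq> 0 \<and> (P v \<noteq> 0 \<longrightarrow> sgn (P v') = sgn (P v))"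
    using generic_perturbation[OF fin lp nz, of v] by blast
  have det: "det (\<chi> a. v' (J a)) \<noteq> 0 \<and> chirotope v' J = chirotope v J" if J: "inj J" "\<And>a. J a < k" for J
  proof -
    have "det (\<chi> a. v (J a)) \<noteq> 0" using assms J by (simp add: uniform_def)
    moreover have "J \<in> index_tuples k" using J by (simp add: index_tuples_def)
    ultimately show ?thesis using v' J(1) by (auto simp: chirotope_def)
  qed
  have unif: "uniform v' k" unfolding uniform_def using det by simp
  have "generic v'" unfolding generic_def
  proof (intro conjI ballI allI impI unif)
    show "det_A c v' \<noteq> 0" if "c \<in> choices" for c using v' that by blast
    show "det_B c i v' \<noteq> 0" if "c \<in> choices" "i \<noteq> z" for c i using v' that by blast
    fix c c' i b
    assume "c \<in> choices" "c' \<in> choices" "(i, b) \<in> cross_pairs z" "c (i, b) \<noteq> c' (i, b)"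
    then have "(c, c', i) \<in> ?T" by blast
    from imageI[OF this, of "\<lambda>(c, c', i). det_C c c' i"]
    have "det_C c c' i \<in> ?P" unfolding prod.case by (rule UnI2)
    then show "det_C c c' i v' \<noteq> 0" using v' by simp
  qed
  moreover have "topes v' k = topes v k"
    by (rule topes_eq_of_chirotope[OF unif assms d_le_k conjunct2[OF det]])
  ultimately show ?thesis by (intro exI[of _ v'] conjI)
qed

end

text \<open>A point y constructed for its signs may still lie on some hyperplanes spanned by
  generators. It is moved off these without changing the signs it already has.\<close>

lemma uniform_extension:
  fixes v :: "nat \<Rightarrow> real^'d::finite"
  assumes unif: "uniform v k" and k: "CARD('d) \<le> k"
  shows "\<exists>x. uniform (v(k := x)) (Suc k) \<and>
    (\<forall>J. inj J \<longrightarrow> (\<forall>a. J a < Suc k) \<longrightarrow> det (\<chi> a. (v(k := y)) (J a)) \<noteq> 0 \<longrightarrow>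
       sgn (det (\<chi> a. (v(k := x)) (J a))) = sgn (det (\<chi> a. (v(k := y)) (J a))))"
proof -
  \<comment> \<open>Only entry 0 of \<open>V\<close> is read, so that a single moving vector fits
    the form of \<open>generic_perturbation\<close>.\<close>
  define P where "P J V = det (\<chi> a. (v(k := V (0::nat))) (J a))" for J :: "'d \<Rightarrow> nat" and V
  let ?\<J> = "{J \<in> index_tuples (Suc k) :: ('d \<Rightarrow> nat) set. inj J}"
  have fin: "finite (P ` ?\<J>)" by (simp add: finite_index_tuples)
  have lp: "line_poly (P J)" for J
    unfolding P_def
  proof (rule line_poly_det)
    fix a b
    show "line_poly (\<lambda>V. (\<chi> a. (v(k := V (0::nat))) (J a)) $ a $ b)"
      by (cases "J a = k") (simp_all add: line_poly_const line_poly_coord)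
  qed
  have nz: "\<exists>V. P J V \<noteq> 0" if J: "J \<in> ?\<J>" for J
  proof (cases "k \<in> range J")
    case False
    have lt: "J a < k" for a
    proof -
      have "J a < Suc k" using J by (simp add: index_tuples_def)
      moreover have "J a \<noteq> k" using False by blast
      ultimately show ?thesis by simp
    qed
    then have "(v(k := x)) (J a) = v (J a)" for x a using less_irrefl[of k] by auto
    then have "P J V = det (\<chi> a. v (J a))" for V by (simp add: P_def)
    then show ?thesis using unif J lt by (simp add: uniform_def)
  next
    case True
    then obtain a0 where a0: "J a0 = k" by blast
    have injJ: "inj J" using J by simp
    let ?H = "J ` (UNIV - {a0})"
    have Hlt: "J a < k" if "a \<noteq> a0" for a
    proof -
      have "J a < Suc k" using J by (simp add: index_tuples_def)
      moreover have "J a \<noteq> k" using injJ a0 that by (auto dest: injD)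
      ultimately show ?thesis by simp
    qed
    have "card ?H \<le> CARD('d) - 1" using card_image_le[of "UNIV - {a0}" J] by simp
    then have "card ?H < card {..<k}" using k zero_less_card_finite[where 'a = 'd] unfolding card_lessThan by linarith
    then have "\<not> {..<k} \<subseteq> ?H" using card_mono[of ?H "{..<k}"] by auto
    \<comment> \<open>An old generator outside the tuple stands in for the new vector and makes the
      determinant nonzero.\<close>
    then obtain j where j: "j < k" "j \<notin> ?H" by blast
    define J' where "J' = J(a0 := j)"
    have "inj J'" unfolding J'_def
      by (rule inj_fun_updI[OF inj_on_subset[OF injJ subset_UNIV] j(2)])
    moreover have "\<forall>a. J' a < k" using Hlt j(1) by (simp add: J'_def)
    ultimately have "det (\<chi> a. v (J' a)) \<noteq> 0" using unif by (simp add: uniform_def)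
    moreover have "(v(k := v j)) (J a) = v (J' a)" for a
      using Hlt[of a] a0 by (cases "a = a0") (auto simp: J'_def)
    ultimately have "P J (\<lambda>_. v j) \<noteq> 0" by (simp add: P_def)
    then show ?thesis by (intro exI[of _ "\<lambda>_. v j"])
  qed
  have lp': "line_poly p" if "p \<in> P ` ?\<J>" for p using that lp by blast
  have nz': "\<exists>V. p V \<noteq> 0" if "p \<in> P ` ?\<J>" for p using that nz by blast
  have "\<exists>V. \<forall>p\<in>P ` ?\<J>. p V \<noteq> 0 \<and> (p (\<lambda>_. y) \<noteq> 0 \<longrightarrow> sgn (p V) = sgn (p (\<lambda>_. y)))"
    by (rule generic_perturbation[OF fin]) (erule lp' nz')+
  then obtain V where V: "\<forall>p\<in>P ` ?\<J>. p V \<noteq> 0 \<and> (p (\<lambda>_. y) \<noteq> 0 \<longrightarrow> sgn (p V) = sgn (p (\<lambda>_. y)))" ..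
  have V': "P J V \<noteq> 0 \<and> (P J (\<lambda>_. y) \<noteq> 0 \<longrightarrow> sgn (P J V) = sgn (P J (\<lambda>_. y)))"
    if "inj J" "\<forall>a. J a < Suc k" for J
    using V that by (simp add: index_tuples_def)
  then show ?thesis
    unfolding P_def uniform_def by (intro exI[of _ "V 0"]) simp
qed

context hyperplane_grid
begin

lemma grid_index:
  assumes c: "c \<in> choices" and a: "a \<noteq> z"
  shows "inj_on (\<lambda>b. idx ((a, b), c (a, b))) (UNIV - {a})"
    and "b \<noteq> a \<Longrightarrow> idx ((a, b), c (a, b)) < k"
proof -
  have mem: "((a, b), c (a, b)) \<in> cross_pairs z \<times> {..<m}" if "b \<noteq> a" for b
  proof -
    have "(a, b) \<in> cross_pairs z" using a that by (simp add: cross_pairs_def)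
    then show ?thesis using choice_less[OF c] by simp
  qed
  show "inj_on (\<lambda>b. idx ((a, b), c (a, b))) (UNIV - {a})"
  proof (rule inj_onI)
    fix b b' assume "b \<in> UNIV - {a}" "b' \<in> UNIV - {a}" "idx ((a, b), c (a, b)) = idx ((a, b'), c (a, b'))"
    then show "b = b'" using inj_onD[OF inj_idx _ mem mem] by simp
  qed
  show "b \<noteq> a \<Longrightarrow> idx ((a, b), c (a, b)) < k" by (rule idx_less[OF mem])
qed

text \<open>The side of a hyperplane on which the new vector lies is the sign of a determinant of
  the extended configuration, which \<open>uniform_extension\<close> controls.\<close>

lemma grid_normal_det:
  assumes c: "c \<in> choices" and a: "a \<noteq> z"
  defines "J \<equiv> (\<lambda>b. idx ((a, b), c (a, b)))(a := k)"
  shows "inj J" "\<forall>b. J b < Suc k" "grid_normal v c a \<bullet> x = det (\<chi> b. (v(k := x)) (J b))"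
proof -
  show "inj J" unfolding J_def
    by (rule inj_fun_updI[OF grid_index(1)[OF c a]]) (use grid_index(2)[OF c a] in blast)
  show "\<forall>b. J b < Suc k" using grid_index(2)[OF c a] by (simp add: J_def less_SucI)
  have "(\<chi> b. if b = a then x else v (idx ((a, b), c (a, b)))) = (\<chi> b. (v(k := x)) (J b))"
    using grid_index(2)[OF c a] by (auto simp: vec_eq_iff J_def)
  then show "grid_normal v c a \<bullet> x = det (\<chi> b. (v(k := x)) (J b))"
    by (simp add: grid_normal_def inner_row_normal row_functional_def)
qed

text \<open>The vertex \<open>p c\<close> of the arrangement is the minimum of the linear functional \<open>\<mu>\<close> over the cell
  that contains \<open>x c\<close>; this makes the cells of different vertices different.\<close>

lemma distinct_extensions:
  assumes gen: "generic v"
  shows "\<exists>x. (\<forall>c\<in>choices. uniform (v(k := x c)) (Suc k)) \<and>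
    (\<forall>c\<in>choices. \<forall>c'\<in>choices. c \<noteq> c' \<longrightarrow> topes (v(k := x c)) (Suc k) \<noteq> topes (v(k := x c')) (Suc k))"
proof -
  define \<mu> :: "real^'d" where "\<mu> = (\<chi> _. 1)"
  have unif: "uniform v k" using gen by (simp add: generic_def)
  have "\<forall>c\<in>choices. \<exists>w. (\<forall>a b. grid_rows v c a \<bullet> w b = (if a = b then 1 else 0)) \<and>
      (\<forall>y. y = (\<Sum>b\<in>UNIV. (grid_rows v c b \<bullet> y) *\<^sub>R w b))"
    using gen by (intro ballI det_rows_dual_basis) (simp add: generic_def det_A_def)
  from bchoice[OF this] obtain W where "\<forall>c\<in>choices.
      (\<forall>a b. grid_rows v c a \<bullet> W c b = (if a = b then 1 else 0)) \<and>
      (\<forall>y. y = (\<Sum>b\<in>UNIV. (grid_rows v c b \<bullet> y) *\<^sub>R W c b))" ..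
  then have W: "grid_rows v c a \<bullet> W c b = (if a = b then 1 else 0)"
    and expand: "y = (\<Sum>b\<in>UNIV. (grid_rows v c b \<bullet> y) *\<^sub>R W c b)" if "c \<in> choices" for c a b y
    using that by simp_all
  have WN: "grid_normal v c a \<bullet> W c b = (if a = b then 1 else 0)" if "c \<in> choices" "a \<noteq> z" for c a b
    using W[OF that(1), of a b] that(2) by (simp add: grid_rows_def)
  \<comment> \<open>The vertex of choice c, scaled to have z-coordinate 1.\<close>
  define p where "p c = W c z" for c
  have p_z: "axis z 1 \<bullet> p c = 1" if "c \<in> choices" for c
    using W[OF that, of z z] by (simp add: p_def grid_rows_def)
  have p_N: "grid_normal v c a \<bullet> p c = 0" if "c \<in> choices" "a \<noteq> z" for c a
    using WN[OF that, of z] that(2) by (simp add: p_def)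
  have \<mu>W: "\<mu> \<bullet> W c b \<noteq> 0" if c: "c \<in> choices" and b: "b \<noteq> z" for c b
  proof
    assume 0: "\<mu> \<bullet> W c b = 0"
    have "W c b \<noteq> 0" using W[OF c, of b b] by auto
    moreover have "(if a = b then (\<chi> _. 1) else grid_rows v c a) \<bullet> W c b = 0" for a
      using 0 W[OF c, of a b] by (simp add: \<mu>_def)
    ultimately have "det_B c b v = 0" unfolding det_B_def det_rows_eq_0_iff by (intro exI[of _ "W c b"]) simp
    then show False using gen c b by (simp add: generic_def)
  qed
  have \<mu>_expand: "\<mu> \<bullet> y = (axis z 1 \<bullet> y) * (\<mu> \<bullet> p c) + (\<Sum>b\<in>UNIV - {z}. (grid_normal v c b \<bullet> y) * (\<mu> \<bullet> W c b))"
    if c: "c \<in> choices" for c y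
  proof -
    have "\<mu> \<bullet> y = \<mu> \<bullet> (\<Sum>b\<in>UNIV. (grid_rows v c b \<bullet> y) *\<^sub>R W c b)" using expand[OF c, of y] by simp
    also have "\<dots> = (\<Sum>b\<in>UNIV. (grid_rows v c b \<bullet> y) * (\<mu> \<bullet> W c b))" by (simp add: inner_sum_right)
    also have "\<dots> = (grid_rows v c z \<bullet> y) * (\<mu> \<bullet> W c z) + (\<Sum>b\<in>UNIV - {z}. (grid_rows v c b \<bullet> y) * (\<mu> \<bullet> W c b))"
      by (rule sum.remove) auto
    finally show ?thesis by (simp add: grid_rows_def p_def)
  qed
  \<comment> \<open>The sum of the edge directions at the vertex, each oriented such that \<mu>
    increases.\<close>
  define d where "d c = (\<Sum>b\<in>UNIV - {z}. sgn (\<mu> \<bullet> W c b) *\<^sub>R W c b)" for c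
  have d_N: "grid_normal v c a \<bullet> d c = sgn (\<mu> \<bullet> W c a)" if "c \<in> choices" "a \<noteq> z" for c a
    using that by (simp add: d_def inner_sum_right WN if_distrib[of "(*) _"] cong: if_cong)
  define S where "S = (\<lambda>(c, a). grid_normal v c a) ` (choices \<times> UNIV)"
  have finS: "finite S" by (simp add: S_def finite_choices)
  have "\<forall>c. \<exists>\<delta>>0. \<forall>s\<in>S. sgn (s \<bullet> (p c + \<delta> *\<^sub>R d c)) = (if s \<bullet> p c \<noteq> 0 then sgn (s \<bullet> p c) else sgn (s \<bullet> d c))"
    using small_perturbation_set[OF finS] by simp
  from choice[OF this] obtain \<delta> where \<delta>: "\<And>c s. s \<in> S \<Longrightarrow>
      sgn (s \<bullet> (p c + \<delta> c *\<^sub>R d c)) = (if s \<bullet> p c \<noteq> 0 then sgn (s \<bullet> p c) else sgn (s \<bullet> d c))" by blast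
  \<comment> \<open>By the choice of \<delta>, y c is so close to p c that it lies on the same side
    as p c of every hyperplane missing the vertex.\<close>
  define y where "y c = p c + \<delta> c *\<^sub>R d c" for c
  have S_mem: "grid_normal v c a \<in> S" if "c \<in> choices" for c a
    unfolding S_def by (rule image_eqI[of _ _ "(c, a)"]) (use that in auto)
  have y_own: "sgn (grid_normal v c a \<bullet> y c) = sgn (\<mu> \<bullet> W c a)" if "c \<in> choices" "a \<noteq> z" for c a
    using \<delta>[OF S_mem[OF that(1)], of a c] p_N[OF that] d_N[OF that] by (simp add: y_def)
  have y_other: "sgn (grid_normal v c a \<bullet> y c') = sgn (grid_normal v c a \<bullet> p c')"
    if "c \<in> choices" "grid_normal v c a \<bullet> p c' \<noteq> 0" for c c' a
    using \<delta>[OF S_mem[OF that(1)], of a c'] that(2) by (simp add: y_def)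
  have "\<forall>c. \<exists>x. uniform (v(k := x)) (Suc k) \<and>
    (\<forall>J. inj J \<longrightarrow> (\<forall>a. J a < Suc k) \<longrightarrow> det (\<chi> a. (v(k := y c)) (J a)) \<noteq> 0 \<longrightarrow>
       sgn (det (\<chi> a. (v(k := x)) (J a))) = sgn (det (\<chi> a. (v(k := y c)) (J a))))"
    by (intro allI uniform_extension[OF unif d_le_k])
  from choice[OF this] obtain x where x: "\<forall>c. uniform (v(k := x c)) (Suc k) \<and>
    (\<forall>J. inj J \<longrightarrow> (\<forall>a. J a < Suc k) \<longrightarrow> det (\<chi> a. (v(k := y c)) (J a)) \<noteq> 0 \<longrightarrow>
       sgn (det (\<chi> a. (v(k := x c)) (J a))) = sgn (det (\<chi> a. (v(k := y c)) (J a))))" ..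
  have x_sgn: "sgn (grid_normal v c a \<bullet> x c') = sgn (grid_normal v c a \<bullet> y c')"
    if "c \<in> choices" "a \<noteq> z" "grid_normal v c a \<bullet> y c' \<noteq> 0" for c c' a
  proof -
    note J = grid_normal_det[OF that(1,2)]
    show ?thesis
      using x[THEN spec, of c', THEN conjunct2, rule_format, OF J(1) J(2)[rule_format]] that(3)
      unfolding J(3) by blast
  qed
  have x_nz: "grid_normal v c a \<bullet> x c' \<noteq> 0" if "c \<in> choices" "a \<noteq> z" for c c' a
  proof -
    note J = grid_normal_det[OF that]
    have "uniform (v(k := x c')) (Suc k)" using x by simp
    from this[unfolded uniform_def, rule_format, OF J(1) J(2)[rule_format]]
    show ?thesis unfolding J(3) .
  qed
  \<comment> \<open>If x c and x c' are on the same sides of the hyperplanes of c, then p c' lies in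
    the closed cone at p c over which \<mu> is smallest at p c. By \<open>det_C\<close> it is off
    one of these hyperplanes, so the inequality is strict; exchanging the roles of c and c' gives a
    contradiction.\<close>
  have lower: "\<mu> \<bullet> p c < \<mu> \<bullet> p c'"
    if c: "c \<in> choices" "c' \<in> choices" "c \<noteq> c'"
      and same: "\<And>b. b \<noteq> z \<Longrightarrow> sgn (grid_normal v c b \<bullet> x c) = sgn (grid_normal v c b \<bullet> x c')" for c c'
  proof -
    have pos_term: "(grid_normal v c b \<bullet> p c') * (\<mu> \<bullet> W c b) > 0"
      if b: "b \<noteq> z" "grid_normal v c b \<bullet> p c' \<noteq> 0" for b
    proof -
      have "grid_normal v c b \<bullet> y c \<noteq> 0" using y_own[OF c(1) b(1)] \<mu>W[OF c(1) b(1)] by (metis sgn_zero_iff)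
      then have "sgn (grid_normal v c b \<bullet> x c) = sgn (\<mu> \<bullet> W c b)"
        using x_sgn[OF c(1) b(1)] y_own[OF c(1) b(1)] by simp
      moreover have "grid_normal v c b \<bullet> y c' \<noteq> 0" using y_other[OF c(1) b(2)] b(2) by (metis sgn_zero_iff)
      then have "sgn (grid_normal v c b \<bullet> x c') = sgn (grid_normal v c b \<bullet> p c')"
        using x_sgn[OF c(1) b(1)] y_other[OF c(1) b(2)] by simp
      ultimately have "sgn (grid_normal v c b \<bullet> p c') = sgn (\<mu> \<bullet> W c b)" using same[OF b(1)] by simp
      then have "sgn ((grid_normal v c b \<bullet> p c') * (\<mu> \<bullet> W c b)) = sgn (\<mu> \<bullet> W c b) * sgn (\<mu> \<bullet> W c b)"
        by (simp add: sgn_mult)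
      also have "\<dots> = 1" using \<mu>W[OF c(1) b(1)] by (simp add: sgn_if)
      finally show ?thesis by (simp add: sgn_1_pos)
    qed
    obtain q where q: "q \<in> cross_pairs z" "c q \<noteq> c' q"
    proof -
      have "\<exists>q\<in>cross_pairs z. c q \<noteq> c' q"
      proof (rule ccontr)
        assume "\<not> ?thesis"
        then have "c = c'" using c(1,2) unfolding choices_def by (intro PiE_ext) auto
        with c(3) show False by contradiction
      qed
      then show thesis using that by blast
    qed
    obtain i b where ib: "q = (i, b)" by (cases q)
    have i: "i \<noteq> z" using q(1) by (simp add: ib cross_pairs_def)
    have "grid_normal v c i \<bullet> p c' \<noteq> 0"
    proof
      assume 0: "grid_normal v c i \<bullet> p c' = 0"
      have "p c' \<noteq> 0" using p_z[OF c(2)] by auto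
      moreover have "(if a = z then grid_normal v c i else grid_normal v c' a) \<bullet> p c' = 0" for a
        using 0 p_N[OF c(2)] by simp
      ultimately have "det_C c c' i v = 0" unfolding det_C_def det_rows_eq_0_iff
        by (intro exI[of _ "p c'"]) simp
      then show False using gen c q unfolding ib generic_def by blast
    qed
    then have "(grid_normal v c i \<bullet> p c') * (\<mu> \<bullet> W c i) > 0" by (rule pos_term[OF i])
    moreover have "(grid_normal v c b \<bullet> p c') * (\<mu> \<bullet> W c b) \<ge> 0" if "b \<noteq> z" for b
      using pos_term[OF that] by (cases "grid_normal v c b \<bullet> p c' = 0") auto
    ultimately have "(\<Sum>b\<in>UNIV - {z}. (grid_normal v c b \<bullet> p c') * (\<mu> \<bullet> W c b)) > 0"
      using i by (intro sum_pos2[of _ i]) auto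
    then show ?thesis using \<mu>_expand[OF c(1), of "p c'"] p_z[OF c(2)] by simp
  qed
  have "topes (v(k := x c)) (Suc k) \<noteq> topes (v(k := x c')) (Suc k)"
    if c: "c \<in> choices" "c' \<in> choices" "c \<noteq> c'" for c c'
  proof -
    have "\<exists>e b. e \<in> choices \<and> b \<noteq> z \<and> sgn (grid_normal v e b \<bullet> x c) \<noteq> sgn (grid_normal v e b \<bullet> x c')"
    proof (rule ccontr)
      assume "\<not> ?thesis"
      then have eq: "sgn (grid_normal v e b \<bullet> x c) = sgn (grid_normal v e b \<bullet> x c')"
        if "e \<in> choices" "b \<noteq> z" for e b using that by blast
      have "\<mu> \<bullet> p c < \<mu> \<bullet> p c'" by (rule lower[OF c eq[OF c(1)]])
      moreover have "\<mu> \<bullet> p c' < \<mu> \<bullet> p c" using c by (intro lower) (simp_all add: eq)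
      ultimately show False by simp
    qed
    then obtain e b where e: "e \<in> choices" "b \<noteq> z" "sgn (grid_normal v e b \<bullet> x c) \<noteq> sgn (grid_normal v e b \<bullet> x c')"
      by blast
    let ?J = "\<lambda>b'. idx ((b, b'), e (b, b'))"
    have orth: "v (?J b') \<bullet> grid_normal v e b = 0" if "b' \<noteq> b" for b'
      using row_normal_inner_row[OF that, of "\<lambda>b'. v (?J b')"] by (simp add: grid_normal_def inner_commute)
    show ?thesis
      by (rule topes_extension_differ[OF unif d_le_k grid_index[OF e(1,2)] orth])
        (use x_nz[OF e(1,2)] e(3) in \<open>simp_all add: inner_commute\<close>)
  qed
  then show ?thesis using x by (intro exI[of _ x]) simp
qed

end

text \<open>Extensions of different tope systems differ because deletion of the last generator
  recovers the system; extensions of the same one differ by \<open>distinct_extensions\<close>. The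
  k generators are shared equally among the slots, which explains the division.\<close>

lemma tope_systems_Suc:
  assumes "CARD('d::finite) \<le> k"
  shows "card (tope_systems TYPE('d) k) * (k div ((CARD('d) - 1) * (CARD('d) - 1))) ^ ((CARD('d) - 1) * (CARD('d) - 1))
    \<le> card (tope_systems TYPE('d) (Suc k))"
proof -
  let ?D = "(CARD('d) - 1) * (CARD('d) - 1)"
  define m where "m = k div ?D"
  fix z :: 'd
  have "cross_pairs z = Sigma (UNIV - {z}) (\<lambda>a. UNIV - {a})" by (auto simp: cross_pairs_def)
  then have "card (cross_pairs z \<times> {..<m}) = ?D * m" by (simp add: card_SigmaI card_cartesian_product)
  also have "\<dots> \<le> card {..<k}" by (simp add: m_def)
  finally obtain idx where idx: "idx ` (cross_pairs z \<times> {..<m}) \<subseteq> {..<k}" "inj_on idx (cross_pairs z \<times> {..<m})"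
    using card_le_inj[of "cross_pairs z \<times> {..<m}" "{..<k}"] by auto
  interpret hyperplane_grid z idx m k
    by unfold_locales (use idx assms in auto)
  let ?T = "tope_systems TYPE('d) k"
  have "\<forall>\<tau>\<in>?T. \<exists>v. generic v \<and> topes v k = \<tau>"
    using generic_exists by (auto simp: tope_systems_def)
  from bchoice[OF this] obtain V where V: "\<forall>\<tau>\<in>?T. generic (V \<tau>) \<and> topes (V \<tau>) k = \<tau>" ..
  have "\<forall>\<tau>\<in>?T. \<exists>x. (\<forall>c\<in>choices. uniform ((V \<tau>)(k := x c)) (Suc k)) \<and>
    (\<forall>c\<in>choices. \<forall>c'\<in>choices. c \<noteq> c' \<longrightarrow> topes ((V \<tau>)(k := x c)) (Suc k) \<noteq> topes ((V \<tau>)(k := x c')) (Suc k))"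
    using V by (intro ballI distinct_extensions) simp
  from bchoice[OF this] obtain X where X: "\<forall>\<tau>\<in>?T. (\<forall>c\<in>choices. uniform ((V \<tau>)(k := X \<tau> c)) (Suc k)) \<and>
    (\<forall>c\<in>choices. \<forall>c'\<in>choices. c \<noteq> c' \<longrightarrow> topes ((V \<tau>)(k := X \<tau> c)) (Suc k) \<noteq> topes ((V \<tau>)(k := X \<tau> c')) (Suc k))" ..
  define f where "f = (\<lambda>(\<tau>, c). topes ((V \<tau>)(k := X \<tau> c)) (Suc k))"
  have restrict: "(\<lambda>T. T(k := 0)) ` f (\<tau>, c) = \<tau>" if "\<tau> \<in> ?T" "c \<in> choices" for \<tau> c
  proof -
    have "uniform ((V \<tau>)(k := X \<tau> c)) (Suc k)" using X that by simp
    then have "((V \<tau>)(k := X \<tau> c)) k \<noteq> 0"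
      by (rule uniform_vector_nonzero) (use assms in auto)
    then show ?thesis using V that by (simp add: f_def topes_restrict)
  qed
  have "inj_on f (?T \<times> choices)"
  proof (rule inj_onI)
    fix p q assume p: "p \<in> ?T \<times> choices" and q: "q \<in> ?T \<times> choices" and eq: "f p = f q"
    obtain \<tau> c \<tau>' c' where pq: "p = (\<tau>, c)" "q = (\<tau>', c')" by (metis surj_pair)
    have "\<tau> = \<tau>'" using restrict[of \<tau> c] restrict[of \<tau>' c'] p q eq by (simp add: pq)
    moreover from this have "c = c'" using X p q eq by (auto simp: pq f_def)
    ultimately show "p = q" by (simp add: pq)
  qed
  moreover have "f ` (?T \<times> choices) \<subseteq> tope_systems TYPE('d) (Suc k)"
    using X by (auto simp: f_def tope_systems_def)
  ultimately have "card (?T \<times> choices) \<le> card (tope_systems TYPE('d) (Suc k))"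
    by (rule card_inj_on_le[OF _ _ finite_tope_systems])
  then have "card ?T * m ^ ?D \<le> card (tope_systems TYPE('d) (Suc k))"
    by (simp only: card_cartesian_product card_choices)
  then show ?thesis by (simp only: m_def)
qed

lemma tope_systems_nonempty: "card (tope_systems TYPE('d::finite) k) > 0"
proof -
  let ?\<P> = "(\<lambda>J (v :: nat \<Rightarrow> real^'d). det (\<chi> a. v (J a))) ` {J \<in> index_tuples k. inj J}"
  have "\<exists>v. \<forall>P\<in>?\<P>. P v \<noteq> 0 \<and> (P (\<lambda>_. 0) \<noteq> 0 \<longrightarrow> sgn (P v) = sgn (P (\<lambda>_. 0)))"
  proof (rule generic_perturbation)
    show "finite ?\<P>" by (simp add: finite_index_tuples)
    show "line_poly P" if "P \<in> ?\<P>" for P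
      using that by (auto intro!: line_poly_det simp: line_poly_coord)
    show "\<exists>w. P w \<noteq> 0" if P: "P \<in> ?\<P>" for P
    proof -
      obtain J :: "'d \<Rightarrow> nat" where J: "inj J" "P = (\<lambda>v. det (\<chi> a. v (J a)))" using P by blast
      show ?thesis unfolding J(2)
        by (rule exI[of _ "\<lambda>j. axis (inv J j) 1"])
          (use J(1) in \<open>auto simp: det_rows_eq_0_iff inner_axis inner_commute vec_eq_iff\<close>)
    qed
  qed
  then obtain v where "\<forall>P\<in>?\<P>. P v \<noteq> 0 \<and> (P (\<lambda>_. 0) \<noteq> 0 \<longrightarrow> sgn (P v) = sgn (P (\<lambda>_. 0)))" ..
  then have v: "\<forall>P\<in>?\<P>. P v \<noteq> 0" by simp
  have "uniform v k" unfolding uniform_def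
  proof (intro allI impI)
    fix J :: "'d \<Rightarrow> nat" assume "inj J" "\<forall>a. J a < k"
    then show "det (\<chi> a. v (J a)) \<noteq> 0" using v by (simp add: index_tuples_def)
  qed
  then have "tope_systems TYPE('d) k \<noteq> {}" unfolding tope_systems_def by blast
  then show ?thesis using finite_tope_systems by (simp add: card_gt_0_iff)
qed

section \<open>Asymptotics\<close>

text \<open>Divided by n!, the left side is a single term of the exponential series at n.\<close>

lemma power_self_le_exp_fact: "real n ^ n \<le> exp (real n) * fact n"
proof -
  have "(\<lambda>k. real n ^ k /\<^sub>R fact k) sums exp (real n)" by (rule exp_converges)
  then have "summable (\<lambda>k. real n ^ k /\<^sub>R fact k)" "(\<Sum>k. real n ^ k /\<^sub>R fact k) = exp (real n)"
    by (auto simp: sums_iff)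
  moreover from this(1) have "(\<Sum>k\<in>{n}. real n ^ k /\<^sub>R fact k) \<le> (\<Sum>k. real n ^ k /\<^sub>R fact k)"
    by (rule sum_le_suminf) auto
  ultimately have "real n ^ n / fact n \<le> exp (real n)" by (simp add: divide_inverse mult.commute)
  then show ?thesis by (simp add: pos_divide_le_eq)
qed

lemma ln_fact_ge:
  assumes "n > 0"
  shows "real n * ln (real n) - real n \<le> ln (fact n)"
proof -
  have "ln (real n ^ n) \<le> ln (exp (real n) * fact n)"
    using power_self_le_exp_fact[of n] assms by (subst ln_le_cancel_iff) auto
  then show ?thesis using assms by (simp add: ln_mult ln_realpow)
qed

lemma binomial_le_exp_power:
  assumes "N > 0"
  shows "real (m choose N) \<le> (exp 1 * real m / real N) ^ N"
proof -
  have "real (m choose N) * real N ^ N \<le> real (m choose N) * (exp (real N) * fact N)"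
    by (intro mult_left_mono power_self_le_exp_fact) simp
  also have "\<dots> = exp (real N) * real ((m choose N) * fact N)" by simp
  also have "\<dots> \<le> exp (real N) * real (m ^ N)"
    by (intro mult_left_mono of_nat_mono binomial_fact_pow) simp
  also have "\<dots> = (exp 1 * real m) ^ N" by (simp add: power_mult_distrib exp_of_nat_mult[symmetric])
  finally show ?thesis using assms by (simp add: power_divide pos_le_divide_eq)
qed

text \<open>With N = n (d - 1) and m of order n ^ d, the quotient m / N is of order n ^ (d - 1);
  raised to the power N it gives the exponent (d - 1) ^ 2 n. All other factors are exponential in n
  and go into C.\<close>

lemma chirotope_bound_ln:
  assumes d: "d \<ge> 2"
  shows "\<exists>C. \<forall>n\<ge>1. ln (real (chirotope_bound d n)) \<le> (real d - 1)\<^sup>2 * real n * ln (real n) + C * real n"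
proof -
  define D where "D = d - 1"
  have D: "D \<ge> 1" "real D = real d - 1" using d by (auto simp: D_def)
  \<comment> \<open>Collects the degree d, the constant e of the binomial estimate and d + 3 from m
    \<le> (d + 3) n ^ d.\<close>
  define K where "K = real d * exp 1 * (real d + 3)"
  have "ln (real (chirotope_bound d n)) \<le> (real d - 1)\<^sup>2 * real n * ln (real n) + (ln (2 * real d) + real D * ln K) * real n"
    if n: "n \<ge> 1" for n
  proof -
    define N where "N = n * D"
    define m where "m = N + Suc (2 * n ^ d)"
    have N: "N > 0" "n \<le> N" using n D by (auto simp: N_def)
    have "real m \<le> (real d + 3) * real n ^ d"
    proof -
      have "n \<le> n ^ d" using self_le_power[of n d] n d by simp
      moreover have "D \<le> d" by (simp add: D_def)
      ultimately have "N \<le> d * n ^ d" unfolding N_def using mult_mono[of n "n ^ d" D d] by (simp add: mult.commute)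
      moreover have "1 \<le> n ^ d" using n by simp
      ultimately have "m \<le> (d + 3) * n ^ d" unfolding m_def by (simp add: algebra_simps)
      then have "real m \<le> real ((d + 3) * n ^ d)" by (rule of_nat_mono)
      then show ?thesis by (simp add: algebra_simps)
    qed
    then have "exp 1 * real m / real N \<le> exp 1 * ((real d + 3) * real n ^ d) / real n"
      using N n by (intro frac_le mult_left_mono) auto
    also have "\<dots> = exp 1 * (real d + 3) * real n ^ D"
    proof -
      have "real n ^ d = real n ^ D * real n" using d by (simp add: D_def flip: power_Suc2)
      then show ?thesis using n by simp
    qed
    finally have "(exp 1 * real m / real N) ^ N \<le> (exp 1 * (real d + 3) * real n ^ D) ^ N"
      by (intro power_mono) auto
    then have "real (m choose N) \<le> (exp 1 * (real d + 3) * real n ^ D) ^ N"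
      using binomial_le_exp_power[OF N(1), of m] by linarith
    then have "real (chirotope_bound d n) \<le> (2 * real d) ^ n * (real d ^ N * (exp 1 * (real d + 3) * real n ^ D) ^ N)"
      by (auto simp: chirotope_bound_def N_def m_def D_def intro!: mult_left_mono)
    also have "\<dots> = (2 * real d) ^ n * (K * real n ^ D) ^ N"
      by (simp only: K_def power_mult_distrib mult.assoc)
    finally have le: "real (chirotope_bound d n) \<le> (2 * real d) ^ n * (K * real n ^ D) ^ N" .
    have "0 < chirotope_bound d n"
      using d by (auto simp: chirotope_bound_def)
    then have "ln (real (chirotope_bound d n)) \<le> ln ((2 * real d) ^ n * (K * real n ^ D) ^ N)"
      using le by (subst ln_le_cancel_iff) auto
    also have "\<dots> = real n * ln (2 * real d) + real N * (ln K + real D * ln (real n))"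
    proof -
      have "K > 0" using d by (simp add: K_def)
      then show ?thesis using n d by (simp add: ln_mult ln_realpow distrib_left)
    qed
    also have "\<dots> = (real d - 1)\<^sup>2 * real n * ln (real n) + (ln (2 * real d) + real D * ln K) * real n"
      by (simp add: N_def D(2) power2_eq_square algebra_simps)
    finally show ?thesis .
  qed
  then show ?thesis by blast
qed

text \<open>Multiplying the recursion \<open>tope_systems_Suc\<close> over all sizes gives a
  factorial to the power E up to C ^ n, and \<open>ln_fact_ge\<close> extracts the main
  term.\<close>

lemma tope_systems_ln:
  assumes d: "CARD('d::finite) \<ge> 2"
  shows "\<exists>C. \<forall>\<^sub>F n in at_top. (real CARD('d) - 1)\<^sup>2 * real n * ln (real n) - C * real n
     \<le> ln (real (card (tope_systems TYPE('d) n)))"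
proof -
  define E where "E = (CARD('d) - 1) * (CARD('d) - 1)"
  \<comment> \<open>From k0 on the recursion applies, and n \<ge> E makes n div E at least n / (2
    E).\<close>
  define k0 where "k0 = CARD('d) + E"
  let ?t = "\<lambda>n. real (card (tope_systems TYPE('d) n))"
  have E: "E \<ge> 1" "real E = (real CARD('d) - 1)\<^sup>2"
    using d by (auto simp: E_def power2_eq_square of_nat_diff)
  have step: "?t n * (real n / (2 * real E)) ^ E \<le> ?t (Suc n)" if n: "n \<ge> k0" for n
  proof -
    have q: "n div E \<ge> 1" using n E by (simp add: k0_def div_greater_zero_iff Suc_le_eq)
    have "n < E * (n div E) + E" using E(1) mod_less_divisor[of E n] by (metis Suc_le_eq One_nat_def add_less_cancel_left mult_div_mod_eq)
    also have "\<dots> \<le> 2 * E * (n div E)" using q by (simp add: algebra_simps)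
    finally have "real n \<le> real (2 * E * (n div E))" by (intro of_nat_mono) simp
    then have "real n / (2 * real E) \<le> real (n div E)" using E(1) by (simp add: pos_divide_le_eq mult.commute)
    then have "?t n * (real n / (2 * real E)) ^ E \<le> ?t n * real (n div E) ^ E"
      by (intro mult_left_mono power_mono) auto
    also have "\<dots> = real (card (tope_systems TYPE('d) n) * (n div E) ^ E)" by simp
    also have "\<dots> \<le> ?t (Suc n)"
      using tope_systems_Suc[where 'd = 'd, of n] n by (intro of_nat_mono) (simp add: E_def k0_def)
    finally show ?thesis .
  qed
  have t1: "?t n \<ge> 1" for n using tope_systems_nonempty[where 'd = 'd, of n] by linarith
  have k0: "k0 \<ge> 1" using E by (simp add: k0_def)
  \<comment> \<open>The powers of 2 E come from rounding down. The factor n is there because the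
    recursion multiplies by n where the factorial multiplies by n + 1, and k0! pays for the start of
    the induction.\<close>
  define P where "P n = fact k0 * real n * (2 * real E) ^ n" for n
  have Ppos: "P n > 0" if "n \<ge> k0" for n using that k0 E(1) by (simp add: P_def)
  have main: "fact n ^ E \<le> ?t n * P n ^ E" if "n \<ge> k0" for n
    using that
  proof (induction n rule: dec_induct)
    case base
    have "fact k0 \<le> P k0"
    proof -
      have "1 * 1 \<le> real k0 * (2 * real E) ^ k0" using k0 E by (intro mult_mono one_le_power) auto
      then have "fact k0 * 1 \<le> fact k0 * (real k0 * (2 * real E) ^ k0)" by (intro mult_left_mono) auto
      then show ?thesis by (simp add: P_def mult.assoc)
    qed
    then have "fact k0 ^ E \<le> P k0 ^ E" by (intro power_mono) auto
    also have "\<dots> \<le> ?t k0 * P k0 ^ E"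
      using mult_right_mono[OF t1[of k0], of "P k0 ^ E"] Ppos[of k0] by simp
    finally show ?case .
  next
    case (step n)
    have n0: "real n > 0" using step.hyps k0 by simp
    have "fact (Suc n) ^ E = (real n + 1) ^ E * fact n ^ E" by (simp add: power_mult_distrib add.commute)
    also have "\<dots> \<le> (real n + 1) ^ E * (?t n * P n ^ E)" by (intro mult_left_mono step.IH) auto
    also have "\<dots> = (?t n * (real n / (2 * real E)) ^ E) * P (Suc n) ^ E"
    proof -
      have "(real n + 1) * P n = (real n / (2 * real E)) * P (Suc n)"
        using E(1) by (simp add: P_def)
      then have "(real n + 1) ^ E * P n ^ E = (real n / (2 * real E)) ^ E * P (Suc n) ^ E"
        by (metis power_mult_distrib)
      then show ?thesis by simp
    qed
    also have "\<dots> \<le> ?t (Suc n) * P (Suc n) ^ E"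
      using assms step.hyps Ppos[of "Suc n"]
      by (intro mult_right_mono \<open>\<And>n. n \<ge> k0 \<Longrightarrow> ?t n * (real n / (2 * real E)) ^ E \<le> ?t (Suc n)\<close>) auto
    finally show ?case .
  qed
  define C where "C = real E * (2 + ln (fact k0) + ln (2 * real E))"
  have "real E * real n * ln (real n) - C * real n \<le> ln (?t n)" if n: "n \<ge> k0" for n
  proof -
    have n1: "n \<ge> 1" using n k0 by simp
    have "ln (fact n ^ E) \<le> ln (?t n * P n ^ E)"
      using main[OF n] by (intro ln_mono) auto
    also have "\<dots> = ln (?t n) + real E * ln (P n)"
      using t1[of n] Ppos[OF n] by (simp add: ln_mult ln_realpow)
    finally have "real E * ln (fact n) - real E * ln (P n) \<le> ln (?t n)" by (simp add: ln_realpow)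
    moreover have "ln (P n) \<le> (1 + ln (fact k0) + ln (2 * real E)) * real n"
    proof -
      have "ln (P n) = ln (fact k0) + ln (real n) + real n * ln (2 * real E)"
        using n1 E(1) by (simp add: P_def ln_mult ln_realpow distrib_left)
      moreover have "ln (real n) \<le> real n" using n1 ln_bound[of "real n"] by simp
      moreover have "ln (fact k0) * 1 \<le> ln (fact k0) * real n"
        using n1 by (intro mult_left_mono) (auto simp: ln_ge_zero_iff)
      ultimately show ?thesis by (simp add: algebra_simps)
    qed
    then have "real E * ln (P n) \<le> real E * ((1 + ln (fact k0) + ln (2 * real E)) * real n)"
      by (intro mult_left_mono) auto
    moreover have "real E * (real n * ln (real n) - real n) \<le> real E * ln (fact n)"
      using ln_fact_ge[of n] n1 by (intro mult_left_mono) auto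
    ultimately show ?thesis by (simp add: C_def algebra_simps)
  qed
  then show ?thesis unfolding E(2)[symmetric]
    by (intro exI[of _ C] eventually_at_top_linorderI[of k0])
qed


theorem theorem2p4:
  assumes "CARD('d::finite) \<ge> 2"
  shows "\<exists>f g :: nat \<Rightarrow> real.
     f \<in> O(\<lambda>n. 1 / ln (real n)) \<and>
     g \<in> O(\<lambda>n. ln (ln (real n)) / ln (real n)) \<and>
     (\<forall>\<^sub>F n in at_top.
        real n powr ((real CARD('d)^2 - 2 * real CARD('d)) * real n * (1 + f n))
          \<le> real (zcount TYPE('d) n) \<and>
        real (zcount TYPE('d) n)
          \<le> real n powr ((real CARD('d) - 1)^2 * real n * (1 + g n)))"
proof -
  define d where "d = real CARD('d)"
  let ?z = "\<lambda>n. real (zcount TYPE('d) n)"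
  let ?t = "\<lambda>n. real (card (tope_systems TYPE('d) n))"
  have d: "d \<ge> 2" using assms by (simp add: d_def)
  obtain C1 where C1: "\<forall>\<^sub>F n in at_top. (d - 1)\<^sup>2 * real n * ln (real n) - C1 * real n \<le> ln (?t n)"
    using tope_systems_ln[OF assms] unfolding d_def by (elim exE)
  obtain C2 where C2: "\<forall>n\<ge>1. ln (real (chirotope_bound CARD('d) n)) \<le> (d - 1)\<^sup>2 * real n * ln (real n) + C2 * real n"
    using chirotope_bound_ln[OF assms] unfolding d_def by (elim exE)
  define A where "A = d\<^sup>2 - 2 * d"
  define E where "E = (d - 1)\<^sup>2"
  \<comment> \<open>The relabelling factor n ^ n costs exactly 1 in the exponent.\<close>
  have AE: "A = E - 1" by (simp add: A_def E_def power2_eq_square algebra_simps)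
  have E1: "E \<ge> 1" using power_mono[of 1 "d - 1" 2] d by (simp add: E_def)
  \<comment> \<open>Both error functions express a term linear in n relative to the main term. Even
    g is of order 1 / ln n; since ln (ln n) \<ge> 1 eventually, it has the stated order.\<close>
  define f where "f n = - ((C1 + ln 2) / A) * (1 / ln (real n))" for n
  define g where "g n = (C2 / E) * (1 / ln (real n))" for n
  have lnln: "\<forall>\<^sub>F n in at_top. ln (ln (real n)) \<ge> 1"
  proof -
    have "filterlim (\<lambda>n. ln (ln (real n))) at_top at_top"
      by (intro filterlim_compose[OF ln_at_top] filterlim_real_sequentially)
    then show ?thesis by (simp add: filterlim_at_top)
  qed
  have "f \<in> O(\<lambda>n. 1 / ln (real n))"
    unfolding f_def[abs_def] by (rule bigoI[of _ "\<bar>(C1 + ln 2) / A\<bar>"]) (simp add: abs_mult mult.commute)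
  moreover have "g \<in> O(\<lambda>n. ln (ln (real n)) / ln (real n))"
  proof (rule bigoI[of _ "\<bar>C2 / E\<bar>"], rule eventually_mono[OF lnln])
    fix n assume n: "ln (ln (real n)) \<ge> 1"
    have "\<bar>1 / ln (real n)\<bar> \<le> \<bar>ln (ln (real n)) / ln (real n)\<bar>"
      using n by (simp add: abs_divide divide_right_mono)
    then show "norm (g n) \<le> \<bar>C2 / E\<bar> * norm (ln (ln (real n)) / ln (real n))"
      unfolding g_def by (simp only: real_norm_def abs_mult) (rule mult_left_mono, auto)
  qed
  moreover have "\<forall>\<^sub>F n in at_top. real n powr (A * real n * (1 + f n)) \<le> ?z n \<and> ?z n \<le> real n powr (E * real n * (1 + g n))"
    using C1 eventually_ge_at_top[of "max 2 CARD('d)"]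
  proof eventually_elim
    case (elim n)
    have n: "real n > 1" "CARD('d) \<le> n" using elim(2) by auto
    then have lnn: "ln (real n) > 0" by simp
    have t: "?t n > 0" using tope_systems_nonempty[where 'd = 'd, of n] by simp
    have tz: "?t n \<le> ?z n * (real n ^ n * 2 ^ n)"
      using of_nat_mono[OF tope_systems_le_zcount[OF assms n(2)], where 'a = real] by simp
    have z: "?z n \<ge> 1"
    proof -
      have "zcount TYPE('d) n \<noteq> 0" using tz t by (intro notI) simp
      then show ?thesis by linarith
    qed
    have "ln (?t n) \<le> ln (?z n * (real n ^ n * 2 ^ n))" using tz t by (intro ln_mono) auto
    also have "\<dots> = ln (?z n) + real n * ln (real n) + real n * ln 2"
      using z n by (simp add: ln_mult ln_realpow)
    finally have "A * real n * ln (real n) - (C1 + ln 2) * real n \<le> ln (?z n)"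
      using elim(1) by (simp add: AE E_def algebra_simps)
    then have "A * real n * (1 + f n) * ln (real n) \<le> ln (?z n)"
    proof (cases "A = 0")
      \<comment> \<open>This is d = 2, where the exponent is 0 whatever f is and the bound says that
        some zonotope exists.\<close>
      case True
      then show ?thesis using z by simp
    next
      case False
      have "A * real n * (1 + f n) * ln (real n) = A * real n * ln (real n) + A * real n * (f n * ln (real n))"
        by (simp add: algebra_simps)
      also have "f n * ln (real n) = - ((C1 + ln 2) / A)" using lnn by (simp add: f_def)
      also have "A * real n * (- ((C1 + ln 2) / A)) = - ((C1 + ln 2) * real n)" using False by simp
      finally show ?thesis using \<open>A * real n * ln (real n) - (C1 + ln 2) * real n \<le> ln (?z n)\<close> by linarith
    qed
    then have lower: "real n powr (A * real n * (1 + f n)) \<le> ?z n"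
      using n(1) z by (simp add: powr_def ln_ge_iff)
    have "ln (?z n) \<le> ln (real (chirotope_bound CARD('d) n))"
      using zcount_upper_bound(2)[OF assms, of n] z by (intro ln_mono) auto
    also have "\<dots> \<le> E * real n * ln (real n) + C2 * real n" using C2 n(1) by (simp add: E_def)
    also have "\<dots> = E * real n * (1 + g n) * ln (real n)"
    proof -
      have "E * real n * (1 + g n) * ln (real n) = E * real n * ln (real n) + E * real n * (g n * ln (real n))"
        by (simp add: algebra_simps)
      also have "g n * ln (real n) = C2 / E" using lnn by (simp add: g_def)
      finally show ?thesis using E1 by simp
    qed
    finally have "exp (ln (?z n)) \<le> exp (E * real n * (1 + g n) * ln (real n))" by simp
    then have "?z n \<le> exp (E * real n * (1 + g n) * ln (real n))" using z by simp
    then have upper: "?z n \<le> real n powr (E * real n * (1 + g n))" using n(1) by (simp add: powr_def)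
    from lower upper show ?case ..
  qed
  ultimately show ?thesis unfolding A_def E_def d_def by (intro exI[of _ f] exI[of _ g] conjI)
qed

end
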